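(* Let $n\ge1$. The subalgebra $N$ of $Q_n$ generated by $M$ is isomorphic to the free (tensor) algebra generated by $M$, i.e. the canonical homomorphism $T(M)\to N$ is an isomorphism; and the map $$Q_n(\hat 1)\otimes N\otimes Q_n(1)\to Q_n$$ induced by multiplication is an isomorphism of graded vector spaces.
   Context: Let $F$ be a field. Let $V$ be the $F$-vector space with basis $\{v(A): \emptyset\neq A\subseteq\{1,\dots,n\}\}$, and put $v(\emptyset)=0$. For $A\subseteq\{1,\dots,n\}$ and distinct $i,j\in A$ put $$\mathcal V(A:\{i,j\})=v(A)\bigl(v(A\setminus\{i\})-v(A\setminus\{j\})\bigr)+\bigl(v(A\setminus\{i\})-v(A\setminus\{j\})\bigr)v(A\setminus\{i,j\})-v(A\setminus\{i\})^2+v(A\setminus\{j\})^2 .$$ $Q_n$ is the quotient of the tensor algebra $T(V)$ by the two-sided ideal generated by all these elements; $r(A)$ is the image of $v(A)$; $Q_n$ is graded with $\deg r(A)=1$. $Q_n(\hat 1)$ is the subalgebra generated by $\{r(A):\emptyset\ne A\subseteq\{2,\dots,n\}\}$ and $Q_n(1)$ is the subalgebra generated by $\{r(A):1\in A\subseteq\{1,\dots,n\}\}$. A string is a finite sequence $\mathcal B=(B_1,\dots,B_l)$, $l\ge 0$, of nonempty subsets of $\{1,\dots,n\}$; strings are multiplied by concatenation; $r(\mathcal B)=r(B_1)\cdots r(B_l)$. For nonempty $A=\{a_1>a_2>\dots>a_l\}$ and $1\le j\le|A|$, let $(A:j)$ be the string $(A,\,A\setminus\{a_1\},\,\dots,\,A\setminus\{a_1,\dots,a_{j-1}\})$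 of length $j$. $Y$ is the set of all strings of the form $(A_1:j_1)\cdots(A_s:j_s)$ ($s\ge0$) such that for every $2\le i\le s$, if $A_i\subseteq A_{i-1}$ then $|A_i|\ne|A_{i-1}|-j_{i-1}$. $Y(1)$ is the set of strings $(B_1,\dots,B_l)\in Y$ with $1\in B_i$ for all $i$; $Y(\hat1)$ is the set of strings $(B_1,\dots,B_l)\in Y$ with $B_i\subseteq\{2,\dots,n\}$ for all $i$. A superscript $\circ$ means that the empty string is removed. $M\subseteq Q_n$ is the span of the elements $r(\mathcal B)$ for $\mathcal B\in Y(1)^\circ Y(\hat 1)^\circ\cap Y$, where $Y(1)^\circ Y(\hat 1)^\circ$ is the set of concatenations of a string in $Y(1)^\circ$ with a string in $Y(\hat1)^\circ$. *)

theory Defs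
  imports "HOL-Algebra.QuotRing" "HOL-Algebra.Module" "HOL-Library.Poly_Mapping"
begin

section \<open>Vector spaces and algebras over a field\<close>

text \<open>
  The field is a type \<open>'f\<close> of class \<open>field\<close>. Vector spaces and (noncommutative, unital)
  algebras over it are given by the record type \<open>('f, 'a) module\<close>, with explicit carriers.
  As is usual for that record type, the fields \<open>mult\<close> and \<open>one\<close> carry no information when
  only the vector space structure is meant.
\<close>

inductive_set vspan :: "('f, 'a) module \<Rightarrow> 'a set \<Rightarrow> 'a set"
  for A :: "('f, 'a) module" and S :: "'a set" where
  zero: "\<zero>\<^bsub>A\<^esub> \<in> vspan A S"
| incl: "x \<in> S \<Longrightarrow> x \<in> vspan A S"
| add: "x \<in> vspan A S \<Longrightarrow> y \<in> vspan A S \<Longrightarrow> x \<oplus>\<^bsub>A\<^esub> y \<in> vspan A S"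
| smult: "x \<in> vspan A S \<Longrightarrow> c \<odot>\<^bsub>A\<^esub> x \<in> vspan A S"

inductive_set subalg_gen :: "('f, 'a) module \<Rightarrow> 'a set \<Rightarrow> 'a set"
  for A :: "('f, 'a) module" and S :: "'a set" where
  one: "\<one>\<^bsub>A\<^esub> \<in> subalg_gen A S"
| incl: "x \<in> S \<Longrightarrow> x \<in> subalg_gen A S"
| add: "x \<in> subalg_gen A S \<Longrightarrow> y \<in> subalg_gen A S \<Longrightarrow> x \<oplus>\<^bsub>A\<^esub> y \<in> subalg_gen A S"
| mult: "x \<in> subalg_gen A S \<Longrightarrow> y \<in> subalg_gen A S \<Longrightarrow> x \<otimes>\<^bsub>A\<^esub> y \<in> subalg_gen A S"
| smult: "x \<in> subalg_gen A S \<Longrightarrow> c \<odot>\<^bsub>A\<^esub> x \<in> subalg_gen A S"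

definition sub :: "('f, 'a) module \<Rightarrow> 'a set \<Rightarrow> ('f, 'a) module" where
  "sub A S = A\<lparr>carrier := S\<rparr>"

text \<open>
  The quotient of an algebra by a two-sided ideal: the quotient ring of the library together
  with the induced scalar multiplication. If \<open>A\<close> is only a vector space and \<open>I\<close> a subspace,
  the same cosets, addition and scalar multiplication form the quotient space.
\<close>

definition quot :: "('f, 'a) module \<Rightarrow> 'a set \<Rightarrow> ('f, 'a set) module" where
  "quot A I =
    \<lparr>carrier = carrier (A Quot I), mult = mult (A Quot I), one = one (A Quot I),
     zero = zero (A Quot I), add = add (A Quot I),
     smult = (\<lambda>c X. \<Union>x\<in>X. I +>\<^bsub>A\<^esub> (c \<odot>\<^bsub>A\<^esub> x))\<rparr>"

definition linear_iso :: "('f, 'a) module \<Rightarrow> ('f, 'b) module \<Rightarrow> ('a \<Rightarrow> 'b) \<Rightarrow> bool" where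
  "linear_iso U W h \<longleftrightarrow>
    bij_betw h (carrier U) (carrier W) \<and>
    (\<forall>x\<in>carrier U. \<forall>y\<in>carrier U. h (x \<oplus>\<^bsub>U\<^esub> y) = h x \<oplus>\<^bsub>W\<^esub> h y) \<and>
    (\<forall>c. \<forall>x\<in>carrier U. h (c \<odot>\<^bsub>U\<^esub> x) = c \<odot>\<^bsub>W\<^esub> h x)"

definition algebra_iso :: "('f, 'a) module \<Rightarrow> ('f, 'b) module \<Rightarrow> ('a \<Rightarrow> 'b) \<Rightarrow> bool" where
  "algebra_iso A B h \<longleftrightarrow>
    h \<in> ring_iso A B \<and> (\<forall>c. \<forall>x\<in>carrier A. h (c \<odot>\<^bsub>A\<^esub> x) = c \<odot>\<^bsub>B\<^esub> h x)"

text \<open>A grading is given by its family of homogeneous components.\<close>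

definition graded_iso ::
  "('f, 'a) module \<Rightarrow> (nat \<Rightarrow> 'a set) \<Rightarrow> ('f, 'b) module \<Rightarrow> (nat \<Rightarrow> 'b set) \<Rightarrow> ('a \<Rightarrow> 'b) \<Rightarrow> bool" where
  "graded_iso U gU W gW h \<longleftrightarrow> linear_iso U W h \<and> (\<forall>d. h ` gU d = gW d)"


section \<open>Free vector spaces, free algebras, tensor algebras, tensor products\<close>

definition free_vs :: "'x set \<Rightarrow> ('f::field, 'x \<Rightarrow>\<^sub>0 'f) module" where
  "free_vs X =
    \<lparr>carrier = {p. Poly_Mapping.keys p \<subseteq> X}, mult = undefined, one = undefined,
     zero = 0, add = (+), smult = (\<lambda>c. Poly_Mapping.map ((*) c))\<rparr>"

text \<open>
  Lists form the free monoid (written additively), so that the convolution product on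
  finitely supported functions on lists is the product of noncommutative polynomials.
\<close>

instantiation list :: (type) monoid_add
begin
definition zero_list :: "'a list" where "zero_list = []"
definition plus_list :: "'a list \<Rightarrow> 'a list \<Rightarrow> 'a list" where "plus_list = (@)"
instance by standard (simp_all add: zero_list_def plus_list_def)
end

definition free_alg :: "'x set \<Rightarrow> ('f::field, 'x list \<Rightarrow>\<^sub>0 'f) module" where
  "free_alg X = (free_vs (lists X))\<lparr>mult := (*), one := 1\<rparr>"

abbreviation letter :: "'x \<Rightarrow> ('x list \<Rightarrow>\<^sub>0 'f::field)" where
  "letter x \<equiv> Poly_Mapping.single [x] 1"

text \<open>
  The tensor algebra of a vector space \<open>W\<close>: the free algebra on the set \<open>W\<close> modulo the
  linear relations of \<open>W\<close>.
\<close>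

type_synonym ('f, 'w) tensor = "('w list \<Rightarrow>\<^sub>0 'f) set"

definition tensor_ideal :: "('f::field, 'w) module \<Rightarrow> ('f, 'w) tensor" where
  "tensor_ideal W = genideal (free_alg (carrier W))
    ({letter (x \<oplus>\<^bsub>W\<^esub> y) - letter x - letter y |x y. x \<in> carrier W \<and> y \<in> carrier W} \<union>
     {letter (c \<odot>\<^bsub>W\<^esub> x) - Poly_Mapping.single [x] c |c x. x \<in> carrier W})"

definition tensor_alg :: "('f::field, 'w) module \<Rightarrow> ('f, ('f, 'w) tensor) module" where
  "tensor_alg W = quot (free_alg (carrier W)) (tensor_ideal W)"

definition tensor_incl :: "('f::field, 'w) module \<Rightarrow> 'w \<Rightarrow> ('f, 'w) tensor" where
  "tensor_incl W x = tensor_ideal W +>\<^bsub>free_alg (carrier W)\<^esub> letter x"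

definition bilinear_rels :: "('f::field, 'u) module \<Rightarrow> ('f, 'w) module \<Rightarrow> ('u \<times> 'w \<Rightarrow>\<^sub>0 'f) set" where
  "bilinear_rels U W = vspan (free_vs (carrier U \<times> carrier W))
    ({Poly_Mapping.single (x \<oplus>\<^bsub>U\<^esub> y, w) 1 - Poly_Mapping.single (x, w) 1
        - Poly_Mapping.single (y, w) 1 |x y w.
        x \<in> carrier U \<and> y \<in> carrier U \<and> w \<in> carrier W} \<union>
     {Poly_Mapping.single (u, x \<oplus>\<^bsub>W\<^esub> y) 1 - Poly_Mapping.single (u, x) 1
        - Poly_Mapping.single (u, y) 1 |u x y.
        u \<in> carrier U \<and> x \<in> carrier W \<and> y \<in> carrier W} \<union>
     {Poly_Mapping.single (c \<odot>\<^bsub>U\<^esub> u, w) 1 - Poly_Mapping.single (u, w) c |c u w.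
        u \<in> carrier U \<and> w \<in> carrier W} \<union>
     {Poly_Mapping.single (u, c \<odot>\<^bsub>W\<^esub> w) 1 - Poly_Mapping.single (u, w) c |c u w.
        u \<in> carrier U \<and> w \<in> carrier W})"

definition tensor_prod ::
  "('f::field, 'u) module \<Rightarrow> ('f, 'w) module \<Rightarrow> ('f, ('u \<times> 'w \<Rightarrow>\<^sub>0 'f) set) module" where
  "tensor_prod U W = quot (free_vs (carrier U \<times> carrier W)) (bilinear_rels U W)"

definition pure_tensor ::
  "('f::field, 'u) module \<Rightarrow> ('f, 'w) module \<Rightarrow> 'u \<Rightarrow> 'w \<Rightarrow> ('u \<times> 'w \<Rightarrow>\<^sub>0 'f) set" where
  "pure_tensor U W u w =
    bilinear_rels U W +>\<^bsub>free_vs (carrier U \<times> carrier W)\<^esub> Poly_Mapping.single (u, w) 1"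

definition tensor_grading ::
  "('f::field, 'u) module \<Rightarrow> (nat \<Rightarrow> 'u set) \<Rightarrow> ('f, 'w) module \<Rightarrow> (nat \<Rightarrow> 'w set)
    \<Rightarrow> nat \<Rightarrow> ('u \<times> 'w \<Rightarrow>\<^sub>0 'f) set set" where
  "tensor_grading U gU W gW d =
    vspan (tensor_prod U W) {pure_tensor U W u w |u w i j. u \<in> gU i \<and> w \<in> gW j \<and> i + j = d}"


section \<open>The algebra \<open>Q\<^sub>n\<close>\<close>

definition nonempty_subsets :: "nat \<Rightarrow> nat set set" where
  "nonempty_subsets n = {A. A \<noteq> {} \<and> A \<subseteq> {1..n}}"

definition Vn :: "nat \<Rightarrow> ('f::field, nat set \<Rightarrow>\<^sub>0 'f) module" where
  "Vn n = free_vs (nonempty_subsets n)"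

definition vv :: "nat set \<Rightarrow> (nat set \<Rightarrow>\<^sub>0 'f::field)" where
  "vv A = (if A = {} then 0 else Poly_Mapping.single A 1)"

abbreviation Tn :: "nat \<Rightarrow> ('f::field, ('f, nat set \<Rightarrow>\<^sub>0 'f) tensor) module" where
  "Tn n \<equiv> tensor_alg (Vn n)"

abbreviation tv :: "nat \<Rightarrow> nat set \<Rightarrow> ('f::field, nat set \<Rightarrow>\<^sub>0 'f) tensor" where
  "tv n A \<equiv> tensor_incl (Vn n) (vv A)"

definition rel :: "nat \<Rightarrow> nat set \<Rightarrow> nat \<Rightarrow> nat \<Rightarrow> ('f::field, nat set \<Rightarrow>\<^sub>0 'f) tensor" where
  "rel n A i j =
    (((tv n A \<otimes>\<^bsub>Tn n\<^esub> (tv n (A - {i}) \<ominus>\<^bsub>Tn n\<^esub> tv n (A - {j})))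
      \<oplus>\<^bsub>Tn n\<^esub> ((tv n (A - {i}) \<ominus>\<^bsub>Tn n\<^esub> tv n (A - {j})) \<otimes>\<^bsub>Tn n\<^esub> tv n (A - {i, j})))
      \<ominus>\<^bsub>Tn n\<^esub> (tv n (A - {i}) [^]\<^bsub>Tn n\<^esub> (2::nat)))
      \<oplus>\<^bsub>Tn n\<^esub> (tv n (A - {j}) [^]\<^bsub>Tn n\<^esub> (2::nat))"

type_synonym 'f qel = "('f, nat set \<Rightarrow>\<^sub>0 'f) tensor set"

definition Qn_ideal :: "nat \<Rightarrow> 'f::field qel" where
  "Qn_ideal n =
    genideal (Tn n) {rel n A i j |A i j. A \<subseteq> {1..n} \<and> i \<in> A \<and> j \<in> A \<and> i \<noteq> j}"

definition Qn :: "nat \<Rightarrow> ('f::field, 'f qel) module" where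
  "Qn n = quot (Tn n) (Qn_ideal n)"

definition rr :: "nat \<Rightarrow> nat set \<Rightarrow> 'f::field qel" where
  "rr n A = Qn_ideal n +>\<^bsub>Tn n\<^esub> tv n A"

definition rstr :: "nat \<Rightarrow> nat set list \<Rightarrow> 'f::field qel" where
  "rstr n B = foldr (\<lambda>A x. rr n A \<otimes>\<^bsub>Qn n\<^esub> x) B \<one>\<^bsub>Qn n\<^esub>"

text \<open>The homogeneous component of degree \<open>d\<close> for the grading with all \<open>r(A)\<close> in degree 1.\<close>

definition Qn_deg :: "nat \<Rightarrow> nat \<Rightarrow> 'f::field qel set" where
  "Qn_deg n d = vspan (Qn n) {rstr n B |B. B \<in> lists (nonempty_subsets n) \<and> length B = d}"

definition Qn_hat1 :: "nat \<Rightarrow> 'f::field qel set" where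
  "Qn_hat1 n = subalg_gen (Qn n) {rr n A |A. A \<noteq> {} \<and> A \<subseteq> {2..n}}"

definition Qn_1 :: "nat \<Rightarrow> 'f::field qel set" where
  "Qn_1 n = subalg_gen (Qn n) {rr n A |A. 1 \<in> A \<and> A \<subseteq> {1..n}}"


section \<open>Strings\<close>

text \<open>\<open>chain A j\<close> is \<open>(A : j)\<close>: its entry at position \<open>k < j\<close> is \<open>A\<close> without its \<open>k\<close> largest elements.\<close>

definition chain :: "nat set \<Rightarrow> nat \<Rightarrow> nat set list" where
  "chain A j = map (\<lambda>k. A - set (take k (rev (sorted_list_of_set A)))) [0..<j]"

text \<open>
  The natural number subtraction does not truncate, as \<open>j \<le> card A\<close> for all pairs \<open>(A, j)\<close> in \<open>ps\<close>.
\<close>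

definition Y :: "nat \<Rightarrow> nat set list set" where
  "Y n = {concat (map (\<lambda>(A, j). chain A j) ps) |ps.
    (\<forall>(A, j)\<in>set ps. A \<in> nonempty_subsets n \<and> 1 \<le> j \<and> j \<le> card A) \<and>
    (\<forall>i. Suc i < length ps \<longrightarrow> fst (ps ! Suc i) \<subseteq> fst (ps ! i) \<longrightarrow>
       card (fst (ps ! Suc i)) \<noteq> card (fst (ps ! i)) - snd (ps ! i))}"

definition Y_1 :: "nat \<Rightarrow> nat set list set" where
  "Y_1 n = {B \<in> Y n. \<forall>A\<in>set B. 1 \<in> A}"

definition Y_hat1 :: "nat \<Rightarrow> nat set list set" where
  "Y_hat1 n = {B \<in> Y n. \<forall>A\<in>set B. A \<subseteq> {2..n}}"

definition Mn :: "nat \<Rightarrow> 'f::field qel set" where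
  "Mn n = vspan (Qn n)
    {rstr n B |B. B \<in> {C @ D |C D. C \<in> Y_1 n - {[]} \<and> D \<in> Y_hat1 n - {[]}} \<inter> Y n}"

definition Nn :: "nat \<Rightarrow> 'f::field qel set" where
  "Nn n = subalg_gen (Qn n) (Mn n)"

end

theory Submission
  imports Defs
begin

text \<open>
  For \<open>A = {a\<^sub>1 > a\<^sub>2 > \<dots>}\<close> let \<open>P\<^sub>A(t)\<close> be the product of the factors
  \<open>1 + t (r(A - {a\<^sub>1, \<dots>, a\<^sub>i}) - r(A - {a\<^sub>1, \<dots>, a\<^sub>i\<^sub>+\<^sub>1}))\<close>. The relations of \<open>Q\<^sub>n\<close> say that
  \<open>P\<^sub>A P\<^sub>B\<^sup>-\<^sup>1\<close> is a polynomial of degree at most \<open>|A| - |B|\<close> whenever \<open>B \<subseteq> A\<close>. Reading these conditions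
  as rewriting rules for the coefficients of the \<open>P\<^sub>A\<close> gives a right action of \<open>Q\<^sub>n\<close> on the vector space of
  sequences \<open>(A\<^sub>1 : j\<^sub>1) \<dots> (A\<^sub>s : j\<^sub>s)\<close> without forbidden neighbours, in which \<open>r(\<B>)\<close>, \<open>\<B> \<in> Y\<close>, sends the
  empty sequence to \<open>\<B>\<close> up to terms of smaller weight (the sum of the cardinalities of the entries).
  Hence \<open>r(Y)\<close> is linearly independent. It spans because, modulo smaller weight, \<open>r(A : j) r(B)\<close> equals
  \<open>r(A : j + 1)\<close> for \<open>B \<subseteq> A\<close> with \<open>|B| = |A| - j\<close>; this reduction stays inside any family of sets that is
  convex and closed under removing the largest element, which also gives bases of the two subalgebras.

  The element 1 is the last to be removed from a set, so every \<open>(A : j)\<close> has entries all containing 1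
  or all avoiding 1, and a set containing 1 is never contained in one that avoids it. So each string
  in \<open>Y\<close> factors uniquely into a string of \<open>Y(hat 1)\<close>, a sequence of strings spanning \<open>M\<close>, and a string
  of \<open>Y(1)\<close>, and all such concatenations lie in \<open>Y\<close>.
\<close>

text \<open>In Q_n one has P_A = (1 + t(r(A) - r(A - {i}))) P_{A - {i}} for every i in A, not only
  for the largest. Removing i and j in either order factors P_A over P_{A - {i, j}} in two ways, and
  equality of the coefficients of t^2 is exactly the relation for A and {i, j}. This is where the
  P_A come from, and why a module need only be tested on pairs of sets that differ by one element.

  The relations are homogeneous, so the length of a string cannot drive the reduction; the sum of
  the cardinalities can. Instead of checking that all overlaps of rewriting rules resolve, the
  action is defined by recursion on the word, where only the last letter meets the new set. Its
  consistency is a single divisibility statement, \<open>factors_all\<close>, obtained by dividing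
  one series by P_B and by P_C and comparing degrees.\<close>

abbreviation "keys \<equiv> Poly_Mapping.keys"
abbreviation "lookup \<equiv> Poly_Mapping.lookup"
abbreviation "single \<equiv> Poly_Mapping.single"

section \<open>Linear algebra over records\<close>

locale vecsp = abelian_group V for V :: "('f::field, 'a) module" (structure) +
  assumes smult_closed [simp, intro]: "x \<in> carrier V \<Longrightarrow> c \<odot> x \<in> carrier V"
    and smult_add_left: "x \<in> carrier V \<Longrightarrow> (c + d) \<odot> x = c \<odot> x \<oplus> d \<odot> x"
    and smult_add_right:
      "x \<in> carrier V \<Longrightarrow> y \<in> carrier V \<Longrightarrow> c \<odot> (x \<oplus> y) = c \<odot> x \<oplus> c \<odot> y"
    and smult_smult: "x \<in> carrier V \<Longrightarrow> (c * d) \<odot> x = c \<odot> (d \<odot> x)"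
    and smult_one [simp]: "x \<in> carrier V \<Longrightarrow> 1 \<odot> x = x"
begin

lemma zero_smult [simp]: "x \<in> carrier V \<Longrightarrow> 0 \<odot> x = \<zero>"
  using smult_add_left[of x 0 0] by (metis add.l_cancel_one' add.m_comm add_0 smult_closed)

lemma smult_zero [simp]: "c \<odot> \<zero> = \<zero>"
  using smult_add_right[of \<zero> \<zero> c] by (metis add.l_cancel_one' smult_closed zero_closed l_zero)

lemma minus_one_smult: "x \<in> carrier V \<Longrightarrow> (-1) \<odot> x = \<ominus> x"
  using smult_add_left[of x "-1" 1] by (simp add: minus_equality)

end

definition subspace :: "('f, 'a) module \<Rightarrow> 'a set \<Rightarrow> bool" where
  "subspace V S \<longleftrightarrow> S \<subseteq> carrier V \<and> \<zero>\<^bsub>V\<^esub> \<in> S \<and>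
    (\<forall>x\<in>S. \<forall>y\<in>S. x \<oplus>\<^bsub>V\<^esub> y \<in> S) \<and> (\<forall>c. \<forall>x\<in>S. c \<odot>\<^bsub>V\<^esub> x \<in> S)"

definition linmap :: "('f, 'a) module \<Rightarrow> ('f, 'b) module \<Rightarrow> ('a \<Rightarrow> 'b) \<Rightarrow> bool" where
  "linmap U W h \<longleftrightarrow> (\<forall>x\<in>carrier U. h x \<in> carrier W) \<and>
    (\<forall>x\<in>carrier U. \<forall>y\<in>carrier U. h (x \<oplus>\<^bsub>U\<^esub> y) = h x \<oplus>\<^bsub>W\<^esub> h y) \<and>
    (\<forall>c. \<forall>x\<in>carrier U. h (c \<odot>\<^bsub>U\<^esub> x) = c \<odot>\<^bsub>W\<^esub> h x)"

definition lincomb :: "('f::field, 'a) module \<Rightarrow> ('i \<Rightarrow> 'a) \<Rightarrow> ('i \<Rightarrow>\<^sub>0 'f) \<Rightarrow> 'a" where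
  "lincomb V g p = finsum V (\<lambda>i. lookup p i \<odot>\<^bsub>V\<^esub> g i) (keys p)"

text \<open>The family is indexed by \<open>I\<close> instead of being a set of vectors, so a
  repeated value is already a dependence. Independence over words thus also says that different
  words have different values.\<close>

definition indep :: "('f::field, 'a) module \<Rightarrow> 'i set \<Rightarrow> ('i \<Rightarrow> 'a) \<Rightarrow> bool" where
  "indep V I g \<longleftrightarrow> (\<forall>p. keys p \<subseteq> I \<longrightarrow> lincomb V g p = \<zero>\<^bsub>V\<^esub> \<longrightarrow> p = 0)"

abbreviation scl :: "'f::field \<Rightarrow> ('i \<Rightarrow>\<^sub>0 'f) \<Rightarrow> ('i \<Rightarrow>\<^sub>0 'f)" where
  "scl c \<equiv> Poly_Mapping.map ((*) c)"

lemma lookup_scl [simp]: "lookup (scl c p) k = c * lookup p k"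
  by (simp add: Poly_Mapping.map.rep_eq when_def)

lemma keys_scl: "keys (scl c p) \<subseteq> keys p"
  by (auto simp: in_keys_iff)

lemma scl_single [simp]: "scl c (single k d) = single k (c * d)"
  by (rule poly_mapping_eqI) (simp add: lookup_single when_def)

text \<open>Reduces linear statements to monomials. In the step \<open>k\<close> may already be a
  key of \<open>p\<close>, which is harmless for statements stable under addition.\<close>

lemma keys_subset_induct [consumes 1, case_names zero single_add]:
  assumes "keys p \<subseteq> S" "P 0"
    and "\<And>k c p. k \<in> S \<Longrightarrow> keys p \<subseteq> S \<Longrightarrow> P p \<Longrightarrow> P (single k c + p)"
  shows "P (p :: 'i \<Rightarrow>\<^sub>0 'f::ab_group_add)"
  using assms(1)
proof (induction "card (keys p)" arbitrary: p rule: less_induct)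
  case less
  show ?case
  proof (cases "keys p = {}")
    case True
    then show ?thesis using assms(2) by simp
  next
    case False
    then obtain k where k: "k \<in> keys p" by blast
    define q where "q = p - single k (lookup p k)"
    have l: "lookup q i = (if i = k then 0 else lookup p i)" for i
      by (simp add: q_def lookup_minus lookup_single)
    have kq: "keys q = keys p - {k}"
      by (auto simp: in_keys_iff l split: if_splits)
    have "card (keys q) < card (keys p)"
      unfolding kq using k by (intro card_Diff1_less) auto
    with less kq have "P q" by blast
    then have "P (single k (lookup p k) + q)"
      using k less.prems kq by (intro assms(3)) auto
    then show ?thesis by (simp add: q_def)
  qed
qed

context vecsp
begin

lemma subspaceD:
  assumes "subspace V S"
  shows "x \<in> S \<Longrightarrow> x \<in> carrier V" "\<zero> \<in> S" "x \<in> S \<Longrightarrow> y \<in> S \<Longrightarrow> x \<oplus> y \<in> S"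
    "x \<in> S \<Longrightarrow> c \<odot> x \<in> S" "x \<in> S \<Longrightarrow> \<ominus> x \<in> S" "x \<in> S \<Longrightarrow> y \<in> S \<Longrightarrow> x \<ominus> y \<in> S"
proof -
  show 1: "x \<in> S \<Longrightarrow> x \<in> carrier V" "\<zero> \<in> S" "x \<in> S \<Longrightarrow> c \<odot> x \<in> S" for x c
    using assms by (auto simp: subspace_def)
  show 2: "x \<in> S \<Longrightarrow> y \<in> S \<Longrightarrow> x \<oplus> y \<in> S" for x y
    using assms by (auto simp: subspace_def)
  show 3: "x \<in> S \<Longrightarrow> \<ominus> x \<in> S" for x
    using 1(1)[of x] 1(3)[of x "-1"] by (simp add: minus_one_smult)
  show "x \<in> S \<Longrightarrow> y \<in> S \<Longrightarrow> x \<ominus> y \<in> S"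
    by (simp add: a_minus_def 2 3)
qed

lemma vspan_closed: "S \<subseteq> carrier V \<Longrightarrow> vspan V S \<subseteq> carrier V"
proof
  fix x assume "x \<in> vspan V S" "S \<subseteq> carrier V"
  then show "x \<in> carrier V" by induction auto
qed

lemma subspace_vspan: "S \<subseteq> carrier V \<Longrightarrow> subspace V (vspan V S)"
  using vspan_closed by (auto simp: subspace_def intro: vspan.intros)

lemma vspan_least: assumes "subspace V T" "S \<subseteq> T" shows "vspan V S \<subseteq> T"
proof
  fix x assume "x \<in> vspan V S"
  then show "x \<in> T" by induction (use assms subspaceD in auto)
qed

lemma vspan_mono: "S \<subseteq> T \<Longrightarrow> vspan V S \<subseteq> vspan V T"
proof
  fix x assume "x \<in> vspan V S" "S \<subseteq> T"
  then show "x \<in> vspan V T" by (induction) (auto intro: vspan.intros)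
qed

lemma vecsp_sub: assumes "subspace V S" shows "vecsp (sub V S)"
proof -
  note S = subspaceD[OF assms]
  show ?thesis
  proof (intro vecsp.intro abelian_groupI vecsp_axioms.intro; (simp add: sub_def; fail)?)
    fix x assume "x \<in> carrier (sub V S)"
    then show "\<exists>y\<in>carrier (sub V S). y \<oplus>\<^bsub>sub V S\<^esub> x = \<zero>\<^bsub>sub V S\<^esub>"
      using S(1,5)[of x] by (auto simp: sub_def l_neg intro!: bexI[of _ "\<ominus> x"])
  qed (use S in \<open>auto simp: sub_def smult_add_left smult_add_right smult_smult a_ac\<close>)
qed

lemma lincomb_superset:
  assumes "finite F" "keys p \<subseteq> F" "g ` F \<subseteq> carrier V"
  shows "lincomb V g p = finsum V (\<lambda>i. lookup p i \<odot> g i) F"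
  unfolding lincomb_def
  by (rule add.finprod_mono_neutral_cong_left) (use assms in \<open>auto simp: in_keys_iff\<close>)

lemma lincomb_closed [simp, intro]: "g ` keys p \<subseteq> carrier V \<Longrightarrow> lincomb V g p \<in> carrier V"
  unfolding lincomb_def by (intro finsum_closed) auto

lemma lincomb_zero [simp]: "lincomb V g 0 = \<zero>"
  by (simp add: lincomb_def)

lemma lincomb_single: "g k \<in> carrier V \<Longrightarrow> lincomb V g (single k c) = c \<odot> g k"
  by (subst lincomb_superset[of "{k}"]) (auto split: if_splits)

lemma lincomb_add:
  assumes "g ` keys p \<subseteq> carrier V" "g ` keys q \<subseteq> carrier V"
  shows "lincomb V g (p + q) = lincomb V g p \<oplus> lincomb V g q"
proof -
  let ?F = "keys p \<union> keys q"
  have g: "g ` ?F \<subseteq> carrier V" using assms by auto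
  have "lincomb V g (p + q) = finsum V (\<lambda>i. lookup (p + q) i \<odot> g i) ?F"
    using g keys_add[of p q] by (intro lincomb_superset) auto
  also have "\<dots> = finsum V (\<lambda>i. lookup p i \<odot> g i \<oplus> lookup q i \<odot> g i) ?F"
    using g by (intro finsum_cong') (auto simp: lookup_add smult_add_left)
  also have "\<dots> = lincomb V g p \<oplus> lincomb V g q"
    using g by (subst finsum_addf) (auto simp: lincomb_superset[of ?F])
  finally show ?thesis .
qed

lemma lincomb_scl:
  assumes "g ` keys p \<subseteq> carrier V"
  shows "lincomb V g (scl c p) = c \<odot> lincomb V g p"
proof -
  obtain S where S: "keys p \<subseteq> S" "g ` S \<subseteq> carrier V" using assms by blast
  from S(1) show ?thesis
  proof (induction p rule: keys_subset_induct)
    case (single_add k d q)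
    have "scl c (single k d + q) = single k (c * d) + scl c q"
      by (rule poly_mapping_eqI) (simp add: lookup_add lookup_single when_def algebra_simps)
    moreover have "g ` keys q \<subseteq> carrier V" "g ` keys (scl c q) \<subseteq> carrier V" "g k \<in> carrier V"
      using single_add(1,2) S(2) keys_scl[of c q] by auto
    moreover from this have "g ` keys (single k d) \<subseteq> carrier V" "g ` keys (single k (c * d)) \<subseteq> carrier V"
      by (simp_all del: mult_eq_0_iff)
    ultimately show ?case
      using single_add
      by (simp add: lincomb_add lincomb_single smult_add_right smult_smult del: keys_single)
  next
    case zero
    have "scl c 0 = (0 :: 'b \<Rightarrow>\<^sub>0 'f)" by (rule poly_mapping_eqI) simp
    then show ?case by simp
  qed
qed

lemma lincomb_cong: 
  "g ` keys p \<subseteq> carrier V \<Longrightarrow> (\<And>i. i \<in> keys p \<Longrightarrow> f i = g i) \<Longrightarrow> lincomb V f p = lincomb V g p"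
  unfolding lincomb_def by (intro finsum_cong') auto

lemma lincomb_in_vspan:
  assumes "g ` I \<subseteq> carrier V" "keys p \<subseteq> I"
  shows "lincomb V g p \<in> vspan V (g ` I)"
  using assms(2)
proof (induction p rule: keys_subset_induct)
  case (single_add k c q)
  then have "lincomb V g (single k c + q) = c \<odot> g k \<oplus> lincomb V g q"
    using assms(1) by (subst lincomb_add) (auto simp: lincomb_single split: if_splits)
  then show ?case using single_add by (auto intro: vspan.intros)
qed (auto intro: vspan.intros)

lemma vspan_image:
  assumes "g ` I \<subseteq> carrier V"
  shows "vspan V (g ` I) = {lincomb V g p |p. keys p \<subseteq> I}" (is "_ = ?R")
proof
  show "vspan V (g ` I) \<subseteq> ?R"
  proof
    fix x assume "x \<in> vspan V (g ` I)"
    then show "x \<in> ?R"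
    proof induction
      case zero
      then show ?case by (auto intro!: exI[of _ 0])
    next
      case (incl x)
      then obtain k where "k \<in> I" "x = g k" by auto
      with assms show ?case
        by (auto intro!: exI[of _ "single k 1"] simp: lincomb_single image_subset_iff)
    next
      case (add x y)
      then obtain p q where "keys p \<subseteq> I" "keys q \<subseteq> I" "x = lincomb V g p" "y = lincomb V g q"
        by auto
      moreover from this have "g ` keys p \<subseteq> carrier V" "g ` keys q \<subseteq> carrier V" using assms by auto
      ultimately show ?case using keys_add[of p q]
        by (intro CollectI exI[of _ "p + q"]) (auto simp: lincomb_add)
    next
      case (smult x c)
      then obtain p where "keys p \<subseteq> I" "x = lincomb V g p" by auto
      moreover from this have "g ` keys p \<subseteq> carrier V" using assms by auto
      ultimately show ?case using keys_scl[of c p]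
        by (intro CollectI exI[of _ "scl c p"]) (auto simp: lincomb_scl)
    qed
  qed
qed (use assms lincomb_in_vspan in auto)

lemma indep_reindex:
  fixes I :: "'i set"
  assumes "indep V J f" "h ` I \<subseteq> J" "inj_on h I" "f ` J \<subseteq> carrier V"
  shows "indep V I (\<lambda>i. f (h i))"
  unfolding indep_def
proof (intro allI impI)
  fix p :: "'i \<Rightarrow>\<^sub>0 'f" assume p: "keys p \<subseteq> I" "lincomb V (\<lambda>i. f (h i)) p = \<zero>"
  \<comment> \<open>\<open>q\<close> is the push-forward of \<open>p\<close> along \<open>h\<close>,
    built monomial by monomial. Its values on the image of \<open>h\<close> are recorded because
    they determine \<open>p\<close> once \<open>q\<close> is known to vanish.\<close>
  have ext: "\<exists>q. keys q \<subseteq> h ` I \<and> (\<forall>i\<in>I. lookup q (h i) = lookup p i) \<and>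
      lincomb V f q = lincomb V (\<lambda>i. f (h i)) p"
    using p(1)
  proof (induction p rule: keys_subset_induct)
    case zero
    then show ?case by (intro exI[of _ 0]) auto
  next
    case (single_add k c p)
    then obtain q where q: "keys q \<subseteq> h ` I" "\<forall>i\<in>I. lookup q (h i) = lookup p i"
      "lincomb V f q = lincomb V (\<lambda>i. f (h i)) p" by blast
    have c: "f ` keys q \<subseteq> carrier V" "(\<lambda>i. f (h i)) ` keys p \<subseteq> carrier V" "f (h k) \<in> carrier V"
      using q(1) single_add assms(2,4) by blast+
    have "keys (single (h k) c + q) \<subseteq> h ` I"
      using keys_add[of "single (h k) c" q] q(1) single_add by (auto split: if_splits)
    moreover have "\<forall>i\<in>I. lookup (single (h k) c + q) (h i) =
        lookup (single k c + p) i"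
      using q(2) single_add assms(3) by (auto simp: lookup_add lookup_single when_def inj_on_eq_iff)
    moreover have "lincomb V f (single (h k) c + q) =
        lincomb V (\<lambda>i. f (h i)) (single k c + p)"
      using c q(3) by (subst (1 2) lincomb_add) (auto simp: lincomb_single split: if_splits)
    ultimately show ?case by blast
  qed
  then obtain q where q: "keys q \<subseteq> h ` I" "\<forall>i\<in>I. lookup q (h i) = lookup p i"
    "lincomb V f q = \<zero>" using p(2) by auto
  then have "q = 0" using assms(1,2) unfolding indep_def by blast
  with q(2) p(1) show "p = 0"
    by (intro poly_mapping_eqI) (metis in_keys_iff lookup_zero subsetD)
qed

end

lemma linmapD:
  assumes "linmap U W h"
  shows "x \<in> carrier U \<Longrightarrow> h x \<in> carrier W"
    "x \<in> carrier U \<Longrightarrow> y \<in> carrier U \<Longrightarrow> h (x \<oplus>\<^bsub>U\<^esub> y) = h x \<oplus>\<^bsub>W\<^esub> h y"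
    "x \<in> carrier U \<Longrightarrow> h (c \<odot>\<^bsub>U\<^esub> x) = c \<odot>\<^bsub>W\<^esub> h x"
  using assms by (auto simp: linmap_def)

locale linmap_loc = U: vecsp U + W: vecsp W
  for U :: "('f::field, 'a) module" and W :: "('f, 'b) module" +
  fixes h :: "'a \<Rightarrow> 'b"
  assumes linmap: "linmap U W h"
begin

lemmas h = linmapD[OF linmap]

lemma h_zero [simp]: "h \<zero>\<^bsub>U\<^esub> = \<zero>\<^bsub>W\<^esub>"
  using h(3)[of "\<zero>\<^bsub>U\<^esub>" 0] h(1)[of "\<zero>\<^bsub>U\<^esub>"] by simp

lemma h_neg: "x \<in> carrier U \<Longrightarrow> h (\<ominus>\<^bsub>U\<^esub> x) = \<ominus>\<^bsub>W\<^esub> h x"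
  using h(3)[of x "-1"] h(1)[of x] by (simp add: U.minus_one_smult W.minus_one_smult)

lemma h_minus: "x \<in> carrier U \<Longrightarrow> y \<in> carrier U \<Longrightarrow> h (x \<ominus>\<^bsub>U\<^esub> y) = h x \<ominus>\<^bsub>W\<^esub> h y"
  by (simp add: a_minus_def h h_neg)

lemma h_lincomb:
  assumes "g ` keys p \<subseteq> carrier U"
  shows "h (lincomb U g p) = lincomb W (\<lambda>i. h (g i)) p"
proof -
  obtain S where S: "keys p \<subseteq> S" "g ` S \<subseteq> carrier U" using assms by blast
  from S(1) show ?thesis
  proof (induction p rule: keys_subset_induct)
    case (single_add k c q)
    then have c: "g ` keys q \<subseteq> carrier U" "g k \<in> carrier U"
      using S(2) by auto
    then have c: "g ` keys q \<subseteq> carrier U" "g k \<in> carrier U"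
      "(\<lambda>i. h (g i)) ` keys q \<subseteq> carrier W" "h (g k) \<in> carrier W"
      by (simp_all add: h(1) image_subset_iff)
    then have s: "g ` keys (single k c) \<subseteq> carrier U" "(\<lambda>i. h (g i)) ` keys (single k c) \<subseteq> carrier W"
      by (auto split: if_splits)
    show ?case
      using c single_add.IH
      by (simp add: U.lincomb_add[OF s(1) c(1)] W.lincomb_add[OF s(2) c(3)]
          U.lincomb_single W.lincomb_single h)
  qed simp
qed

lemma h_vspan: "S \<subseteq> carrier U \<Longrightarrow> h ` vspan U S = vspan W (h ` S)"
proof
  assume S: "S \<subseteq> carrier U"
  note cl = U.vspan_closed[OF S]
  show "h ` vspan U S \<subseteq> vspan W (h ` S)"
  proof
    fix y assume "y \<in> h ` vspan U S"
    then obtain x where "x \<in> vspan U S" "y = h x" by blast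
    moreover from this(1) have "h x \<in> vspan W (h ` S)"
    proof induction
      case (add x y)
      then show ?case using cl by (subst h) (auto intro: vspan.intros)
    next
      case (smult x c)
      then show ?case using cl by (subst h) (auto intro: vspan.intros)
    qed (auto intro: vspan.intros)
    ultimately show "y \<in> vspan W (h ` S)" by simp
  qed
  show "vspan W (h ` S) \<subseteq> h ` vspan U S"
  proof
    fix y assume "y \<in> vspan W (h ` S)"
    then show "y \<in> h ` vspan U S"
    proof induction
      case zero
      then show ?case by (metis h_zero image_eqI vspan.zero)
    next
      case (add x y)
      then show ?case using cl by (auto simp: h(2)[symmetric] subset_iff intro!: imageI vspan.add)
    next
      case (smult x c)
      then show ?case using cl by (auto simp: h(3)[symmetric] subset_iff intro!: imageI vspan.smult)
    qed (auto intro: vspan.intros)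
  qed
qed

text \<open>Both isomorphisms of the theorem get their injectivity here. Their domains are quotients
  known only through a spanning family; independence of the images makes that family a basis, so no
  basis of a tensor construction has to be built by hand.\<close>

lemma inj_on_if_indep:
  assumes "carrier U = vspan U (g ` I)" "g ` I \<subseteq> carrier U" "indep W I (\<lambda>i. h (g i))"
  shows "inj_on h (carrier U)"
proof -
  have "x = \<zero>\<^bsub>U\<^esub>" if x: "x \<in> carrier U" "h x = \<zero>\<^bsub>W\<^esub>" for x
  proof -
    obtain p where p: "keys p \<subseteq> I" "x = lincomb U g p"
      using x(1) assms(1) U.vspan_image[OF assms(2)] by auto
    then have "lincomb W (\<lambda>i. h (g i)) p = \<zero>\<^bsub>W\<^esub>"
      using x(2) h_lincomb[of g p] assms(2) by (metis image_mono order_trans)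
    then have "p = 0" using assms(3) p(1) by (auto simp: indep_def)
    with p(2) show ?thesis by simp
  qed
  note ker = this
  show ?thesis
  proof (rule inj_onI)
    fix x y assume "x \<in> carrier U" "y \<in> carrier U" "h x = h y"
    then have "x \<ominus>\<^bsub>U\<^esub> y = \<zero>\<^bsub>U\<^esub>"
      by (intro ker) (simp_all add: h_minus h a_minus_def W.r_neg h_neg)
    with \<open>x \<in> carrier U\<close> \<open>y \<in> carrier U\<close> show "x = y" by (metis U.add.inv_closed U.add.inv_inv U.minus_equality a_minus_def)
  qed
qed

end

text \<open>\<open>sub\<close> replaces the carrier only, and the closure rules of
  \<open>vspan\<close> never consult the carrier.\<close>

lemma vspan_sub: "vspan (sub V S) X = vspan V X"
proof -
  have "vspan (sub V S) X \<subseteq> vspan V X"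
  proof
    fix x assume "x \<in> vspan (sub V S) X"
    then show "x \<in> vspan V X" by induction (auto simp: sub_def intro: vspan.intros)
  qed
  moreover have "vspan V X \<subseteq> vspan (sub V S) X"
  proof
    fix x assume "x \<in> vspan V X"
    then show "x \<in> vspan (sub V S) X"
    proof induction
      case zero
      then show ?case using vspan.zero[of "sub V S" X] by (simp add: sub_def)
    next
      case (add x y)
      then show ?case using vspan.add[of x "sub V S" X y] by (simp add: sub_def)
    next
      case (smult x c)
      then show ?case using vspan.smult[of x "sub V S" X c] by (simp add: sub_def)
    qed (auto intro: vspan.incl)
  qed
  ultimately show ?thesis by blast
qed

section \<open>Algebras and quotients\<close>

locale falg = ring A + vecsp A for A :: "('f::field, 'a) module" (structure) +
  assumes smult_mult_left:
      "x \<in> carrier A \<Longrightarrow> y \<in> carrier A \<Longrightarrow> (c \<odot> x) \<otimes> y = c \<odot> (x \<otimes> y)"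
    and smult_mult_right:
      "x \<in> carrier A \<Longrightarrow> y \<in> carrier A \<Longrightarrow> x \<otimes> (c \<odot> y) = c \<odot> (x \<otimes> y)"

definition mprod :: "('f, 'a) module \<Rightarrow> 'a list \<Rightarrow> 'a" where
  "mprod A xs = foldr (\<lambda>x y. x \<otimes>\<^bsub>A\<^esub> y) xs \<one>\<^bsub>A\<^esub>"

lemma mprod_simps [simp]: "mprod A [] = \<one>\<^bsub>A\<^esub>" "mprod A (x # xs) = x \<otimes>\<^bsub>A\<^esub> mprod A xs"
  by (simp_all add: mprod_def)

definition alghom :: "('f, 'a) module \<Rightarrow> ('f, 'b) module \<Rightarrow> ('a \<Rightarrow> 'b) \<Rightarrow> bool" where
  "alghom A B h \<longleftrightarrow> linmap A B h \<and> h \<one>\<^bsub>A\<^esub> = \<one>\<^bsub>B\<^esub> \<and>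
    (\<forall>x\<in>carrier A. \<forall>y\<in>carrier A. h (x \<otimes>\<^bsub>A\<^esub> y) = h x \<otimes>\<^bsub>B\<^esub> h y)"

context falg
begin

lemma mprod_closed [simp, intro]: "set xs \<subseteq> carrier A \<Longrightarrow> mprod A xs \<in> carrier A"
  by (induction xs) auto

lemma mprod_append:
  "set xs \<subseteq> carrier A \<Longrightarrow> set ys \<subseteq> carrier A \<Longrightarrow> mprod A (xs @ ys) = mprod A xs \<otimes> mprod A ys"
  by (induction xs) (auto simp: m_assoc)

text \<open>Scalar multiplication is multiplication by \<open>c \<odot> \<one>\<close>, so a ring
  ideal is closed under it, and ideals generated in the sense of rings serve as ideals of
  algebras.\<close>

lemma ideal_subspace:
  assumes "ideal I A" shows "subspace A I"
proof -
  interpret ideal I A by fact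
  have "c \<odot> x \<in> I" if "x \<in> I" for c x
    using I_l_closed[OF that, of "c \<odot> \<one>"] that by (simp add: smult_mult_left)
  then show ?thesis by (auto simp: subspace_def)
qed

lemma subalg_gen_closed: "S \<subseteq> carrier A \<Longrightarrow> subalg_gen A S \<subseteq> carrier A"
proof
  fix x assume "x \<in> subalg_gen A S" "S \<subseteq> carrier A"
  then show "x \<in> carrier A" by induction auto
qed

lemma subspace_subalg_gen: "S \<subseteq> carrier A \<Longrightarrow> subspace A (subalg_gen A S)"
  using subalg_gen_closed[of S] subalg_gen.smult[OF subalg_gen.one, of A 0 S]
  by (auto simp: subspace_def intro: subalg_gen.intros)

lemma vspan_mult:
  assumes "S \<subseteq> carrier A" "T \<subseteq> carrier A"
    and "\<And>s t. s \<in> S \<Longrightarrow> t \<in> T \<Longrightarrow> s \<otimes> t \<in> vspan A R"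
    and "x \<in> vspan A S" "y \<in> vspan A T"
  shows "x \<otimes> y \<in> vspan A R"
proof -
  note cl = vspan_closed[OF assms(1)] vspan_closed[OF assms(2)]
  have 1: "s \<otimes> y \<in> vspan A R" if "s \<in> S" for s
    using assms(5)
  proof induction
    case (smult y c)
    then show ?case using cl assms(1) that by (subst smult_mult_right) (auto intro: vspan.intros)
  next
    case (add x y)
    then show ?case using cl assms(1) that by (subst r_distr) (auto intro: vspan.intros)
  qed (use that assms(1,2,3) subsetD[OF assms(1) that] in \<open>auto intro: vspan.intros\<close>)
  have y: "y \<in> carrier A" using cl assms(5) by blast
  show ?thesis
    using assms(4)
  proof induction
    case (smult x c)
    then show ?case using cl y by (subst smult_mult_left) (auto intro: vspan.intros)
  next
    case (add x x')
    then show ?case using cl y by (subst l_distr) (auto intro: vspan.intros)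
  qed (use y 1 in \<open>auto intro: vspan.intros\<close>)
qed

text \<open>Distributing products over sums leaves only products of elements of the spanning family,
  the empty product being \<open>\<one>\<close>. This describes both N, generated by the span M, and
  the tensor algebra, generated by a vector space.\<close>

lemma subalg_gen_vspan:
  assumes "g ` I \<subseteq> carrier A"
  shows "subalg_gen A (vspan A (g ` I)) = vspan A ((\<lambda>u. mprod A (map g u)) ` lists I)"
    (is "?L = vspan A ?W")
proof
  have gu: "set (map g u) \<subseteq> carrier A" if "u \<in> lists I" for u
    using that assms by auto
  have W: "?W \<subseteq> carrier A" using gu by blast
  show "?L \<subseteq> vspan A ?W"
  proof
    fix x assume "x \<in> ?L"
    then show "x \<in> vspan A ?W"
    proof induction
      case one
      have "mprod A (map g []) \<in> ?W" by (intro imageI) auto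
      then show ?case by (simp add: vspan.incl)
    next
      case (incl x)
      then show ?case
      proof (rule subsetD[rotated], intro vspan_least subspace_vspan W subsetI)
        fix y assume "y \<in> g ` I"
        then obtain i where i: "i \<in> I" "y = g i" by blast
        then have "mprod A (map g [i]) \<in> ?W" by (intro imageI) auto
        moreover have "mprod A (map g [i]) = y" using i assms by auto
        ultimately show "y \<in> vspan A ?W" by (simp add: vspan.incl)
      qed
    next
      case (mult x y)
      show ?case
      proof (rule vspan_mult[OF W W _ mult.IH])
        fix s t assume "s \<in> ?W" "t \<in> ?W"
        then obtain u v where uv: "u \<in> lists I" "v \<in> lists I"
          "s = mprod A (map g u)" "t = mprod A (map g v)" by blast
        then have "s \<otimes> t = mprod A (map g (u @ v))"
          using gu by (simp add: mprod_append)
        moreover have "\<dots> \<in> ?W" using uv by (intro imageI) auto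
        ultimately show "s \<otimes> t \<in> vspan A ?W" by (simp add: vspan.incl)
      qed
    qed (auto intro: vspan.intros)
  qed
  have cl: "vspan A (g ` I) \<subseteq> carrier A" using vspan_closed assms by blast
  show "vspan A ?W \<subseteq> ?L"
  proof (rule vspan_least[OF subspace_subalg_gen[OF cl]], rule image_subsetI)
    fix u assume "u \<in> lists I"
    then show "mprod A (map g u) \<in> ?L"
      by (induction u) (auto intro: subalg_gen.intros vspan.incl)
  qed
qed

lemma subalg_gen_image:
  assumes "g ` I \<subseteq> carrier A"
  shows "subalg_gen A (g ` I) = vspan A ((\<lambda>u. mprod A (map g u)) ` lists I)"
proof
  have "subalg_gen A (g ` I) \<subseteq> subalg_gen A (vspan A (g ` I))"
  proof
    fix x assume "x \<in> subalg_gen A (g ` I)"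
    then show "x \<in> subalg_gen A (vspan A (g ` I))"
      by induction (auto intro: subalg_gen.intros vspan.incl)
  qed
  then show "subalg_gen A (g ` I) \<subseteq> vspan A ((\<lambda>u. mprod A (map g u)) ` lists I)"
    by (simp add: subalg_gen_vspan assms)
  show "vspan A ((\<lambda>u. mprod A (map g u)) ` lists I) \<subseteq> subalg_gen A (g ` I)"
  proof (rule vspan_least[OF subspace_subalg_gen[OF assms]], rule image_subsetI)
    fix u assume "u \<in> lists I"
    then show "mprod A (map g u) \<in> subalg_gen A (g ` I)"
      by (induction u) (auto intro: subalg_gen.intros)
  qed
qed

end

lemma alghomD:
  assumes "alghom A B h"
  shows "linmap A B h" "h \<one>\<^bsub>A\<^esub> = \<one>\<^bsub>B\<^esub>"
    "x \<in> carrier A \<Longrightarrow> y \<in> carrier A \<Longrightarrow> h (x \<otimes>\<^bsub>A\<^esub> y) = h x \<otimes>\<^bsub>B\<^esub> h y"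
  using assms by (auto simp: alghom_def)

locale alghom_loc = A: falg A + B: falg B
  for A :: "('f::field, 'a) module" and B :: "('f, 'b) module" +
  fixes h :: "'a \<Rightarrow> 'b"
  assumes alghom: "alghom A B h"

sublocale alghom_loc \<subseteq> linmap_loc A B h
  by unfold_locales (rule alghomD(1)[OF alghom])

context alghom_loc
begin

lemmas h_one = alghomD(2)[OF alghom] and h_mult = alghomD(3)[OF alghom]

lemma h_mprod: "set xs \<subseteq> carrier A \<Longrightarrow> h (mprod A xs) = mprod B (map h xs)"
  by (induction xs) (auto simp: h_one h_mult)

lemma kernel_ideal: "ideal {x \<in> carrier A. h x = \<zero>\<^bsub>B\<^esub>} A"
proof (rule idealI)
  show "subgroup {x \<in> carrier A. h x = \<zero>\<^bsub>B\<^esub>} (add_monoid A)"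
    by (rule subgroup.intro)
      (auto simp: h h_neg a_inv_def[symmetric])
qed (auto simp: h h_mult A.ring_axioms)

end

context vecsp
begin

lemma abelian_subgroup_subspace: assumes "subspace V I" shows "abelian_subgroup I V"
proof -
  have "subgroup I (add_monoid V)"
    using subspaceD[OF assms] by (intro subgroup.intro) (auto simp: a_inv_def[symmetric])
  then show ?thesis
    by (intro abelian_subgroupI3 additive_subgroupI abelian_group_axioms)
qed

lemma coset_eq_iff:
  assumes "subspace V I" "x \<in> carrier V" "y \<in> carrier V"
  shows "I +> x = I +> y \<longleftrightarrow> x \<ominus> y \<in> I"
proof -
  interpret I: abelian_subgroup I V by (rule abelian_subgroup_subspace) fact
  have "x \<in> I +> y \<longleftrightarrow> x \<ominus> y \<in> I"
    using assms(2,3) by (metis I.a_rcos_module a_minus_def)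
  with assms(2,3) show ?thesis
    by (metis I.a_rcos_self I.a_repr_independence')
qed

lemma quot_simps:
  assumes "subspace V I" "x \<in> carrier V"
  shows "carrier (quot V I) = (\<lambda>x. I +> x) ` carrier V"
    "\<zero>\<^bsub>quot V I\<^esub> = I" "\<zero>\<^bsub>quot V I\<^esub> = I +> \<zero>"
    "y \<in> carrier V \<Longrightarrow> (I +> x) \<oplus>\<^bsub>quot V I\<^esub> (I +> y) = I +> (x \<oplus> y)"
    "c \<odot>\<^bsub>quot V I\<^esub> (I +> x) = I +> (c \<odot> x)"
proof -
  interpret I: abelian_subgroup I V by (rule abelian_subgroup_subspace) fact
  note S = subspaceD[OF assms(1)]
  show "carrier (quot V I) = (\<lambda>x. I +> x) ` carrier V"
    by (auto simp: quot_def FactRing_def A_RCOSETS_defs a_r_coset_def)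
  show "\<zero>\<^bsub>quot V I\<^esub> = I" "\<zero>\<^bsub>quot V I\<^esub> = I +> \<zero>"
    using S(1) by (simp_all add: quot_def FactRing_def subset_iff)
  show "y \<in> carrier V \<Longrightarrow> (I +> x) \<oplus>\<^bsub>quot V I\<^esub> (I +> y) = I +> (x \<oplus> y)"
    using assms(2) by (simp add: quot_def FactRing_def I.a_rcos_sum)
  \<comment> \<open>The scalar multiple in the quotient is a union over all representatives; it
    collapses to one coset because each of them contributes the same one.\<close>
  have rep: "I +> (c \<odot> z) = I +> (c \<odot> x)" if z: "z \<in> I +> x" for z
  proof -
    from z obtain i where i: "i \<in> I" "z = i \<oplus> x" by (auto simp: a_r_coset_def r_coset_def)
    then have "c \<odot> z \<ominus> c \<odot> x = c \<odot> i"
      using S(1) assms(2) by (simp add: smult_add_right a_minus_def a_assoc r_neg)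
    moreover have "z \<in> carrier V" using i S(1) assms(2) by simp
    ultimately show ?thesis
      using coset_eq_iff[OF assms(1), of "c \<odot> z" "c \<odot> x"] S(4)[OF i(1), of c] assms(2) by simp
  qed
  have "I +> x \<noteq> {}" using I.a_rcos_self[OF assms(2)] by blast
  then have "(\<Union>z\<in>I +> x. I +> (c \<odot> z)) = I +> (c \<odot> x)"
    by (rule SUP_eq_const) (rule rep)
  then show "c \<odot>\<^bsub>quot V I\<^esub> (I +> x) = I +> (c \<odot> x)"
    by (simp add: quot_def)
qed

lemma vecsp_quot:
  assumes "subspace V I" shows "vecsp (quot V I)"
proof -
  note q = quot_simps[OF assms]
  have c: "carrier (quot V I) = (\<lambda>x. I +> x) ` carrier V" "\<zero>\<^bsub>quot V I\<^esub> = I +> \<zero>" 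
    using q(1,3) by blast+
  show ?thesis
  proof (intro vecsp.intro abelian_groupI vecsp_axioms.intro)
    fix X assume "X \<in> carrier (quot V I)"
    then obtain x where "x \<in> carrier V" "X = I +> x" using c by auto
    then show "\<exists>Z\<in>carrier (quot V I). Z \<oplus>\<^bsub>quot V I\<^esub> X = \<zero>\<^bsub>quot V I\<^esub>"
      by (intro bexI[of _ "I +> (\<ominus> x)"]) (auto simp: c q(4) l_neg)
  qed (auto simp: c q smult_add_left smult_add_right smult_smult a_ac)
qed

lemma linmap_coset:
  assumes "subspace V I" shows "linmap V (quot V I) (\<lambda>x. I +> x)"
  using quot_simps[OF assms] by (auto simp: linmap_def)

end

lemma (in linmap_loc) linmap_quot:
  assumes "subspace U I" "\<And>x. x \<in> I \<Longrightarrow> h x = \<zero>\<^bsub>W\<^esub>"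
  obtains k where "linmap (quot U I) W k" "\<And>x. x \<in> carrier U \<Longrightarrow> k (I +>\<^bsub>U\<^esub> x) = h x"
proof -
  define k where "k X = h (SOME x. x \<in> carrier U \<and> X = I +>\<^bsub>U\<^esub> x)" for X
  have k: "k (I +>\<^bsub>U\<^esub> x) = h x" if x: "x \<in> carrier U" for x
  proof -
    define y where "y = (SOME y. y \<in> carrier U \<and> I +>\<^bsub>U\<^esub> x = I +>\<^bsub>U\<^esub> y)"
    have y: "y \<in> carrier U \<and> I +>\<^bsub>U\<^esub> x = I +>\<^bsub>U\<^esub> y"
      unfolding y_def by (rule someI[of _ x]) (use x in auto)
    then have "h (x \<ominus>\<^bsub>U\<^esub> y) = \<zero>\<^bsub>W\<^esub>"
      using x assms U.coset_eq_iff by blast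
    then have "h x = h y"
      using x y by (simp add: h_minus) (metis W.add.inv_closed W.add.inv_inv W.minus_equality a_minus_def h(1))
    then show ?thesis by (simp add: k_def y_def)
  qed
  note q = U.quot_simps[OF assms(1)]
  have c: "carrier (quot U I) = (\<lambda>x. I +>\<^bsub>U\<^esub> x) ` carrier U" using q(1) by blast
  have "linmap (quot U I) W k"
    by (auto simp: linmap_def c q k h)
  with k that show ?thesis by blast
qed

context falg
begin

lemma quot_alg_simps:
  assumes "ideal I A"
  shows "\<one>\<^bsub>quot A I\<^esub> = I +> \<one>"
    "x \<in> carrier A \<Longrightarrow> y \<in> carrier A \<Longrightarrow> (I +> x) \<otimes>\<^bsub>quot A I\<^esub> (I +> y) = I +> (x \<otimes> y)"
  using assms by (simp_all add: quot_def FactRing_def ideal.rcoset_mult_add)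

lemma falg_quot:
  assumes "ideal I A" shows "falg (quot A I)"
proof -
  note s = ideal_subspace[OF assms]
  note q = quot_simps[OF s] quot_alg_simps[OF assms]
  have c: "carrier (quot A I) = (\<lambda>x. I +> x) ` carrier A" using q(1) by blast
  interpret Q: vecsp "quot A I" by (rule vecsp_quot[OF s])
  show ?thesis
    by (intro falg.intro ringI Q.vecsp_axioms Q.abelian_group_axioms falg_axioms.intro monoidI)
      (auto simp: c q m_assoc l_distr r_distr smult_mult_left smult_mult_right)
qed

lemma alghom_coset:
  assumes "ideal I A" shows "alghom A (quot A I) (\<lambda>x. I +> x)"
  using linmap_coset[OF ideal_subspace[OF assms]] quot_alg_simps[OF assms]
  by (auto simp: alghom_def)

end

lemma (in alghom_loc) alghom_quot_genideal:
  assumes "S \<subseteq> carrier A" "\<And>x. x \<in> S \<Longrightarrow> h x = \<zero>\<^bsub>B\<^esub>"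
  obtains k where "alghom (quot A (genideal A S)) B k"
    "\<And>x. x \<in> carrier A \<Longrightarrow> k (genideal A S +>\<^bsub>A\<^esub> x) = h x"
proof -
  let ?I = "genideal A S"
  have I: "ideal ?I A" using assms(1) by (rule A.genideal_ideal)
  have s: "subspace A ?I" using I by (rule A.ideal_subspace)
  have "?I \<subseteq> {x \<in> carrier A. h x = \<zero>\<^bsub>B\<^esub>}"
    using assms by (intro A.genideal_minimal kernel_ideal) auto
  then obtain k where k: "linmap (quot A ?I) B k" "\<And>x. x \<in> carrier A \<Longrightarrow> k (?I +>\<^bsub>A\<^esub> x) = h x"
    using linmap_quot[OF s] by blast
  note q = A.quot_simps[OF s] A.quot_alg_simps[OF I]
  have c: "carrier (quot A ?I) = (\<lambda>x. ?I +>\<^bsub>A\<^esub> x) ` carrier A" using q(1) by blast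
  have "alghom (quot A ?I) B k"
    using k by (auto simp: alghom_def c q h_one h_mult)
  with k(2) that show ?thesis by blast
qed

section \<open>Free objects\<close>

lemma free_vs_simps [simp]:
  "carrier (free_vs X) = {p. keys p \<subseteq> X}" "\<zero>\<^bsub>free_vs X\<^esub> = 0"
  "p \<oplus>\<^bsub>free_vs X\<^esub> q = p + q" "c \<odot>\<^bsub>free_vs X\<^esub> p = scl c p"
  by (simp_all add: free_vs_def)

lemma free_alg_simps [simp]:
  "carrier (free_alg X) = {p. keys p \<subseteq> lists X}" "\<zero>\<^bsub>free_alg X\<^esub> = 0"
  "p \<oplus>\<^bsub>free_alg X\<^esub> q = p + q" "c \<odot>\<^bsub>free_alg X\<^esub> p = scl c p"
  "p \<otimes>\<^bsub>free_alg X\<^esub> q = p * q" "\<one>\<^bsub>free_alg X\<^esub> = 1"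
  by (simp_all add: free_alg_def free_vs_def)

lemma scl_add_left: "scl (c + d) p = scl c p + scl d p"
  by (rule poly_mapping_eqI) (simp add: lookup_add algebra_simps)

lemma scl_add_right: "scl c (p + q) = scl c p + scl c q"
  by (rule poly_mapping_eqI) (simp add: lookup_add algebra_simps)

lemma scl_scl: "scl (c * d) p = scl c (scl d p)"
  by (rule poly_mapping_eqI) (simp add: algebra_simps)

lemma scl_one [simp]: "scl 1 p = p"
  by (rule poly_mapping_eqI) simp

lemma scl_zero [simp]: "scl c 0 = 0"
  by (rule poly_mapping_eqI) simp

text \<open>Scalars sit in the convolution algebra as multiples of the monoid unit \<open>0\<close>,
  and these are central. The mixed laws of \<open>falg\<close> for the free algebra then follow from
  associativity.\<close>

lemma scl_conv_mult:
  fixes p :: "'a::monoid_add \<Rightarrow>\<^sub>0 'f::field"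
  shows "scl c p = single 0 c * p" "scl c p = p * single 0 c"
proof -
  show "scl c p = single 0 c * p"
    using subset_refl[of "keys p"]
    by (induction p rule: keys_subset_induct) (simp_all add: scl_add_right distrib_left mult_single)
  show "scl c p = p * single 0 c"
    using subset_refl[of "keys p"]
  proof (induction p rule: keys_subset_induct)
    case (single_add k d p)
    have "single k d * single 0 c = single k (c * d)"
      by (simp add: mult_single mult.commute)
    with single_add show ?case
      by (simp add: scl_add_right distrib_right)
  qed simp
qed

lemma vecsp_free_vs: "vecsp (free_vs X)"
proof (intro vecsp.intro abelian_groupI vecsp_axioms.intro)
  fix p :: "'a \<Rightarrow>\<^sub>0 'b" assume "p \<in> carrier (free_vs X)"
  then show "\<exists>q\<in>carrier (free_vs X). q \<oplus>\<^bsub>free_vs X\<^esub> p = \<zero>\<^bsub>free_vs X\<^esub>"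
    by (intro bexI[of _ "-p"]) auto
qed (use keys_add keys_scl in \<open>force simp: scl_add_left scl_add_right scl_scl\<close>)+

lemma falg_free_alg:
  fixes X :: "'x set"
  shows "falg (free_alg X :: ('f::field, 'x list \<Rightarrow>\<^sub>0 'f) module)"
proof -
  have m: "keys (p * q) \<subseteq> lists X" if "keys p \<subseteq> lists X" "keys q \<subseteq> lists X"
    for p q :: "'x list \<Rightarrow>\<^sub>0 'f"
    using keys_mult[of p q] that by (fastforce simp: plus_list_def)
  have v: "vecsp (free_alg X :: ('f, 'x list \<Rightarrow>\<^sub>0 'f) module)"
  proof (intro vecsp.intro abelian_groupI vecsp_axioms.intro)
    fix p :: "'x list \<Rightarrow>\<^sub>0 'f" assume "p \<in> carrier (free_alg X)"
    then show "\<exists>q\<in>carrier (free_alg X). q \<oplus>\<^bsub>free_alg X\<^esub> p = \<zero>\<^bsub>free_alg X\<^esub>"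
      by (intro bexI[of _ "-p"]) auto
  qed (use keys_add keys_scl in \<open>force simp: scl_add_left scl_add_right scl_scl\<close>)+
  have cm: "p * single [] c = single [] c * p" for p :: "'x list \<Rightarrow>\<^sub>0 'f" and c
    using scl_conv_mult[of c p] by (simp add: zero_list_def)
  show ?thesis
    by (intro falg.intro ringI v vecsp.axioms(1)[OF v] falg_axioms.intro monoidI)
      (auto simp: m algebra_simps scl_conv_mult(1) zero_list_def,
        (metis mult.assoc cm)+)
qed

lemma free_vs_minus:
  "p \<in> carrier (free_vs X) \<Longrightarrow> q \<in> carrier (free_vs X) \<Longrightarrow> p \<ominus>\<^bsub>free_vs X\<^esub> q = p - q"
proof -
  interpret F: vecsp "free_vs X" by (rule vecsp_free_vs)
  assume "p \<in> carrier (free_vs X)" "q \<in> carrier (free_vs X)"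
  then show ?thesis
    using F.minus_equality[of "-q" q] by (simp add: a_minus_def)
qed

lemma free_alg_minus:
  "p \<in> carrier (free_alg X) \<Longrightarrow> q \<in> carrier (free_alg X) \<Longrightarrow> p \<ominus>\<^bsub>free_alg X\<^esub> q = p - q"
proof -
  interpret F: falg "free_alg X" by (rule falg_free_alg)
  assume "p \<in> carrier (free_alg X)" "q \<in> carrier (free_alg X)"
  then show ?thesis
    using F.minus_equality[of "-q" q] by (simp add: a_minus_def)
qed

lemma (in vecsp) linmap_lincomb:
  "g ` X \<subseteq> carrier V \<Longrightarrow> linmap (free_vs X) V (lincomb V g)"
  by (auto simp: linmap_def intro!: lincomb_closed lincomb_add lincomb_scl)

lemma free_vs_span: "carrier (free_vs X) = vspan (free_vs X) ((\<lambda>x. single x 1) ` X)"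
proof
  interpret F: vecsp "free_vs X" by (rule vecsp_free_vs)
  show "vspan (free_vs X) ((\<lambda>x. single x (1::'f::field)) ` X) \<subseteq> carrier (free_vs X)"
    by (rule F.vspan_closed) auto
  show "carrier (free_vs X) \<subseteq> vspan (free_vs X) ((\<lambda>x. single x (1::'f::field)) ` X)"
  proof
    fix p :: "'a \<Rightarrow>\<^sub>0 'f" assume "p \<in> carrier (free_vs X)"
    then have "keys p \<subseteq> X" by simp
    then show "p \<in> vspan (free_vs X) ((\<lambda>x. single x 1) ` X)"
    proof (induction p rule: keys_subset_induct)
      case zero
      then show ?case using vspan.zero[of "free_vs X"] by simp
    next
      case (single_add k c p)
      have "scl c (single k 1) + p \<in> vspan (free_vs X) ((\<lambda>x. single x 1) ` X)"
        using vspan.add[OF vspan.smult[OF vspan.incl, of "single k 1"] single_add(3), of c]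
          single_add(1) by simp
      then show ?case by simp
    qed
  qed
qed

lemma free_alg_hom:
  fixes B :: "('f::field, 'b) module" and X :: "'x set"
  assumes "falg B" "g ` X \<subseteq> carrier B"
  obtains h where "alghom (free_alg X) B h" "\<And>x. x \<in> X \<Longrightarrow> h (letter x) = g x"
proof -
  interpret B: falg B by fact
  define m where "m u = mprod B (map g u)" for u
  have mc: "m u \<in> carrier B" if "u \<in> lists X" for u
    using that assms(2) unfolding m_def by (intro B.mprod_closed) auto
  have ma: "m (u @ v) = m u \<otimes>\<^bsub>B\<^esub> m v" if "u \<in> lists X" "v \<in> lists X" for u v
    unfolding m_def map_append using that assms(2) by (intro B.mprod_append) auto
  define h :: "('x list \<Rightarrow>\<^sub>0 'f) \<Rightarrow> 'b" where "h = lincomb B m"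
  have "linmap (free_vs (lists X)) B h"
    unfolding h_def using mc by (intro B.linmap_lincomb) auto
  then have lin: "linmap (free_alg X) B h" by (simp add: linmap_def)
  note l = linmapD[OF lin, simplified]
  have hs: "h (single u c) = c \<odot>\<^bsub>B\<^esub> m u" if "u \<in> lists X" for u c
    using that mc by (simp add: h_def B.lincomb_single)
  have h0: "h 0 = \<zero>\<^bsub>B\<^esub>" by (simp add: h_def)
  interpret F: falg "free_alg X" by (rule falg_free_alg)
  have fc: "keys (p * q) \<subseteq> lists X" if "keys p \<subseteq> lists X" "keys q \<subseteq> lists X"
    for p q :: "'x list \<Rightarrow>\<^sub>0 'f"
    using F.m_closed[of p q] that by simp
  \<comment> \<open>Multiplicativity takes two inductions: a monomial times a polynomial here, then
    a polynomial times a polynomial.\<close>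
  have 1: "h (single u c * q) = h (single u c) \<otimes>\<^bsub>B\<^esub> h q" if u: "u \<in> lists X" and "keys q \<subseteq> lists X" for u c q
    using that(2)
  proof (induction q rule: keys_subset_induct)
    case zero
    then show ?case using u mc by (simp add: hs h0)
  next
    case (single_add v d q)
    have k: "keys (single v d) \<subseteq> lists X" "keys (single u c) \<subseteq> lists X"
      using u single_add by auto
    then have k: "keys (single u c * q) \<subseteq> lists X" "keys (single u c * single v d) \<subseteq> lists X"
      "keys (single v d) \<subseteq> lists X"
      using single_add by (auto intro: fc del: subsetI)
    have "h (single u c * (single v d + q)) = h (single u c * single v d) \<oplus>\<^bsub>B\<^esub> h (single u c * q)"
      using k by (simp add: distrib_left l)
    moreover have "h (single u c * single v d) = h (single u c) \<otimes>\<^bsub>B\<^esub> h (single v d)"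
      using u single_add(1) mc ma[of u v]
      by (simp add: mult_single plus_list_def hs B.smult_mult_left B.smult_mult_right
          mult.commute[of d] flip: B.smult_smult)
    ultimately show ?case
      using k single_add u mc by (simp add: l B.r_distr hs)
  qed
  have "h (p * q) = h p \<otimes>\<^bsub>B\<^esub> h q" if "keys p \<subseteq> lists X" and q: "keys q \<subseteq> lists X" for p q
    using that(1)
  proof (induction p rule: keys_subset_induct)
    case zero
    then show ?case using q l(1) by (simp add: h0)
  next
    case (single_add u c p)
    have "keys (single u c) \<subseteq> lists X" using single_add by auto
    then have k: "keys (single u c * q) \<subseteq> lists X" "keys (p * q) \<subseteq> lists X" "keys (single u c) \<subseteq> lists X"
      using fc[OF _ q] single_add by auto
    have "h ((single u c + p) * q) = h (single u c * q) \<oplus>\<^bsub>B\<^esub> h (p * q)"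
      using k by (simp add: distrib_right l)
    then show ?case
      using k single_add q 1 by (simp add: l B.l_distr)
  qed
  moreover have "h 1 = \<one>\<^bsub>B\<^esub>"
    using hs[of "[]" 1] by (simp add: m_def zero_list_def single_one[symmetric] del: single_one)
  ultimately have "alghom (free_alg X) B h"
    using lin by (simp add: alghom_def)
  moreover have "h (letter x) = g x" if "x \<in> X" for x
    using that assms(2) hs[of "[x]" 1] by (auto simp: m_def)
  ultimately show ?thesis using that by blast
qed

lemma free_alg_gen:
  fixes X :: "'x set"
  shows "carrier (free_alg X :: ('f::field, 'x list \<Rightarrow>\<^sub>0 'f) module) =
    subalg_gen (free_alg X) (letter ` X)"
proof
  interpret F: falg "free_alg X :: ('f, 'x list \<Rightarrow>\<^sub>0 'f) module" by (rule falg_free_alg)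
  show "subalg_gen (free_alg X) (letter ` X) \<subseteq> carrier (free_alg X :: ('f, 'x list \<Rightarrow>\<^sub>0 'f) module)"
    by (rule F.subalg_gen_closed) auto
  have letter_closed: "letter ` X \<subseteq> carrier (free_alg X :: ('f, 'x list \<Rightarrow>\<^sub>0 'f) module)" by auto
  have w: "(single u 1 :: 'x list \<Rightarrow>\<^sub>0 'f) \<in> subalg_gen (free_alg X) (letter ` X)" if "u \<in> lists X" for u
    using that
  proof (induction u)
    case Nil
    then show ?case using subalg_gen.one[of "free_alg X"]
      by (simp add: zero_list_def[symmetric])
  next
    case (Cons x u)
    have "letter x * (single u 1 :: 'x list \<Rightarrow>\<^sub>0 'f) \<in> subalg_gen (free_alg X) (letter ` X)"
      using subalg_gen.mult[OF subalg_gen.incl Cons.IH, of "letter x"] Cons.hyps by simp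
    then show ?case by (simp add: mult_single plus_list_def)
  qed
  show "carrier (free_alg X :: ('f, 'x list \<Rightarrow>\<^sub>0 'f) module) \<subseteq> subalg_gen (free_alg X) (letter ` X)"
  proof
    fix p :: "'x list \<Rightarrow>\<^sub>0 'f" assume "p \<in> carrier (free_alg X)"
    then have "keys p \<subseteq> lists X" by simp
    then show "p \<in> subalg_gen (free_alg X) (letter ` X)"
    proof (induction p rule: keys_subset_induct)
      case zero
      then show ?case
        by (metis F.subspaceD(2) F.subspace_subalg_gen free_alg_simps(2) letter_closed)
    next
      case (single_add k c p)
      have "scl c (single k 1) + p \<in> subalg_gen (free_alg X) (letter ` X)"
        using subalg_gen.add[OF subalg_gen.smult[OF w, of k] single_add(3), of c]
          single_add(1) by simp
      then show ?case by simp
    qed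
  qed
qed

lemma (in alghom_loc) h_subalg_gen:
  assumes "S \<subseteq> carrier A"
  shows "h ` subalg_gen A S = subalg_gen B (h ` S)"
proof -
  have S: "mprod A ` lists S \<subseteq> carrier A" using assms by auto
  have "h ` subalg_gen A S = h ` vspan A (mprod A ` lists S)"
    using A.subalg_gen_image[of "\<lambda>x. x" S] assms by simp
  also have "\<dots> = vspan B ((\<lambda>u. h (mprod A u)) ` lists S)"
    unfolding h_vspan[OF S] image_image ..
  also have "(\<lambda>u. h (mprod A u)) ` lists S = (\<lambda>u. mprod B (map h u)) ` lists S"
    using assms by (intro image_cong refl h_mprod) auto
  also have "vspan B \<dots> = subalg_gen B (h ` S)"
    using assms h(1) by (intro B.subalg_gen_image[symmetric]) auto
  finally show ?thesis .
qed

section \<open>Tensor algebras and tensor products\<close>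

context vecsp
begin

abbreviation (input) "tensor_rels \<equiv>
  {letter (x \<oplus> y) - letter x - letter y |x y. x \<in> carrier V \<and> y \<in> carrier V} \<union>
  {letter (c \<odot> x) - single [x] c |c x. x \<in> carrier V}"

lemma tensor_rels_closed: "tensor_rels \<subseteq> carrier (free_alg (carrier V))"
proof -
  interpret F: falg "free_alg (carrier V) :: ('f, 'a list \<Rightarrow>\<^sub>0 'f) module" by (rule falg_free_alg)
  have l: "single [x] c \<in> carrier (free_alg (carrier V))" if "x \<in> carrier V" for x and c :: 'f
    using that by simp
  have m: "p - q \<in> carrier (free_alg (carrier V))"
    if "p \<in> carrier (free_alg (carrier V))" "q \<in> carrier (free_alg (carrier V))"
    for p q :: "'a list \<Rightarrow>\<^sub>0 'f"
    using F.minus_closed[OF that] free_alg_minus[OF that] by simp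
  show ?thesis
    by (intro Un_least subsetI; elim CollectE exE conjE; hypsubst; intro m l a_closed smult_closed)
qed

lemma tensor_ideal: "ideal (tensor_ideal V) (free_alg (carrier V))"
proof -
  interpret F: falg "free_alg (carrier V) :: ('f, 'a list \<Rightarrow>\<^sub>0 'f) module" by (rule falg_free_alg)
  show ?thesis
    unfolding tensor_ideal_def using tensor_rels_closed by (rule F.genideal_ideal)
qed

lemma falg_tensor_alg: "falg (tensor_alg V)"
  unfolding tensor_alg_def by (rule falg.falg_quot[OF falg_free_alg tensor_ideal])

lemma linmap_tensor_incl: "linmap V (tensor_alg V) (tensor_incl V)"
proof -
  interpret F: falg "free_alg (carrier V) :: ('f, 'a list \<Rightarrow>\<^sub>0 'f) module" by (rule falg_free_alg)
  let ?I = "tensor_ideal V" and ?F = "free_alg (carrier V) :: ('f, 'a list \<Rightarrow>\<^sub>0 'f) module"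
  note s = F.ideal_subspace[OF tensor_ideal]
  have r: "r \<in> ?I" if "r \<in> tensor_rels" for r
    using F.genideal_self[OF tensor_rels_closed] that unfolding tensor_ideal_def by blast
  have eq: "?I +>\<^bsub>?F\<^esub> p = ?I +>\<^bsub>?F\<^esub> q"
    if "p \<in> carrier ?F" "q \<in> carrier ?F" "p - q \<in> ?I" for p q
    using that F.coset_eq_iff[OF s, of p q] by (simp add: free_alg_minus)
  have l: "letter x \<in> carrier ?F" if "x \<in> carrier V" for x
    using that by simp
  show ?thesis
    unfolding linmap_def
  proof (intro conjI ballI allI)
    fix x assume "x \<in> carrier V"
    then show "tensor_incl V x \<in> carrier (tensor_alg V)"
      using F.quot_simps(1)[OF s l] by (auto simp: tensor_incl_def tensor_alg_def)
  next
    fix x y assume xy: "x \<in> carrier V" "y \<in> carrier V"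
    have "letter (x \<oplus> y) - (letter x + letter y) \<in> ?I"
      using xy by (intro r) (auto simp: diff_diff_eq)
    then have "?I +>\<^bsub>?F\<^esub> letter (x \<oplus> y) = ?I +>\<^bsub>?F\<^esub> (letter x + letter y)"
      using xy F.a_closed[OF l l, of x y] by (intro eq) auto
    then show "tensor_incl V (x \<oplus> y) = tensor_incl V x \<oplus>\<^bsub>tensor_alg V\<^esub> tensor_incl V y"
      using F.quot_simps(4)[OF s l[OF xy(1)] l[OF xy(2)]] by (simp add: tensor_incl_def tensor_alg_def)
  next
    fix c x assume x: "x \<in> carrier V"
    have "letter (c \<odot> x) - single [x] c \<in> ?I"
      using x by (intro r) auto
    then have "?I +>\<^bsub>?F\<^esub> letter (c \<odot> x) = ?I +>\<^bsub>?F\<^esub> (single [x] c)"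
      using x by (intro eq) auto
    then show "tensor_incl V (c \<odot> x) = c \<odot>\<^bsub>tensor_alg V\<^esub> tensor_incl V x"
      using F.quot_simps(5)[OF s l[OF x], of c] by (simp add: tensor_incl_def tensor_alg_def)
  qed
qed

text \<open>The extension of \<open>g\<close> to the free algebra on the set
  \<open>carrier V\<close> kills both kinds of linear relations because \<open>g\<close> is linear,
  hence it descends to the quotient.\<close>

lemma tensor_alg_hom:
  assumes "falg B" "linmap V B g"
  obtains h where "alghom (tensor_alg V) B h" "\<And>x. x \<in> carrier V \<Longrightarrow> h (tensor_incl V x) = g x"
proof -
  interpret B: falg B by fact
  let ?F = "free_alg (carrier V) :: ('f, 'a list \<Rightarrow>\<^sub>0 'f) module"
  note g = linmapD[OF assms(2)]
  have "g ` carrier V \<subseteq> carrier B" using g by auto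
  from free_alg_hom[OF assms(1) this] obtain k where
    k: "alghom ?F B k" "\<And>x. x \<in> carrier V \<Longrightarrow> k (letter x) = g x" by blast
  interpret k: alghom_loc ?F B k
    by (intro alghom_loc.intro alghom_loc_axioms.intro falg_free_alg assms(1) k(1))
  have l: "single [x] c \<in> carrier ?F" if "x \<in> carrier V" for x c
    using that by simp
  have "k r = \<zero>\<^bsub>B\<^esub>" if "r \<in> tensor_rels" for r
    using that
  proof (elim UnE CollectE exE conjE)
    fix x y assume r: "r = letter (x \<oplus> y) - letter x - letter y" "x \<in> carrier V" "y \<in> carrier V"
    have "r = letter (x \<oplus> y) \<ominus>\<^bsub>?F\<^esub> (letter x \<oplus>\<^bsub>?F\<^esub> letter y)"
      using r k.A.a_closed[OF l l, of x y]
      by (subst free_alg_minus) (simp_all add: diff_diff_eq)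
    then show ?thesis
      using r k.A.a_closed[OF l l, of x y] by (simp only: k.h_minus l k.h k(2) a_closed) (simp add: k(2) g a_minus_def B.r_neg)
  next
    fix c x assume r: "r = letter (c \<odot> x) - single [x] c" "x \<in> carrier V"
    have "r = letter (c \<odot> x) \<ominus>\<^bsub>?F\<^esub> (c \<odot>\<^bsub>?F\<^esub> letter x)"
      using r by (subst free_alg_minus) simp_all
    then show ?thesis
      using r by (simp only: k.h_minus l k.h k(2) smult_closed k.A.smult_closed) (simp add: k(2) g a_minus_def B.r_neg)
  qed
  from k.alghom_quot_genideal[OF tensor_rels_closed this] obtain h where
    h: "alghom (tensor_alg V) B h"
      "\<And>x. x \<in> carrier ?F \<Longrightarrow> h (tensor_ideal V +>\<^bsub>?F\<^esub> x) = k x"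
    unfolding tensor_alg_def tensor_ideal_def by blast
  have "h (tensor_incl V x) = g x" if "x \<in> carrier V" for x
    using h(2)[OF l[OF that, of 1]] that k(2) by (simp add: tensor_incl_def)
  with h(1) that show ?thesis by blast
qed

lemma tensor_alg_gen:
  "carrier (tensor_alg V) = subalg_gen (tensor_alg V) (tensor_incl V ` carrier V)"
proof -
  let ?F = "free_alg (carrier V) :: ('f, 'a list \<Rightarrow>\<^sub>0 'f) module"
  let ?\<pi> = "\<lambda>x. tensor_ideal V +>\<^bsub>?F\<^esub> x"
  interpret \<pi>: alghom_loc ?F "tensor_alg V" ?\<pi>
    using falg.alghom_coset[OF falg_free_alg tensor_ideal]
    by (intro alghom_loc.intro alghom_loc_axioms.intro falg_free_alg falg_tensor_alg)
      (simp add: tensor_alg_def)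
  have "carrier (tensor_alg V) = ?\<pi> ` carrier ?F"
    using \<pi>.A.quot_simps(1)[OF \<pi>.A.ideal_subspace[OF tensor_ideal] \<pi>.A.zero_closed]
    by (simp add: tensor_alg_def)
  also have "\<dots> = subalg_gen (tensor_alg V) (?\<pi> ` letter ` carrier V)"
    unfolding free_alg_gen by (rule \<pi>.h_subalg_gen) auto
  also have "?\<pi> ` letter ` carrier V = tensor_incl V ` carrier V"
    by (simp add: image_image tensor_incl_def)
  finally show ?thesis .
qed

end

locale two_vecsp = U: vecsp U + W: vecsp W
  for U :: "('f::field, 'u) module" and W :: "('f, 'w) module"
begin

abbreviation (input) "FUW \<equiv> free_vs (carrier U \<times> carrier W) :: ('f, ('u \<times> 'w) \<Rightarrow>\<^sub>0 'f) module"

sublocale F: vecsp FUW by (rule vecsp_free_vs)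

abbreviation (input) "bigens \<equiv>
    ({single (x \<oplus>\<^bsub>U\<^esub> y, w) 1 - single (x, w) 1
        - single (y, w) 1 |x y w.
        x \<in> carrier U \<and> y \<in> carrier U \<and> w \<in> carrier W} \<union>
     {single (u, x \<oplus>\<^bsub>W\<^esub> y) 1 - single (u, x) 1
        - single (u, y) 1 |u x y.
        u \<in> carrier U \<and> x \<in> carrier W \<and> y \<in> carrier W} \<union>
     {single (c \<odot>\<^bsub>U\<^esub> u, w) 1 - single (u, w) c |c u w.
        u \<in> carrier U \<and> w \<in> carrier W} \<union>
     {single (u, c \<odot>\<^bsub>W\<^esub> w) 1 - single (u, w) c |c u w.
        u \<in> carrier U \<and> w \<in> carrier W})"

lemma bigens_closed: "bigens \<subseteq> carrier FUW"
proof -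
  have l: "single (u, w) c \<in> carrier FUW" if "u \<in> carrier U" "w \<in> carrier W" for u w c
    using that by simp
  have m: "p - q \<in> carrier FUW" if "p \<in> carrier FUW" "q \<in> carrier FUW" for p q
    using F.minus_closed[OF that] free_vs_minus[OF that] by simp
  show ?thesis
    by (intro Un_least subsetI; elim CollectE exE conjE; hypsubst;
        intro m l U.a_closed U.smult_closed W.a_closed W.smult_closed)
qed

lemma bilinear_rels_subspace: "subspace FUW (bilinear_rels U W)"
  unfolding bilinear_rels_def using bigens_closed by (rule F.subspace_vspan)

lemma vecsp_tensor_prod: "vecsp (tensor_prod U W)"
  unfolding tensor_prod_def by (rule F.vecsp_quot[OF bilinear_rels_subspace])

lemma pure_tensor:
  "u \<in> carrier U \<Longrightarrow> w \<in> carrier W \<Longrightarrow> pure_tensor U W u w \<in> carrier (tensor_prod U W)"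
  "u \<in> carrier U \<Longrightarrow> u' \<in> carrier U \<Longrightarrow> w \<in> carrier W \<Longrightarrow>
    pure_tensor U W (u \<oplus>\<^bsub>U\<^esub> u') w = pure_tensor U W u w \<oplus>\<^bsub>tensor_prod U W\<^esub> pure_tensor U W u' w"
  "u \<in> carrier U \<Longrightarrow> w \<in> carrier W \<Longrightarrow> w' \<in> carrier W \<Longrightarrow>
    pure_tensor U W u (w \<oplus>\<^bsub>W\<^esub> w') = pure_tensor U W u w \<oplus>\<^bsub>tensor_prod U W\<^esub> pure_tensor U W u w'"
  "u \<in> carrier U \<Longrightarrow> w \<in> carrier W \<Longrightarrow>
    pure_tensor U W (c \<odot>\<^bsub>U\<^esub> u) w = c \<odot>\<^bsub>tensor_prod U W\<^esub> pure_tensor U W u w"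
  "u \<in> carrier U \<Longrightarrow> w \<in> carrier W \<Longrightarrow>
    pure_tensor U W u (c \<odot>\<^bsub>W\<^esub> w) = c \<odot>\<^bsub>tensor_prod U W\<^esub> pure_tensor U W u w"
proof -
  let ?I = "bilinear_rels U W"
  note s = bilinear_rels_subspace
  have r: "r \<in> ?I" if "r \<in> bigens" for r
    using that unfolding bilinear_rels_def by (rule vspan.incl)
  have eq: "?I +>\<^bsub>FUW\<^esub> p = ?I +>\<^bsub>FUW\<^esub> q"
    if "p \<in> carrier FUW" "q \<in> carrier FUW" "p - q \<in> ?I" for p q
    using that F.coset_eq_iff[OF s, of p q] by (simp add: free_vs_minus)
  have l: "single (u, w) c \<in> carrier FUW" if "u \<in> carrier U" "w \<in> carrier W" for u w c
    using that by simp
  note defs = pure_tensor_def tensor_prod_def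
  {
    assume "u \<in> carrier U" "w \<in> carrier W"
    then show "pure_tensor U W u w \<in> carrier (tensor_prod U W)"
      using F.quot_simps(1)[OF s l] by (auto simp: defs)
  next
    assume a: "u \<in> carrier U" "u' \<in> carrier U" "w \<in> carrier W"
    have "single (u \<oplus>\<^bsub>U\<^esub> u', w) 1 - (single (u, w) 1 + single (u', w) 1) \<in> ?I"
      using a by (intro r) (auto simp: diff_diff_eq)
    then have "?I +>\<^bsub>FUW\<^esub> single (u \<oplus>\<^bsub>U\<^esub> u', w) 1 = ?I +>\<^bsub>FUW\<^esub> (single (u, w) 1 + single (u', w) 1)"
      using a F.a_closed[OF l l, of u w u' w 1 1] by (intro eq) auto
    then show "pure_tensor U W (u \<oplus>\<^bsub>U\<^esub> u') w =
        pure_tensor U W u w \<oplus>\<^bsub>tensor_prod U W\<^esub> pure_tensor U W u' w"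
      using F.quot_simps(4)[OF s l l, of u w u' w 1 1] a by (simp add: defs)
  next
    assume a: "u \<in> carrier U" "w \<in> carrier W" "w' \<in> carrier W"
    have "single (u, w \<oplus>\<^bsub>W\<^esub> w') 1 - (single (u, w) 1 + single (u, w') 1) \<in> ?I"
      by (rule r, rule UnI1, rule UnI1, rule UnI2) (use a in \<open>auto simp: diff_diff_eq\<close>)
    then have "?I +>\<^bsub>FUW\<^esub> single (u, w \<oplus>\<^bsub>W\<^esub> w') 1 = ?I +>\<^bsub>FUW\<^esub> (single (u, w) 1 + single (u, w') 1)"
      using a F.a_closed[OF l l, of u w u w' 1 1] by (intro eq) auto
    then show "pure_tensor U W u (w \<oplus>\<^bsub>W\<^esub> w') =
        pure_tensor U W u w \<oplus>\<^bsub>tensor_prod U W\<^esub> pure_tensor U W u w'"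
      using F.quot_simps(4)[OF s l l, of u w u w' 1 1] a by (simp add: defs)
  next
    assume a: "u \<in> carrier U" "w \<in> carrier W"
    have "?I +>\<^bsub>FUW\<^esub> single (c \<odot>\<^bsub>U\<^esub> u, w) 1 = ?I +>\<^bsub>FUW\<^esub> single (u, w) c"
      using a by (intro eq r) auto
    then show "pure_tensor U W (c \<odot>\<^bsub>U\<^esub> u) w = c \<odot>\<^bsub>tensor_prod U W\<^esub> pure_tensor U W u w"
      using F.quot_simps(5)[OF s l, of u w c 1] a by (simp add: defs)
    have "?I +>\<^bsub>FUW\<^esub> single (u, c \<odot>\<^bsub>W\<^esub> w) 1 = ?I +>\<^bsub>FUW\<^esub> single (u, w) c"
      using a by (intro eq r) auto
    then show "pure_tensor U W u (c \<odot>\<^bsub>W\<^esub> w) = c \<odot>\<^bsub>tensor_prod U W\<^esub> pure_tensor U W u w"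
      using F.quot_simps(5)[OF s l, of u w c 1] a by (simp add: defs)
  }
qed

lemma pure_tensor_linmap:
  "w \<in> carrier W \<Longrightarrow> linmap U (tensor_prod U W) (\<lambda>u. pure_tensor U W u w)"
  "u \<in> carrier U \<Longrightarrow> linmap W (tensor_prod U W) (\<lambda>w. pure_tensor U W u w)"
  by (simp_all add: linmap_def pure_tensor)

lemma tensor_prod_lift:
  assumes Z: "vecsp Z"
    and b1: "\<And>w. w \<in> carrier W \<Longrightarrow> linmap U Z (\<lambda>u. b u w)"
    and b2: "\<And>u. u \<in> carrier U \<Longrightarrow> linmap W Z (b u)"
  obtains h where "linmap (tensor_prod U W) Z h"
    "\<And>u w. u \<in> carrier U \<Longrightarrow> w \<in> carrier W \<Longrightarrow> h (pure_tensor U W u w) = b u w"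
proof -
  interpret Z: vecsp Z by fact
  define k where "k = lincomb Z (\<lambda>(u, w). b u w)"
  note b = linmapD[OF b1] linmapD[OF b2]
  have "linmap FUW Z k"
    unfolding k_def using b by (intro Z.linmap_lincomb) auto
  then interpret k: linmap_loc FUW Z k
    by unfold_locales
  have ks: "k (single (u, w) c) = c \<odot>\<^bsub>Z\<^esub> b u w" if "u \<in> carrier U" "w \<in> carrier W" for u w c
    unfolding k_def using b(1) that by (subst Z.lincomb_single) auto
  have l: "single (u, w) c \<in> carrier FUW" if "u \<in> carrier U" "w \<in> carrier W" for u w c
    using that by simp
  have m: "p - q \<in> carrier FUW" "k (p - q) = k p \<ominus>\<^bsub>Z\<^esub> k q"
    if "p \<in> carrier FUW" "q \<in> carrier FUW" for p q
    using F.minus_closed[OF that] free_vs_minus[OF that] k.h_minus[OF that] by simp_all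
  have z2: "x \<ominus>\<^bsub>Z\<^esub> x = \<zero>\<^bsub>Z\<^esub>" if "x \<in> carrier Z" for x
    using that by (simp add: a_minus_def Z.r_neg)
  have z: "x \<oplus>\<^bsub>Z\<^esub> y \<ominus>\<^bsub>Z\<^esub> x \<ominus>\<^bsub>Z\<^esub> y = \<zero>\<^bsub>Z\<^esub>" if "x \<in> carrier Z" "y \<in> carrier Z" for x y
  proof -
    have "x \<oplus>\<^bsub>Z\<^esub> y \<ominus>\<^bsub>Z\<^esub> x \<ominus>\<^bsub>Z\<^esub> y = (x \<oplus>\<^bsub>Z\<^esub> y) \<ominus>\<^bsub>Z\<^esub> (x \<oplus>\<^bsub>Z\<^esub> y)"
      using that by (simp add: a_minus_def Z.minus_add Z.a_assoc)
    with that show ?thesis by (simp add: z2)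
  qed
  have gen: "k r = \<zero>\<^bsub>Z\<^esub>" if "r \<in> bigens" for r
    using that
    by (elim UnE CollectE exE conjE; hypsubst)
      (simp_all only: m l ks b z z2 Z.a_closed U.a_closed W.a_closed U.smult_closed W.smult_closed Z.smult_one
         Z.smult_closed)
  have "bilinear_rels U W \<subseteq> {x \<in> carrier FUW. k x = \<zero>\<^bsub>Z\<^esub>}"
    unfolding bilinear_rels_def
  proof (rule F.vspan_least)
    show "subspace FUW {x \<in> carrier FUW. k x = \<zero>\<^bsub>Z\<^esub>}"
      unfolding subspace_def using F.a_closed F.smult_closed F.zero_closed k.h k.h_zero by auto
  qed (intro subsetI CollectI conjI, erule subsetD[OF bigens_closed], erule gen)
  then obtain h where "linmap (tensor_prod U W) Z h"
    "\<And>x. x \<in> carrier FUW \<Longrightarrow> h (bilinear_rels U W +>\<^bsub>FUW\<^esub> x) = k x"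
    using k.linmap_quot[OF bilinear_rels_subspace] unfolding tensor_prod_def by blast
  then show ?thesis
    using that ks b(1) l by (simp add: pure_tensor_def)
qed

text \<open>Two passes, one per argument, by linearity of \<open>pure_tensor\<close> in each. Only
  generation is claimed; independence of such tensors is inherited later from their images in
  Q_n.\<close>

lemma tensor_prod_span:
  assumes "carrier U \<subseteq> vspan U S" "carrier W \<subseteq> vspan W T" "S \<subseteq> carrier U" "T \<subseteq> carrier W"
  shows "carrier (tensor_prod U W) = vspan (tensor_prod U W) {pure_tensor U W s t |s t. s \<in> S \<and> t \<in> T}"
    (is "_ = vspan _ ?P")
proof
  interpret T: vecsp "tensor_prod U W" by (rule vecsp_tensor_prod)
  have P: "?P \<subseteq> carrier (tensor_prod U W)" using assms pure_tensor(1) by blast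
  then show "vspan (tensor_prod U W) ?P \<subseteq> carrier (tensor_prod U W)" by (rule T.vspan_closed)
  have 1: "pure_tensor U W s w \<in> vspan (tensor_prod U W) ?P" if "s \<in> S" "w \<in> carrier W" for s w
  proof -
    have s: "s \<in> carrier U" using that assms by auto
    interpret L: linmap_loc W "tensor_prod U W" "pure_tensor U W s"
      by unfold_locales (rule pure_tensor_linmap(2)[OF s])
    have "pure_tensor U W s w \<in> vspan (tensor_prod U W) (pure_tensor U W s ` T)"
      using L.h_vspan[OF assms(4)] assms(2) that(2) by auto
    moreover have "pure_tensor U W s ` T \<subseteq> ?P" using that by blast
    ultimately show ?thesis using T.vspan_mono by blast
  qed
  have 2: "pure_tensor U W u w \<in> vspan (tensor_prod U W) ?P" if "u \<in> carrier U" "w \<in> carrier W" for u w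
  proof -
    interpret L: linmap_loc U "tensor_prod U W" "\<lambda>u. pure_tensor U W u w"
      by unfold_locales (rule pure_tensor_linmap(1)[OF that(2)])
    have "pure_tensor U W u w \<in> vspan (tensor_prod U W) ((\<lambda>u. pure_tensor U W u w) ` S)"
      using L.h_vspan[OF assms(3)] assms(1) that(1) by auto
    moreover have "vspan (tensor_prod U W) ((\<lambda>u. pure_tensor U W u w) ` S) \<subseteq> vspan (tensor_prod U W) ?P"
      using 1 that(2) by (intro T.vspan_least T.subspace_vspan P) auto
    ultimately show ?thesis by blast
  qed
  interpret \<pi>: linmap_loc FUW "tensor_prod U W" "\<lambda>x. bilinear_rels U W +>\<^bsub>FUW\<^esub> x"
    by unfold_locales (use F.linmap_coset[OF bilinear_rels_subspace] in \<open>simp add: tensor_prod_def\<close>)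
  have "carrier (tensor_prod U W) = (\<lambda>x. bilinear_rels U W +>\<^bsub>FUW\<^esub> x) ` carrier FUW"
    using F.quot_simps(1)[OF bilinear_rels_subspace F.zero_closed] by (simp add: tensor_prod_def)
  also have "\<dots> = vspan (tensor_prod U W)
      ((\<lambda>x. bilinear_rels U W +>\<^bsub>FUW\<^esub> single x 1) ` (carrier U \<times> carrier W))"
    unfolding free_vs_span[of "carrier U \<times> carrier W"]
    by (subst \<pi>.h_vspan) (auto simp: image_image)
  also have "\<dots> \<subseteq> vspan (tensor_prod U W) ?P"
    using 2 by (intro T.vspan_least T.subspace_vspan P) (auto simp: pure_tensor_def)
  finally show "carrier (tensor_prod U W) \<subseteq> vspan (tensor_prod U W) ?P" .
qed

end

section \<open>The algebra of endomorphisms acting from the right\<close>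

text \<open>The product \<open>f \<otimes> g\<close> applies \<open>f\<close> first, so an algebra
  homomorphism into \<open>endalg V\<close> is a right module structure. Restricting to extensional
  functions makes equality of endomorphisms the same as equality on the carrier, as the ring axioms
  demand.\<close>

definition endalg :: "('f, 'a) module \<Rightarrow> ('f, 'a \<Rightarrow> 'a) module" where
  "endalg V = \<lparr>carrier = {f \<in> extensional (carrier V). linmap V V f},
    mult = (\<lambda>f g. \<lambda>x\<in>carrier V. g (f x)), one = (\<lambda>x\<in>carrier V. x),
    zero = (\<lambda>x\<in>carrier V. \<zero>\<^bsub>V\<^esub>), add = (\<lambda>f g. \<lambda>x\<in>carrier V. f x \<oplus>\<^bsub>V\<^esub> g x),
    smult = (\<lambda>c f. \<lambda>x\<in>carrier V. c \<odot>\<^bsub>V\<^esub> f x)\<rparr>"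

lemma (in vecsp) falg_endalg: "falg (endalg V)"
proof -
  have sc: "c \<odot> (d \<odot> x) = d \<odot> (c \<odot> x)" if "x \<in> carrier V" for c d x
    using that by (metis mult.commute smult_smult)
  note simps = endalg_def linmap_def restrict_def extensional_def fun_eq_iff
  have cl: "f \<oplus>\<^bsub>endalg V\<^esub> g \<in> carrier (endalg V)" "f \<otimes>\<^bsub>endalg V\<^esub> g \<in> carrier (endalg V)"
    "c \<odot>\<^bsub>endalg V\<^esub> f \<in> carrier (endalg V)"
    if "f \<in> carrier (endalg V)" "g \<in> carrier (endalg V)" for f g c
    using that by (auto simp: simps smult_add_right a_ac intro: sc)
  have cl': "\<zero>\<^bsub>endalg V\<^esub> \<in> carrier (endalg V)" "\<one>\<^bsub>endalg V\<^esub> \<in> carrier (endalg V)"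
    by (auto simp: endalg_def linmap_def)
  have inv: "\<exists>g\<in>carrier (endalg V). g \<oplus>\<^bsub>endalg V\<^esub> f = \<zero>\<^bsub>endalg V\<^esub>" if f: "f \<in> carrier (endalg V)" for f
    using f by (intro bexI[OF _ cl(3)[OF f f, of "-1"]]) (auto simp: simps minus_one_smult l_neg)
  have "abelian_group (endalg V)"
    by (intro abelian_groupI inv cl cl'; assumption?)
      (auto simp: simps a_ac)
  moreover have "monoid (endalg V)"
    by (intro monoidI cl cl'; assumption?) (auto simp: simps)
  ultimately show ?thesis
    by (intro falg.intro ringI vecsp.intro vecsp_axioms.intro falg_axioms.intro cl; assumption?)
      (auto simp: simps smult_add_left smult_add_right smult_smult)
qed

section \<open>A right module with the normal words as a basis\<close>

definition lext :: "('i \<Rightarrow> ('j \<Rightarrow>\<^sub>0 'f::field)) \<Rightarrow> ('i \<Rightarrow>\<^sub>0 'f) \<Rightarrow> ('j \<Rightarrow>\<^sub>0 'f)" where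
  "lext F = lincomb (free_vs UNIV) F"

lemma lext_linmap: "linmap (free_vs UNIV) (free_vs UNIV) (lext F)"
  unfolding lext_def by (rule vecsp.linmap_lincomb[OF vecsp_free_vs]) auto

lemma lext_add: "lext F (u + v) = lext F u + lext F v"
  and lext_scl: "lext F (scl c u) = scl c (lext F u)"
  using linmapD(2,3)[OF lext_linmap] by auto

lemma lext_0 [simp]: "lext F 0 = 0"
  using lext_add[of F 0 0] by simp

lemma lext_diff: "lext F (u - v) = lext F u - lext F v"
  using lext_add[of F "u - v" v] by (simp add: algebra_simps)

lemma lext_single: "lext F (single w c) = scl c (F w)"
  unfolding lext_def by (subst vecsp.lincomb_single[OF vecsp_free_vs]) auto

lemma lext_cong: "(\<And>w. w \<in> keys v \<Longrightarrow> F w = G w) \<Longrightarrow> lext F v = lext G v"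
  unfolding lext_def by (rule vecsp.lincomb_cong[OF vecsp_free_vs]) auto

lemma keys_lext: "(\<And>w. w \<in> keys v \<Longrightarrow> keys (F w) \<subseteq> S) \<Longrightarrow> keys (lext F v) \<subseteq> S"
proof -
  assume F: "\<And>w. w \<in> keys v \<Longrightarrow> keys (F w) \<subseteq> S"
  from subset_refl[of "keys v"] show ?thesis
  proof (induction v rule: keys_subset_induct)
    case (single_add k c p)
    have "keys (scl c (F k)) \<subseteq> S" using F[OF single_add(1)] keys_scl[of c "F k"] by blast
    then show ?case
      using single_add keys_add[of "scl c (F k)" "lext F p"] by (auto simp: lext_add lext_single)
  qed simp
qed

lemma lext_id: "lext (\<lambda>w. single w 1) v = v"
  using subset_refl[of "keys v"]
  by (induction v rule: keys_subset_induct) (simp_all add: lext_add lext_single)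

lemma keys_sum_subset: "(\<And>i. i \<in> I \<Longrightarrow> keys (g i) \<subseteq> S) \<Longrightarrow> keys (sum g I) \<subseteq> S"
proof (induction I rule: infinite_finite_induct)
  case (insert x F)
  then show ?case using keys_add[of "g x" "sum g F"] by auto
qed auto

lemma keys_diff_subset: "keys (u :: 'a \<Rightarrow>\<^sub>0 'f::field) \<subseteq> S \<Longrightarrow> keys v \<subseteq> S \<Longrightarrow> keys (u - v) \<subseteq> S"
  using keys_diff[of u v] by blast

section \<open>Words and the action of the coefficients of P_B\<close>

type_synonym word = "(nat set \<times> nat) list"
type_synonym 'f wvec = "word \<Rightarrow>\<^sub>0 'f"

text \<open>
  Words are stored in reverse: the head of the list is the last letter, the one on which
  the right action operates.
\<close>

definition conf :: "word \<Rightarrow> nat set \<Rightarrow> bool" where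
  "conf w B = (case w of [] \<Rightarrow> False | (A, j) # _ \<Rightarrow> B \<subseteq> A \<and> card B = card A - j)"

lemma conf_simps [simp]:
  "\<not> conf [] B" "conf ((A, j) # w) B \<longleftrightarrow> B \<subseteq> A \<and> card B = card A - j"
  by (simp_all add: conf_def)

fun nword :: "word \<Rightarrow> bool" where
  "nword [] = True"
| "nword ((A, j) # w) = (finite A \<and> 1 \<le> j \<and> j \<le> card A \<and> \<not> conf w A \<and> nword w)"

text \<open>Bare multiplication by the coefficient of t^k in P_B, without rewriting: P_B has
  constant term 1 and degree |B|, which explains the two default values. It agrees with the intended
  action only on words that \<open>B\<close> does not conflict with.\<close>

definition app :: "nat set \<Rightarrow> nat \<Rightarrow> word \<Rightarrow> (('f::field) wvec)" where
  "app B k w = (if k = 0 then single w 1 else if k \<le> card B then single ((B, k) # w) 1 else 0)"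

abbreviation lapp :: "nat set \<Rightarrow> nat \<Rightarrow> (('f::field) wvec) \<Rightarrow> ('f wvec)" where
  "lapp B k \<equiv> lext (app B k)"

lemma lapp_0 [simp]: "lapp B 0 v = v"
  using lext_id[of v] by (simp add: app_def[abs_def])

text \<open>Division of power series: these are the coefficients of the X without constant term for
  which X P_B = S, where P_B acts by \<open>lapp\<close> and S has constant term 0. In a conflict
  with a letter (A, j) only the indices i \<le> j are used, and the coefficients below j contain no
  words in conflict with \<open>B\<close>, so bare appending is correct there.\<close>

function divs :: "nat set \<Rightarrow> (nat \<Rightarrow> (('f::field) wvec)) \<Rightarrow> nat \<Rightarrow> ('f wvec)" where
  "divs B S m = S m - (\<Sum>i\<in>{0<..<m}. lapp B (m - i) (divs B S i))"
  by pat_completeness auto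
termination by (relation "measure (\<lambda>(B, S, m). m)") auto

declare divs.simps [simp del]

text \<open>
  The letter \<open>(A, k)\<close> plays the role of the coefficient of \<open>t\<^sup>k\<close> in \<open>P\<^sub>A(t)\<close>. The action \<open>ract B w k\<close> of the \<open>k\<close>-th coefficient of
  \<open>P\<^sub>B\<close> on a word \<open>w = w' (A:j)\<close> with \<open>B \<subseteq> A\<close> and \<open>|B| = |A| - j\<close> is forced by the condition that
  \<open>w' P\<^sub>A P\<^sub>B\<^sup>-\<^sup>1\<close> be a polynomial of degree at most \<open>j\<close>; its coefficients are given by \<open>divs\<close>.
\<close>

primrec ract :: "nat set \<Rightarrow> word \<Rightarrow> nat \<Rightarrow> (('f::field) wvec)" where
  "ract B [] = (\<lambda>k. app B k [])"
| "ract B (a # w) = (\<lambda>k. if conf (a # w) B then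
      (let j = snd a; S = (\<lambda>m. app (fst a) m w - ract B w m) in
        S (j + k) - (\<Sum>i\<in>{0<..<j}. lapp B (j + k - i) (divs B S i))
          - lapp B k (divs B S j - app (fst a) j w))
      else app B k (a # w))"

declare ract.simps(2) [simp del]

lemma ract_not_conf: "\<not> conf w B \<Longrightarrow> ract B w k = app B k w"
  by (cases w) (auto simp: ract.simps)

abbreviation R :: "nat set \<Rightarrow> nat \<Rightarrow> (('f::field) wvec) \<Rightarrow> ('f wvec)" where
  "R B k \<equiv> lext (\<lambda>w. ract B w k)"


text \<open>With X = w P_A P_B^{-1}, the coefficient of t^(j + k) in X P_B = w P_A is solved for its
  one unknown term. X_j is the word \<open>(A, j) # w\<close> plus terms without conflict, so
  multiplying it by the k-th coefficient of P_B gives the unknown plus a \<open>lapp\<close>.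
  Coefficients of X beyond j are put to 0, and X_0 = w accounts for the summand
  \<open>ract B w m\<close> inside \<open>S\<close>.\<close>

lemma ract_conf:
  fixes w :: word and A B :: "nat set"
  defines "S \<equiv> (\<lambda>m. app A m w - ract B w m :: ('f::field) wvec)"
  assumes "conf ((A, j) # w) B"
  shows "ract B ((A, j) # w) k = S (j + k) - (\<Sum>i\<in>{0<..<j}. lapp B (j + k - i) (divs B S i))
          - lapp B k (divs B S j - app A j w)"
  using assms(2) by (simp add: S_def Let_def ract.simps)

text \<open>The constant term of P_B must act as the identity also in a conflict. There the
  recursion for \<open>divs B S j\<close> makes the formula collapse to \<open>app A j w'\<close>,
  which is the word itself.\<close>

lemma ract_0:
  assumes "nword w"
  shows "ract B w 0 = (single w 1 :: ('f::field) wvec)"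
proof (cases "conf w B")
  case True
  then obtain A j w' where w: "w = (A, j) # w'" by (cases w) auto
  define S where "S = (\<lambda>m. app A m w' - ract B w' m :: 'f wvec)"
  have "divs B S j = S j - (\<Sum>i\<in>{0<..<j}. lapp B (j - i) (divs B S i))"
    by (rule divs.simps)
  then have "ract B w 0 = (app A j w' :: 'f wvec)"
    using ract_conf[of A j w' B 0, where 'f = 'f] True by (simp add: w S_def)
  then show ?thesis using assms by (simp add: w app_def)
qed (simp add: ract_not_conf app_def)

lemma R_0: "keys v \<subseteq> Collect nword \<Longrightarrow> R B 0 v = v"
proof -
  assume "keys v \<subseteq> Collect nword"
  then have "R B 0 v = lext (\<lambda>w. single w 1) v"
    by (intro lext_cong ract_0) auto
  then show ?thesis by (simp add: lext_id)
qed

definition ncw :: "nat set \<Rightarrow> word set" where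
  "ncw B = {w. nword w \<and> \<not> conf w B}"

lemma R_ncw: "keys v \<subseteq> ncw B \<Longrightarrow> R B k v = lapp B k v"
  by (rule lext_cong) (auto simp: ncw_def ract_not_conf)

section \<open>Weights and triangularity of the action\<close>

definition wl :: "nat set \<Rightarrow> nat \<Rightarrow> nat" where
  "wl A j = (\<Sum>i<j. card A - i)"

fun wt :: "word \<Rightarrow> nat" where
  "wt [] = 0"
| "wt ((A, j) # w) = wl A j + wt w"

lemma wl_0 [simp]: "wl A 0 = 0"
  by (simp add: wl_def)

lemma wl_add: "wl A (i + k) = wl A i + (\<Sum>x<k. card A - (i + x))"
  by (induction k) (simp_all add: wl_def)

text \<open>Both sides describe two chains of total length j' + k. The entries of the chain of A at
  the positions from i up to j' - 1 have more than |B| = |A| - j elements, because j' \<le> j; the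
  left side trades them for equally many further entries of the chain of B, each with at most |B|
  elements.\<close>

lemma wl_less:
  assumes "card B = card A - j" "j \<le> card A" "i < j'" "j' \<le> j"
  shows "wl A i + wl B (j' - i + k) < wl A j' + wl B k"
proof -
  define m where "m = j' - i"
  have m: "j' = i + m" "0 < m" using assms by (auto simp: m_def)
  have "wl B (m + k) = (\<Sum>x<k. card B - (m + x)) + wl B m"
    using wl_add[of B m k] by simp
  also have "\<dots> \<le> wl B k + m * card B"
    using sum_mono[of "{..<m}" "\<lambda>x. card B - x" "\<lambda>x. card B"]
    by (intro add_mono) (auto simp: wl_def intro: sum_mono)
  finally have 1: "wl B (m + k) \<le> wl B k + m * card B" .
  have "(\<Sum>x<m. Suc (card B)) \<le> (\<Sum>x<m. card A - (i + x))"
    using assms m by (intro sum_mono) auto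
  then have "m * Suc (card B) + wl A i \<le> wl A j'"
    by (simp add: m wl_add)
  with 1 m show ?thesis by (simp add: m_def[symmetric])
qed

text \<open>Truncated subtraction lets this hold for all j and k: past the end of a chain both sides
  only add zeros.\<close>

lemma wl_conf: "card B = card A - j \<Longrightarrow> wl A (j + k) = wl A j + wl B k"
  by (simp add: wl_add) (simp add: wl_def)

definition Wle :: "nat set \<Rightarrow> nat \<Rightarrow> word set" where
  "Wle B c = {w \<in> ncw B. wt w \<le> c}"

lemma Wle_mono: "c \<le> d \<Longrightarrow> Wle B c \<subseteq> Wle B d"
  by (auto simp: Wle_def)

lemma Wle_ncw: "Wle B c \<subseteq> ncw B"
  by (auto simp: Wle_def)

lemma app_ncw:
  assumes "finite B" "w \<in> ncw B"
  shows "keys (app B k w :: ('f::field) wvec) \<subseteq> Wle B (wt w + wl B k)"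
proof (cases "k = 0 \<or> k > card B")
  case False
  then have "nword ((B, k) # w)" "card B \<noteq> card B - k" using assms by (auto simp: ncw_def)
  then show ?thesis using False by (auto simp: app_def Wle_def ncw_def)
qed (use assms in \<open>auto simp: app_def Wle_def\<close>)

lemma lapp_Wle:
  assumes "finite B" "keys v \<subseteq> Wle B c" "c + wl B k \<le> d"
  shows "keys (lapp B k v) \<subseteq> Wle B d"
proof (rule keys_lext)
  fix w assume "w \<in> keys v"
  then have w: "w \<in> ncw B" "wt w + wl B k \<le> d" using assms by (auto simp: Wle_def)
  show "keys (app B k w :: 'a wvec) \<subseteq> Wle B d"
    using app_ncw[OF assms(1) w(1), where 'f = 'a] Wle_mono[OF w(2)] by (rule order_trans)
qed

text \<open>The weights enter only through \<open>wl_less\<close>; all correction terms have smaller weight.\<close>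

lemma divs_ract_keys:
  fixes B :: "nat set" and w :: word
  assumes B: "finite B" and "nword w"
  shows "k \<ge> 1 \<Longrightarrow> keys (ract B w k :: ('f::field) wvec) \<subseteq> Wle B (wt w + wl B k)" (is "_ \<Longrightarrow> ?P w k")
    and "w = (A, j) # w' \<Longrightarrow> conf w B \<Longrightarrow> k \<ge> 1 \<Longrightarrow>
      keys (ract B w k - app A (j + k) w' :: 'f wvec) \<subseteq> Wle B (wt w + wl B k - 1)"
    and "w = (A, j) # w' \<Longrightarrow> conf w B \<Longrightarrow> 0 < i \<Longrightarrow> i < j \<Longrightarrow>
      keys (divs B (\<lambda>m. app A m w' - ract B w' m :: 'f wvec) i) \<subseteq> ncw B"
    and "w = (A, j) # w' \<Longrightarrow> conf w B \<Longrightarrow>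
      keys (divs B (\<lambda>m. app A m w' - ract B w' m :: 'f wvec) j - single w 1) \<subseteq> ncw B"
proof -
  have *: "(\<forall>k\<ge>1. ?P w k) \<and> (\<forall>A j w' k i. w = (A, j) # w' \<longrightarrow> conf w B \<longrightarrow>
      (k \<ge> 1 \<longrightarrow> keys (ract B w k - app A (j + k) w' :: 'f wvec) \<subseteq> Wle B (wt w + wl B k - 1)) \<and>
      (0 < i \<and> i < j \<longrightarrow> keys (divs B (\<lambda>m. app A m w' - ract B w' m :: 'f wvec) i) \<subseteq> ncw B) \<and>
      keys (divs B (\<lambda>m. app A m w' - ract B w' m :: 'f wvec) j - single w 1) \<subseteq> ncw B)"
    using assms(2)
  proof (induction w)
    case Nil
    then show ?case
      using app_ncw[OF B, of "[]", where 'f = 'f] by (simp add: ncw_def)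
  next
    case (Cons a w)
    obtain A j where a: "a = (A, j)" by fastforce
    have n: "finite A" "1 \<le> j" "j \<le> card A" "\<not> conf w A" "nword w"
      using Cons.prems by (auto simp: a)
    show ?case
    proof (cases "conf (a # w) B")
      case False
      then have "\<forall>k\<ge>1. ?P (a # w) k"
        using app_ncw[OF B, of "a # w", where 'f = 'f] Cons.prems by (simp add: ncw_def ract_not_conf)
      with False show ?thesis by blast
    next
      case True
      then have BA: "B \<subseteq> A" "card B = card A - j" by (auto simp: a)
      define S where "S = (\<lambda>m. app A m w - ract B w m :: 'f wvec)"
      have G: "keys (ract B w k :: 'f wvec) \<subseteq> Wle B (wt w + wl B k)" if "k \<ge> 1" for k
        using Cons.IH n(5) that by blast
      \<comment> \<open>(A, j) is the only letter on the set A that \<open>B\<close> conflicts with,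
        since \<open>card A - m\<close> determines m for m \<le> card A.\<close>
      have u: "keys (app A m w :: 'f wvec) \<subseteq> Wle B (wt w + wl A m)" if "0 < m" "m \<noteq> j" for m
        using that n BA by (auto simp: app_def Wle_def ncw_def)
      \<comment> \<open>The coefficient of degree i stays within the weight of (A, i): every term of
        the recursion trades entries of the chain of A for entries of the chain of B.\<close>
      have d: "keys (divs B S i) \<subseteq> Wle B (wt w + wl A i)" if "0 < i" "i < j" for i
        using that
      proof (induction i rule: less_induct)
        case (less i)
        have "wl A 0 + wl B (i - 0 + 0) < wl A i + wl B 0"
          using less.prems BA n by (intro wl_less[OF BA(2) n(3)]) auto
        then have "keys (ract B w i :: 'f wvec) \<subseteq> Wle B (wt w + wl A i)"
          using less.prems by (intro order_trans[OF G Wle_mono]) auto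
        moreover have "keys (lapp B (i - q) (divs B S q)) \<subseteq> Wle B (wt w + wl A i)"
          if "q \<in> {0<..<i}" for q
        proof (rule lapp_Wle[OF B less.IH])
          have "wl A q + wl B (i - q + 0) < wl A i + wl B 0"
            using that less.prems BA n by (intro wl_less[OF BA(2) n(3)]) auto
          then show "wt w + wl A q + wl B (i - q) \<le> wt w + wl A i" by simp
        qed (use that less.prems in auto)
        moreover have "divs B S i = app A i w - ract B w i - (\<Sum>q\<in>{0<..<i}. lapp B (i - q) (divs B S q))"
          by (subst divs.simps) (simp add: S_def)
        ultimately show ?case
          using less.prems u[of i] by (simp only:) (intro keys_diff_subset keys_sum_subset; simp)
      qed
      \<comment> \<open>What remains of \<open>divs B S j\<close> once \<open>app A j w\<close> is
        taken off, the only word in it that conflicts with \<open>B\<close>.\<close>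
      have z0: "keys (- ract B w j - (\<Sum>i\<in>{0<..<j}. lapp B (j - i) (divs B S i))) \<subseteq> Wle B (wt w + wl A j - 1)"
      proof (intro keys_diff_subset keys_sum_subset)
        have "wl A 0 + wl B (j - 0 + 0) < wl A j + wl B 0"
          using BA n by (intro wl_less[OF BA(2) n(3)]) auto
        then show "keys (- ract B w j :: 'f wvec) \<subseteq> Wle B (wt w + wl A j - 1)"
          unfolding keys_minus using n by (intro order_trans[OF G Wle_mono]) auto
        fix i assume i: "i \<in> {0<..<j}"
        have "wl A i + wl B (j - i + 0) < wl A j + wl B 0"
          using i BA n by (intro wl_less[OF BA(2) n(3)]) auto
        then show "keys (lapp B (j - i) (divs B S i)) \<subseteq> Wle B (wt w + wl A j - 1)"
          using i by (intro lapp_Wle[OF B d]) auto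
      qed
      have "divs B S j - app A j w = - ract B w j - (\<Sum>i\<in>{0<..<j}. lapp B (j - i) (divs B S i))"
        by (subst divs.simps) (simp add: S_def)
      with z0 have z: "keys (divs B S j - app A j w) \<subseteq> Wle B (wt w + wl A j - 1)" by simp
      have aj: "app A j w = (single (a # w) 1 :: 'f wvec)"
        using n by (simp add: app_def a)
      \<comment> \<open>Positive weight of the last letter keeps the truncated \<open>- 1\<close> in
        the bounds meaningful.\<close>
      have wA: "wl A j \<ge> 1"
        using n wl_less[of "{}" A "card A" 0 j 0] by simp
      \<comment> \<open>The leading term merges the letters: (A : j)(B : k) becomes (A : j + k), of
        the same weight by \<open>wl_conf\<close>, and 0 if k > card B.\<close>
      have r: "keys (ract B (a # w) k - app A (j + k) w :: 'f wvec) \<subseteq> Wle B (wt (a # w) + wl B k - 1)"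
        if k: "k \<ge> 1" for k
      proof -
        have "ract B (a # w) k - app A (j + k) w = - ract B w (j + k) -
            (\<Sum>i\<in>{0<..<j}. lapp B (j + k - i) (divs B S i)) - lapp B k (divs B S j - app A j w)"
          using ract_conf[of A j w B k, where 'f = 'f] True
          by (simp add: a S_def)
        also have "keys \<dots> \<subseteq> Wle B (wt (a # w) + wl B k - 1)"
        proof (intro keys_diff_subset keys_sum_subset)
          have "wl A 0 + wl B (j - 0 + k) < wl A j + wl B k"
            using BA n by (intro wl_less[OF BA(2) n(3)]) auto
          then show "keys (- ract B w (j + k) :: 'f wvec) \<subseteq> Wle B (wt (a # w) + wl B k - 1)"
            unfolding keys_minus using n by (intro order_trans[OF G Wle_mono]) (auto simp: a)
          show "keys (lapp B k (divs B S j - app A j w)) \<subseteq> Wle B (wt (a # w) + wl B k - 1)"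
            using wA by (intro lapp_Wle[OF B z]) (auto simp: a)
          fix i assume i: "i \<in> {0<..<j}"
          have "wl A i + wl B (j - i + k) < wl A j + wl B k"
            using i BA n by (intro wl_less[OF BA(2) n(3)]) auto
          then show "keys (lapp B (j + k - i) (divs B S i)) \<subseteq> Wle B (wt (a # w) + wl B k - 1)"
            using i by (intro lapp_Wle[OF B d]) (auto simp: a)
        qed
        finally show ?thesis .
      qed
      have P: "?P (a # w) k" if k: "k \<ge> 1" for k
      proof -
        have "keys (ract B (a # w) k - app A (j + k) w + app A (j + k) w :: 'f wvec)
            \<subseteq> Wle B (wt (a # w) + wl B k)"
        proof (rule order_trans[OF keys_add Un_least])
          show "keys (ract B (a # w) k - app A (j + k) w :: 'f wvec) \<subseteq> Wle B (wt (a # w) + wl B k)"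
            using r[OF k] Wle_mono[of "wt (a # w) + wl B k - 1" "wt (a # w) + wl B k" B] by auto
          show "keys (app A (j + k) w :: 'f wvec) \<subseteq> Wle B (wt (a # w) + wl B k)"
            using u[of "j + k"] k n wl_conf[OF BA(2), of k] by (simp add: a add.commute add.left_commute)
        qed
        then show ?thesis by simp
      qed
      show ?thesis
      proof (intro conjI allI impI)
        fix k :: nat assume "1 \<le> k" then show "?P (a # w) k" by (rule P)
      next
        fix A' j' w' and k :: nat assume "a # w = (A', j') # w'" "1 \<le> k"
        then show "keys (ract B (a # w) k - app A' (j' + k) w' :: 'f wvec) \<subseteq> Wle B (wt (a # w) + wl B k - 1)"
          using r[of k] by (simp add: a)
      next
        fix A' j' w' and i :: nat assume "a # w = (A', j') # w'" "0 < i \<and> i < j'"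
        then show "keys (divs B (\<lambda>m. app A' m w' - ract B w' m :: 'f wvec) i) \<subseteq> ncw B"
          using d[of i] Wle_ncw by (auto simp: a S_def)
      next
        fix A' j' w' assume "a # w = (A', j') # w'"
        then show "keys (divs B (\<lambda>m. app A' m w' - ract B w' m :: 'f wvec) j' - single (a # w) 1) \<subseteq> ncw B"
          using z Wle_ncw unfolding aj by (auto simp: a S_def)
      qed
    qed
  qed
  from * show "k \<ge> 1 \<Longrightarrow> ?P w k" by blast
  from * show "w = (A, j) # w' \<Longrightarrow> conf w B \<Longrightarrow> k \<ge> 1 \<Longrightarrow>
      keys (ract B w k - app A (j + k) w' :: 'f wvec) \<subseteq> Wle B (wt w + wl B k - 1)" by blast
  from * show "w = (A, j) # w' \<Longrightarrow> conf w B \<Longrightarrow> 0 < i \<Longrightarrow> i < j \<Longrightarrow>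
      keys (divs B (\<lambda>m. app A m w' - ract B w' m :: 'f wvec) i) \<subseteq> ncw B" by blast
  from * show "w = (A, j) # w' \<Longrightarrow> conf w B \<Longrightarrow>
      keys (divs B (\<lambda>m. app A m w' - ract B w' m :: 'f wvec) j - single w 1) \<subseteq> ncw B" by blast
qed

text \<open>\<open>X\<close> is the polynomial w P_A P_B^{-1} of degree at most j, now for the true
  action \<open>R\<close> instead of \<open>lapp\<close>. The two may differ on X_0 = w, which is
  absorbed by the term \<open>ract B w m\<close> of S, and on the word \<open>(A, j) # w\<close> in
  X_j, which is therefore split off. All other terms are free of conflicts.\<close>

lemma ract_quotient:
  fixes w :: word
  assumes B: "finite B" and n: "nword ((A, j) # w)" and c: "conf ((A, j) # w) B"
  obtains X :: "nat \<Rightarrow> (('f::field) wvec)" where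
    "X 0 = single w 1" "\<And>i. 0 < i \<Longrightarrow> i < j \<Longrightarrow> keys (X i) \<subseteq> ncw B"
    "keys (X j - single ((A, j) # w) 1) \<subseteq> ncw B" "\<And>i. i > j \<Longrightarrow> X i = 0"
    "\<And>m. app A m w = (\<Sum>i\<le>m. R B (m - i) (X i))"
proof -
  define S where "S = (\<lambda>m. app A m w - ract B w m :: 'f wvec)"
  define X where "X i = (if i = 0 then single w 1 else if i \<le> j then divs B S i else 0)" for i
  have j: "0 < j" "j \<le> card A" "nword w" using n by auto
  note K2 = divs_ract_keys(3)[OF B n refl c, where 'f = 'f]
    and K3 = divs_ract_keys(4)[OF B n refl c, where 'f = 'f]
  have Xi: "keys (X i) \<subseteq> ncw B" if "0 < i" "i < j" for i
    using K2[OF that] that by (simp add: X_def S_def)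
  have Xj: "keys (X j - single ((A, j) # w) 1) \<subseteq> ncw B"
    using K3 j by (simp add: X_def S_def)
  have aj: "app A j w = (single ((A, j) # w) 1 :: 'f wvec)"
    using j by (simp add: app_def)
  have RX: "R B k (X i) = lapp B k (divs B S i)" if "0 < i" "i < j" for i k
    using R_ncw[OF Xi[OF that]] that by (simp add: X_def)
  have RXj: "R B k (X j) = ract B ((A, j) # w) k + lapp B k (divs B S j - app A j w)" for k
  proof -
    have "R B k (X j) = R B k (single ((A, j) # w) 1) + R B k (X j - single ((A, j) # w) 1)"
      by (simp flip: lext_add)
    then show ?thesis
      using R_ncw[OF Xj, of k] j by (simp add: lext_single aj) (simp add: X_def)
  qed
  have X0: "R B k (X 0) = ract B w k" for k
    by (simp add: X_def lext_single)
  have S0: "app A m w = ract B w m + S m" for m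
    by (simp add: S_def)
  \<comment> \<open>Below degree j this is the recursion of \<open>divs\<close>; from j on it is
    \<open>ract_conf\<close> read backwards.\<close>
  have main: "app A m w = (\<Sum>i\<le>m. R B (m - i) (X i))" for m
  proof (cases "m < j")
    case True
    show ?thesis
    proof (cases "m = 0")
      case True
      then show ?thesis using j X0[of 0] by (simp add: ract_0 app_def)
    next
      case False
      have "{..m} = insert 0 (insert m {0<..<m})" using False by auto
      then have "(\<Sum>i\<le>m. R B (m - i) (X i)) =
          ract B w m + (R B 0 (X m) + (\<Sum>i\<in>{0<..<m}. R B (m - i) (X i)))"
        using False by (simp add: X0)
      also have "R B 0 (X m) = divs B S m"
        using RX[of m 0] True False by simp
      also have "(\<Sum>i\<in>{0<..<m}. R B (m - i) (X i)) = (\<Sum>i\<in>{0<..<m}. lapp B (m - i) (divs B S i))"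
        using True by (intro sum.cong refl RX) auto
      also have "divs B S m + \<dots> = S m"
        by (subst divs.simps) simp
      finally show ?thesis by (simp add: S0)
    qed
  next
    case False
    then obtain k where m: "m = j + k" using le_Suc_ex by (metis not_less)
    have "(\<Sum>i\<le>m. R B (m - i) (X i)) = (\<Sum>i\<le>j. R B (m - i) (X i))"
      by (rule sum.mono_neutral_right) (auto simp: m X_def)
    also have "{..j} = insert 0 (insert j {0<..<j})" using j by auto
    then have "(\<Sum>i\<le>j. R B (m - i) (X i)) =
        ract B w m + (R B k (X j) + (\<Sum>i\<in>{0<..<j}. R B (m - i) (X i)))"
      using j by (simp add: X0 m)
    also have "(\<Sum>i\<in>{0<..<j}. R B (m - i) (X i)) = (\<Sum>i\<in>{0<..<j}. lapp B (m - i) (divs B S i))"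
      by (intro sum.cong refl RX) auto
    also have "R B k (X j) = S m - (\<Sum>i\<in>{0<..<j}. lapp B (m - i) (divs B S i))"
      unfolding RXj ract_conf[OF c] by (simp add: m S_def)
    finally show ?thesis by (simp add: S0)
  qed
  show ?thesis
    by (rule that[OF _ Xi Xj _ main]) (simp_all add: X_def)
qed

section \<open>Divisibility for sets differing by one element\<close>

lemma keys_R_norm:
  assumes "finite B" "keys v \<subseteq> Collect nword"
  shows "keys (R B k v) \<subseteq> Collect nword"
proof (cases "k = 0")
  case False
  show ?thesis
  proof (rule keys_lext)
    fix w assume "w \<in> keys v"
    then have "nword w" using assms(2) by auto
    then have "keys (ract B w k :: 'a wvec) \<subseteq> Wle B (wt w + wl B k)"
      using assms(1) False by (intro divs_ract_keys(1)) auto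
    then show "keys (ract B w k :: 'a wvec) \<subseteq> Collect nword"
      by (auto simp: Wle_def ncw_def)
  qed
qed (use assms in \<open>simp add: R_0\<close>)

text \<open>
  \<open>factors B C v\<close> states that \<open>v P\<^sub>B = (v + x t) P\<^sub>C\<close> for some \<open>x\<close>; the coefficient of \<open>t\<close> determines \<open>x\<close>.
\<close>

definition factors :: "nat set \<Rightarrow> nat set \<Rightarrow> (('f::field) wvec) \<Rightarrow> bool" where
  "factors B C v \<longleftrightarrow> (\<forall>k. R B k v = R C k v +
    (if k = 0 then 0 else R C (k - 1) (R B 1 v - R C 1 v)))"

lemma factors_add: "factors B C u \<Longrightarrow> factors B C v \<Longrightarrow> factors B C (u + v)"
proof (unfold factors_def, intro allI)
  fix k assume u: "\<forall>k. R B k u = R C k u + (if k = 0 then 0 else R C (k - 1) (R B 1 u - R C 1 u))"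
    and v: "\<forall>k. R B k v = R C k v + (if k = 0 then 0 else R C (k - 1) (R B 1 v - R C 1 v))"
  show "R B k (u + v) = R C k (u + v) +
      (if k = 0 then 0 else R C (k - 1) (R B 1 (u + v) - R C 1 (u + v)))"
    unfolding lext_add spec[OF u, of k] spec[OF v, of k]
    by (cases "k = 0") (simp_all add: lext_add lext_diff algebra_simps)
qed

lemma factors_scl: "factors B C v \<Longrightarrow> factors B C (scl c v)"
proof -
  have "scl c (u - v) = scl c u - scl c v" for u v :: "'a wvec"
    by (rule poly_mapping_eqI) (simp add: lookup_minus algebra_simps)
  note scl_diff = this
  assume v: "factors B C v"
  show "factors B C (scl c v)"
    unfolding factors_def
  proof
    fix k
    have "R B k v = R C k v + (if k = 0 then 0 else R C (k - 1) (R B 1 v - R C 1 v))"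
      using v unfolding factors_def by blast
    then have "scl c (R B k v) = scl c (R C k v + (if k = 0 then 0 else R C (k - 1) (R B 1 v - R C 1 v)))"
      by (rule arg_cong)
    then show "R B k (scl c v) = R C k (scl c v) +
      (if k = 0 then 0 else R C (k - 1) (R B 1 (scl c v) - R C 1 (scl c v)))"
      by (cases "k = 0") (simp_all only: lext_scl scl_add_right scl_diff[symmetric] if_True if_False scl_zero simp_thms)
  qed
qed

lemma factors_keys:
  fixes v :: "('f::field) wvec"
  assumes "\<And>w. w \<in> keys v \<Longrightarrow> factors B C (single w 1 :: 'f wvec)"
  shows "factors B C v"
  using subset_refl[of "keys v"]
proof (induction v rule: keys_subset_induct)
  case zero
  then show ?case by (simp add: factors_def)
next
  case (single_add k c p)
  then show ?case
    using factors_add[OF factors_scl[OF assms[OF single_add(1)], where c = c] single_add(3)] by simp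
qed

lemma factors_diff:
  assumes "factors B C u" "factors B C v"
  shows "factors B C (u - v)"
proof -
  have "u - v = u + scl (-1) v"
    by (rule poly_mapping_eqI) (simp add: lookup_minus lookup_add)
  then show ?thesis using factors_add[OF assms(1) factors_scl[OF assms(2), where c = "-1"]] by (simp only:)
qed

text \<open>If \<open>B\<close> does not conflict with w, the letter (B, 1) may be appended and
  \<open>C\<close> conflicts with it, so dividing w P_B by P_C is the case j = 1 of
  \<open>ract_quotient\<close>. Otherwise the word is \<open>(A, j) # w\<close>, and w P_A is
  divided both by P_B, with quotient X of degree at most j, and by P_C, with quotient X' of degree
  at most j + 1. All X_i with i < j factor already, so t^j X_j P_B is a polynomial times P_C, whose
  coefficients can only live in degrees j and j + 1. This is the factorization of X_j, and X_j is
  the given word up to terms without conflict.\<close>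

lemma factors_all:
  assumes B: "finite B" and C: "C \<subseteq> B" "card B = Suc (card C)" and "nword w"
  shows "factors B C (single w 1 :: ('f::field) wvec)"
  using assms(4)
proof (induction w)
  fix w :: word
  have fC: "finite C" using B C by (meson finite_subset)
  have nc: "factors B C (single w 1 :: 'f wvec)" if "w \<in> ncw B" for w
  proof -
    have w: "nword w" "\<not> conf w B" using that by (auto simp: ncw_def)
    have "nword ((B, 1) # w)" "conf ((B, 1) # w) C" using w B C by auto
    then obtain X :: "nat \<Rightarrow> ('f wvec)"
      where X: "X 0 = single w 1" and "\<And>i. 0 < i \<Longrightarrow> i < 1 \<Longrightarrow> keys (X i) \<subseteq> ncw C"
        and X': "keys (X 1 - single ((B, 1) # w) 1) \<subseteq> ncw C"
        "\<And>i. i > 1 \<Longrightarrow> X i = 0" "\<And>m. app B m w = (\<Sum>i\<le>m. R C (m - i) (X i))"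
      by (rule ract_quotient[OF fC, where 'f = 'f]) (rule that; assumption)
    note X = X X'
    have R: "R B k (single w 1 :: 'f wvec) = app B k w" for k
      using w by (simp add: lext_single ract_not_conf)
    have s: "app B m w = R C m (single w 1) + (if m = 0 then 0 else R C (m - 1) (X 1))" for m
    proof -
      have "app B m w = (\<Sum>i\<in>{..m} \<inter> {0, 1}. R C (m - i) (X i))"
        unfolding X(4)
      proof (rule sum.mono_neutral_right)
        show "\<forall>i\<in>{..m} - {..m} \<inter> {0, 1}. R C (m - i) (X i) = 0"
        proof
          fix i assume "i \<in> {..m} - {..m} \<inter> {0, 1}"
          then have "i > 1" by auto
          then show "R C (m - i) (X i) = 0" by (simp add: X(3))
        qed
      qed auto
      also have "{..m} \<inter> {0, 1} = (if m = 0 then {0} else {0, 1})" by auto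
      finally show ?thesis using X(1) by auto
    qed
    have "keys (X 1) \<subseteq> Collect nword"
    proof -
      have "keys (X 1 - single ((B, 1) # w) 1 + single ((B, 1) # w) 1) \<subseteq> Collect nword"
        using keys_add[of "X 1 - single ((B, 1) # w) 1" "single ((B, 1) # w) 1"] X(2)
          \<open>nword ((B, 1) # w)\<close> by (fastforce simp: ncw_def)
      then show ?thesis by simp
    qed
    then have "app B 1 w = R C 1 (single w 1) + X 1" using s[of 1] by (simp add: R_0)
    then have "X 1 = R B 1 (single w 1) - R C 1 (single w 1)" by (simp add: R)
    then show ?thesis using s by (simp add: factors_def R)
  qed
  {
    case Nil
    then show ?case by (intro nc) (simp add: ncw_def)
  next
    case (Cons a w)
    show ?case
    proof (cases "conf (a # w) B")
      case False
      with Cons.prems show ?thesis by (intro nc) (simp add: ncw_def)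
    next
      case True
      obtain A j where a: "a = (A, j)" by fastforce
      have n: "finite A" "1 \<le> j" "j \<le> card A" "\<not> conf w A" "nword w" "nword ((A, j) # w)"
        using Cons.prems by (auto simp: a)
      have cB: "conf ((A, j) # w) B" "B \<subseteq> A" "card B = card A - j" using True by (auto simp: a)
      have nC: "nword ((A, Suc j) # w)" "conf ((A, Suc j) # w) C"
        using n cB C by auto
      obtain X :: "nat \<Rightarrow> ('f wvec)" where X: "X 0 = single w 1"
        "\<And>i. 0 < i \<Longrightarrow> i < j \<Longrightarrow> keys (X i) \<subseteq> ncw B"
        "keys (X j - single ((A, j) # w) 1) \<subseteq> ncw B" "\<And>i. i > j \<Longrightarrow> X i = 0"
        "\<And>m. app A m w = (\<Sum>i\<le>m. R B (m - i) (X i))"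
        by (rule ract_quotient[OF B n(6) cB(1), where 'f = 'f]) (rule that; assumption)
      obtain X' :: "nat \<Rightarrow> ('f wvec)" where X': "X' 0 = single w 1"
        "\<And>i. 0 < i \<Longrightarrow> i < Suc j \<Longrightarrow> keys (X' i) \<subseteq> ncw C"
        "keys (X' (Suc j) - single ((A, Suc j) # w) 1) \<subseteq> ncw C" "\<And>i. i > Suc j \<Longrightarrow> X' i = 0"
        "\<And>m. app A m w = (\<Sum>i\<le>m. R C (m - i) (X' i))"
        by (rule ract_quotient[OF fC nC, where 'f = 'f]) (rule that; assumption)
      \<comment> \<open>\<open>X0\<close> omits the coefficient X_j, the only one not yet known to
        factor. \<open>\<Delta>\<close> collects the degree-one parts of the other factorizations,
        so that X0 P_B = (X0 + \<open>\<Delta>\<close>) P_C.\<close>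
      define X0 where "X0 i = (if i = j then 0 else X i)" for i
      define \<delta> where "\<delta> v = R B 1 v - R C 1 v" for v :: "'f wvec"
      define \<Delta> where "\<Delta> i = (if i = 0 then 0 else \<delta> (X0 (i - 1)))" for i
      define T where "T i = X' i - X0 i - \<Delta> i" for i
      have nn: "keys v \<subseteq> Collect nword" if "keys (v - single w' 1) \<subseteq> ncw D" "nword w'"
        for D w' and v :: "'f wvec"
        using keys_add[of "v - single w' 1" "single w' 1"] that by (fastforce simp: ncw_def)
      have Xn: "keys (X i) \<subseteq> Collect nword" for i
      proof -
        consider "i = 0" | "0 < i \<and> i < j" | "i = j" | "i > j" by linarith
        then show ?thesis
          using X(1) X(2)[of i] X(4)[of i] nn[OF X(3)] n by cases (auto simp: ncw_def)
      qed
      have X'n: "keys (X' i) \<subseteq> Collect nword" for i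
      proof -
        consider "i = 0" | "0 < i \<and> i < Suc j" | "i = Suc j" | "i > Suc j" by linarith
        then show ?thesis
          using X'(1) X'(2)[of i] X'(4)[of i] nn[OF X'(3) nC(1)] n by cases (auto simp: ncw_def)
      qed
      have X0n: "keys (X0 i) \<subseteq> Collect nword" for i using Xn by (simp add: X0_def)
      have \<delta>n: "keys (\<delta> v) \<subseteq> Collect nword" if "keys v \<subseteq> Collect nword" for v
        unfolding \<delta>_def using that B fC by (intro keys_diff_subset keys_R_norm)
      have Tn: "keys (T i) \<subseteq> Collect nword" for i
        unfolding T_def \<Delta>_def using X'n X0n \<delta>n by (intro keys_diff_subset) auto
      have facX0: "factors B C (X0 i)" for i
      proof -
        consider "i = 0" | "0 < i \<and> i < j" | "i \<ge> j" by linarith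
        then show ?thesis
        proof cases
          case 1
          then show ?thesis using Cons.IH n X(1) by (simp add: X0_def)
        next
          case 2
          then have "keys (X0 i) \<subseteq> ncw B" using X(2)[of i] by (simp add: X0_def)
          then show ?thesis by (rule factors_keys[OF nc, OF subsetD])
        next
          case 3
          then have "X0 i = 0" using X(4)[of i] by (auto simp: X0_def)
          then show ?thesis by (simp add: factors_def)
        qed
      qed
      have fX0: "R B k (X0 i) = R C k (X0 i) + (if k = 0 then 0 else R C (k - 1) (\<delta> (X0 i)))" for k i
        using facX0[of i] unfolding factors_def \<delta>_def by blast
      \<comment> \<open>Multiplying the degree-one parts by t is a shift of the index.\<close>
      have shift: "(\<Sum>i\<le>m. if m - i = 0 then 0 else R C (m - i - 1) (\<delta> (X0 i))) =
          (\<Sum>i\<le>m. R C (m - i) (\<Delta> i))" for m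
      proof (cases m)
        case (Suc m')
        have "(\<Sum>i\<le>m. if m - i = 0 then 0 else R C (m - i - 1) (\<delta> (X0 i))) =
            (\<Sum>i\<le>m'. R C (m' - i) (\<delta> (X0 i)))"
          unfolding Suc by (simp add: Suc_diff_le del: One_nat_def)
        also have "\<dots> = (\<Sum>i\<le>Suc m'. R C (Suc m' - i) (\<Delta> i))"
          unfolding sum.atMost_Suc_shift by (simp add: \<Delta>_def)
        finally show ?thesis by (simp only: Suc)
      qed (simp add: \<Delta>_def)
      have eq: "(if j \<le> m then R B (m - j) (X j) else 0) = (\<Sum>i\<le>m. R C (m - i) (T i))" for m
      proof -
        have "(\<Sum>i\<le>m. R B (m - i) (X i)) =
            (\<Sum>i\<le>m. R B (m - i) (X0 i) + (if i = j then R B (m - j) (X j) else 0))"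
          by (rule sum.cong) (auto simp: X0_def)
        also have "\<dots> = (\<Sum>i\<le>m. R B (m - i) (X0 i)) + (if j \<le> m then R B (m - j) (X j) else 0)"
          by (simp add: sum.distrib)
        also have "(\<Sum>i\<le>m. R B (m - i) (X0 i)) =
            (\<Sum>i\<le>m. R C (m - i) (X0 i) + (if m - i = 0 then 0 else R C (m - i - 1) (\<delta> (X0 i))))"
          by (intro sum.cong refl fX0)
        also have "\<dots> = (\<Sum>i\<le>m. R C (m - i) (X0 i)) + (\<Sum>i\<le>m. R C (m - i) (\<Delta> i))"
          by (simp only: sum.distrib shift)
        finally have "app A m w = (\<Sum>i\<le>m. R C (m - i) (X0 i)) + (\<Sum>i\<le>m. R C (m - i) (\<Delta> i)) +
            (if j \<le> m then R B (m - j) (X j) else 0)"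
          unfolding X(5)[of m] .
        moreover have "(\<Sum>i\<le>m. R C (m - i) (T i)) =
            app A m w - (\<Sum>i\<le>m. R C (m - i) (X0 i)) - (\<Sum>i\<le>m. R C (m - i) (\<Delta> i))"
          unfolding X'(5)[of m] T_def lext_diff sum_subtractf ..
        ultimately show ?thesis by simp
      qed
      \<comment> \<open>The left side of \<open>eq\<close> starts in degree j and the constant term
        of P_C acts as the identity, so the low coefficients of \<open>T\<close> vanish
        successively.\<close>
      have T0: "T m = 0" if "m < j" for m
        using that
      proof (induction m rule: less_induct)
        case (less m)
        have "(\<Sum>i\<le>m. R C (m - i) (T i)) = (\<Sum>i\<in>{m}. R C (m - i) (T i))"
          using less by (intro sum.mono_neutral_right) auto
        then show ?case using eq[of m] less.prems Tn by (simp add: R_0)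
      qed
      have T1: "T m = 0" if "m > Suc j" for m
        using that X'(4)[of m] X(4)[of m] X(4)[of "m - 1"] by (simp add: T_def \<Delta>_def X0_def \<delta>_def)
      \<comment> \<open>This is \<open>eq\<close> in degree j + k, where only the coefficients of
        \<open>T\<close> at j and j + 1 survive.\<close>
      have eq2: "R B k (X j) = R C k (T j) + (if k = 0 then 0 else R C (k - 1) (T (Suc j)))" for k
      proof -
        have "R B k (X j) = (\<Sum>i\<le>j + k. R C (j + k - i) (T i))"
          using eq[of "j + k"] by simp
        also have "\<dots> = (\<Sum>i\<in>{..j + k} \<inter> {j, Suc j}. R C (j + k - i) (T i))"
        proof (rule sum.mono_neutral_right)
          show "\<forall>i\<in>{..j + k} - {..j + k} \<inter> {j, Suc j}. R C (j + k - i) (T i) = 0"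
          proof
            fix i assume "i \<in> {..j + k} - {..j + k} \<inter> {j, Suc j}"
            then have "i < j \<or> i > Suc j" by auto
            then show "R C (j + k - i) (T i) = 0" using T0 T1 by auto
          qed
        qed auto
        also have "{..j + k} \<inter> {j, Suc j} = (if k = 0 then {j} else {j, Suc j})" by auto
        finally show ?thesis by auto
      qed
      have Tj: "T j = X j"
        using eq2[of 0] Tn[of j] Xn[of j] by (simp add: R_0)
      have "T (Suc j) = \<delta> (X j)"
        using eq2[of 1] Tn[of "Suc j"] by (simp add: R_0 Tj \<delta>_def)
      then have "factors B C (X j)"
        using eq2 by (simp add: factors_def Tj \<delta>_def)
      \<comment> \<open>Taking off the terms of X_j without conflict, which factor by
        \<open>nc\<close>, leaves the given word.\<close>
      then have "factors B C (X j - (X j - single ((A, j) # w) 1))"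
        using factors_keys[OF nc, OF subsetD[OF X(3)]] by (rule factors_diff)
      then show ?thesis by (simp add: a)
    qed
  }
qed

section \<open>Strings of words, and the relations of Q_n in the module\<close>

lemma card_chain_entry:
  assumes "finite A" "k \<le> card A"
  shows "card (A - set (take k (rev (sorted_list_of_set A)))) = card A - k"
proof -
  let ?xs = "rev (sorted_list_of_set A)"
  have "card (set (take k ?xs)) = k"
    using assms by (simp add: distinct_card)
  moreover have "set (take k ?xs) \<subseteq> A"
    using assms(1) set_take_subset[of k ?xs] by auto
  ultimately show ?thesis by (simp add: card_Diff_subset finite_subset[OF _ assms(1)])
qed

lemma chain_Suc: "chain A (Suc j) = chain A j @ [A - set (take j (rev (sorted_list_of_set A)))]"
  by (simp add: chain_def)

lemma chain_0 [simp]: "chain A 0 = []"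
  by (simp add: chain_def)

lemma length_chain [simp]: "length (chain A j) = j"
  by (simp add: chain_def)

primrec str :: "word \<Rightarrow> nat set list" where
  "str [] = []"
| "str (a # w) = str w @ chain (fst a) (snd a)"

text \<open>Going down from A to B and from B to A - {i, j}, where B is A - {i} or A - {j}, the
  coefficients of t^2 express \<open>R A 2 v - R ?C 2 v\<close> by actions of degree 1. That
  difference does not know which element was removed first, and equating the two expressions is the
  relation. Composition is reversed: \<open>R B 1 (R A 1 v)\<close> stands for v r(A) r(B).\<close>

lemma R_relation:
  fixes v :: "('f::field) wvec"
  assumes A: "finite A" "i \<in> A" "j \<in> A" "i \<noteq> j" and v: "keys v \<subseteq> Collect nword"
  shows "R (A - {i}) 1 (R A 1 v) - R (A - {j}) 1 (R A 1 v)
    + (R (A - {i, j}) 1 (R (A - {i}) 1 v) - R (A - {i, j}) 1 (R (A - {j}) 1 v))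
    - R (A - {i}) 1 (R (A - {i}) 1 v) + R (A - {j}) 1 (R (A - {j}) 1 v) = 0"
proof -
  let ?C = "A - {i, j}"
  have f: "factors B C v" if "finite B" "C \<subseteq> B" "card B = Suc (card C)" for B C
    using factors_keys[OF factors_all[OF that], of v] v by blast
  have *: "R A 2 v - R ?C 2 v =
      R B 1 (R A 1 v) - R B 1 (R B 1 v) + (R ?C 1 (R B 1 v) - R ?C 1 (R ?C 1 v))"
    if "B = A - {i} \<or> B = A - {j}" for B
  proof -
    have "card {i, j} \<le> card A" using A by (intro card_mono) auto
    then have "card A \<ge> 2" using A(4) by simp
    then have "card A = Suc (card B)" "card B = Suc (card ?C)" "?C \<subseteq> B" "B \<subseteq> A"
      using that A by (auto simp: card_Diff_singleton card_Diff_subset)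
    then have fac: "factors A B v" "factors B ?C v"
      using f[of A B] f[of B ?C] A(1) finite_subset[of B A] by blast+
    have "R A 2 v = R B 2 v + R B 1 (R A 1 v - R B 1 v)"
      using spec[OF fac(1)[unfolded factors_def], of 2] by simp
    moreover have "R B 2 v = R ?C 2 v + R ?C 1 (R B 1 v - R ?C 1 v)"
      using spec[OF fac(2)[unfolded factors_def], of 2] by simp
    ultimately have "R A 2 v - R ?C 2 v = R B 1 (R A 1 v - R B 1 v) + R ?C 1 (R B 1 v - R ?C 1 v)"
      by (simp only: add.assoc add.left_commute[of _ "R ?C 2 v"] add_diff_cancel_left' add.commute)
    then show ?thesis by (simp add: lext_diff)
  qed
  have "R (A - {i}) 1 (R A 1 v) - R (A - {i}) 1 (R (A - {i}) 1 v) + (R ?C 1 (R (A - {i}) 1 v) - R ?C 1 (R ?C 1 v))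
    = R (A - {j}) 1 (R A 1 v) - R (A - {j}) 1 (R (A - {j}) 1 v) + (R ?C 1 (R (A - {j}) 1 v) - R ?C 1 (R ?C 1 v))"
    using *[of "A - {i}"] *[of "A - {j}"] by simp
  then show ?thesis by (simp add: algebra_simps)
qed

text \<open>For the empty set the series P is 1, matching the convention that v vanishes there. A
  conflict with a last letter (A, j) means j = card A, so the letter (A, j + k) that merging would
  produce does not exist.\<close>

lemma ract_empty: "nword w \<Longrightarrow> k \<ge> 1 \<Longrightarrow> ract {} w k = (0 :: ('f::field) wvec)"
proof (induction w arbitrary: k)
  case Nil
  then show ?case by (simp add: app_def)
next
  case (Cons a w)
  obtain A j where a: "a = (A, j)" by fastforce
  have l: "lapp {} q v = 0" if "q \<ge> 1" for q and v :: "'f wvec"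
    using lext_cong[of v "app {} q" "\<lambda>_. 0"] keys_lext[of v "\<lambda>_. 0" "{}"] that
    by (auto simp: app_def)
  show ?case
  proof (cases "conf (a # w) {}")
    case True
    then have "card A = j" using Cons.prems by (auto simp: a)
    have "(\<Sum>i\<in>{0<..<j}. lapp {} (j + k - i) (divs {} (\<lambda>m. app A m w - ract {} w m) i)) = (0 :: 'f wvec)"
      using Cons.prems by (intro sum.neutral ballI l) auto
    then show ?thesis
      using True ract_conf[of A j w "{}" k, where 'f = 'f] Cons.prems Cons.IH[of "j + k"] l \<open>card A = j\<close>
      by (simp add: a app_def)
  next
    case False
    then show ?thesis using Cons.prems by (simp add: ract_not_conf app_def)
  qed
qed

lemma R_empty: "keys v \<subseteq> Collect nword \<Longrightarrow> R {} 1 v = 0"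
proof -
  assume v: "keys v \<subseteq> Collect nword"
  have "keys (R {} 1 v) \<subseteq> {}"
    using v by (intro keys_lext) (auto simp: ract_empty)
  then show ?thesis by simp
qed

section \<open>Leading words of the action\<close>

definition low :: "nat \<Rightarrow> word set" where
  "low c = {w. nword w \<and> wt w < c}"

lemma wl_1 [simp]: "wl B (Suc 0) = card B"
  by (simp add: wl_def)

lemma R_low:
  assumes "finite B" "keys v \<subseteq> low c"
  shows "keys (R B 1 v) \<subseteq> low (c + card B)"
proof (rule keys_lext)
  fix w assume "w \<in> keys v"
  then have w: "nword w" "wt w < c" using assms(2) by (auto simp: low_def)
  have "keys (ract B w 1 :: 'a wvec) \<subseteq> Wle B (wt w + wl B 1)"
    using assms(1) w by (intro divs_ract_keys(1)) auto
  then show "keys (ract B w 1 :: 'a wvec) \<subseteq> low (c + card B)"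
    using w by (auto simp: Wle_def ncw_def low_def)
qed

text \<open>The leading word of w r(B): in a conflict the last chain grows by one entry, which adds
  the same weight as appending (B, 1).\<close>

definition extend :: "word \<Rightarrow> nat set \<Rightarrow> word" where
  "extend w B = (if conf w B then (fst (hd w), Suc (snd (hd w))) # tl w else (B, 1) # w)"

text \<open>The conflict case is the leading-term estimate of \<open>divs_ract_keys\<close> at k =
  1. Since B is nonempty, card A - j = card B > 0 leaves room for one more entry in the last
  chain.\<close>

lemma extend:
  assumes "nword w" "finite B" "B \<noteq> {}"
  shows "nword (extend w B)" "wt (extend w B) = wt w + card B"
    "keys (R B 1 (single w 1) - single (extend w B) 1 :: ('f::field) wvec) \<subseteq> low (wt w + card B)"
proof -
  have B: "card B \<ge> 1" using assms by (simp add: Suc_leI card_gt_0_iff)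
  have "nword (extend w B) \<and> wt (extend w B) = wt w + card B \<and>
    keys (R B 1 (single w 1) - single (extend w B) 1 :: 'f wvec) \<subseteq> low (wt w + card B)"
  proof (cases "conf w B")
    case False
    then show ?thesis
      using assms B by (simp add: extend_def lext_single ract_not_conf app_def)
  next
    case True
    then obtain A j w' where w: "w = (A, j) # w'" by (cases w) auto
    have c: "card B = card A - j" using True by (simp add: w)
    have e: "extend w B = (A, Suc j) # w'" using True by (simp add: extend_def w)
    have a: "app A (j + 1) w' = (single (extend w B) 1 :: 'f wvec)"
    proof -
      have "j + 1 \<le> card A" using B c by linarith
      then show ?thesis by (simp add: e app_def)
    qed
    have "keys (ract B w 1 - app A (j + 1) w' :: 'f wvec) \<subseteq> Wle B (wt w + wl B 1 - 1)"
      using assms w True by (intro divs_ract_keys(2)) auto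
    then have "keys (R B 1 (single w 1) - single (extend w B) 1 :: 'f wvec) \<subseteq> low (wt w + card B)"
      unfolding a using B by (auto simp: lext_single Wle_def ncw_def low_def)
    moreover have "nword (extend w B)"
    proof -
      have "Suc j \<le> card A" using B c by linarith
      then show ?thesis using assms(1) unfolding e by (simp add: w)
    qed
    moreover have "wt (extend w B) = wt w + card B"
      using wl_conf[OF c, of 1] unfolding e by (simp add: w)
    ultimately show ?thesis by blast
  qed
  then show "nword (extend w B)" "wt (extend w B) = wt w + card B"
    "keys (R B 1 (single w 1) - single (extend w B) 1 :: 'f wvec) \<subseteq> low (wt w + card B)" by auto
qed

section \<open>Presentation of \<open>Q\<^sub>n\<close>\<close>

text \<open>The relation as an expression in an arbitrary algebra, so that one formula can be
  evaluated in the tensor algebra, in Q_n and in the endomorphism algebra, and be moved along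
  homomorphisms by \<open>h_vrel\<close>.\<close>

definition vrel :: "('f, 'a) module \<Rightarrow> (nat set \<Rightarrow> 'a) \<Rightarrow> nat set \<Rightarrow> nat \<Rightarrow> nat \<Rightarrow> 'a" where
  "vrel B g A i j = (((g A \<otimes>\<^bsub>B\<^esub> (g (A - {i}) \<ominus>\<^bsub>B\<^esub> g (A - {j})))
      \<oplus>\<^bsub>B\<^esub> ((g (A - {i}) \<ominus>\<^bsub>B\<^esub> g (A - {j})) \<otimes>\<^bsub>B\<^esub> g (A - {i, j})))
      \<ominus>\<^bsub>B\<^esub> (g (A - {i}) [^]\<^bsub>B\<^esub> (2::nat)))
      \<oplus>\<^bsub>B\<^esub> (g (A - {j}) [^]\<^bsub>B\<^esub> (2::nat))"

lemma (in falg) pow2: "x \<in> carrier A \<Longrightarrow> x [^] (2::nat) = x \<otimes> x"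
  by (simp add: numeral_2_eq_2 nat_pow_Suc)

lemma (in falg) vrel_closed:
  "(\<And>C. C \<subseteq> D \<Longrightarrow> g C \<in> carrier A) \<Longrightarrow> vrel A g D i j \<in> carrier A"
  unfolding vrel_def by (intro a_closed minus_closed m_closed nat_pow_closed) auto

lemma (in alghom_loc) h_vrel:
  assumes "\<And>C. C \<subseteq> D \<Longrightarrow> g C \<in> carrier A" "\<And>C. C \<subseteq> D \<Longrightarrow> h (g C) = g' C"
  shows "h (vrel A g D i j) = vrel B g' D i j"
proof -
  have c: "g D \<in> carrier A" "g (D - {i}) \<in> carrier A" "g (D - {j}) \<in> carrier A" "g (D - {i, j}) \<in> carrier A"
    using assms(1) by auto
  have e: "h (g D) = g' D" "h (g (D - {i})) = g' (D - {i})" "h (g (D - {j})) = g' (D - {j})"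
    "h (g (D - {i, j})) = g' (D - {i, j})"
    using assms(2) by auto
  have "g' (D - {i}) \<in> carrier B" "g' (D - {j}) \<in> carrier B"
    using c h(1) e by metis+
  with c show ?thesis
    unfolding vrel_def by (simp add: A.pow2 B.pow2 h h_minus h_mult e[symmetric])
qed

lemma Vn_vecsp: "vecsp (Vn n)"
  unfolding Vn_def by (rule vecsp_free_vs)

lemma vv_closed: "A \<subseteq> {1..n} \<Longrightarrow> vv A \<in> carrier (Vn n)"
  by (auto simp: vv_def Vn_def nonempty_subsets_def)

lemma falg_Tn: "falg (Tn n)"
  by (rule vecsp.falg_tensor_alg[OF Vn_vecsp])

lemma tv_closed: "A \<subseteq> {1..n} \<Longrightarrow> tv n A \<in> carrier (Tn n)"
  using linmapD(1)[OF vecsp.linmap_tensor_incl[OF Vn_vecsp] vv_closed] .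

lemma rel_conv_vrel: "rel n A i j = vrel (Tn n) (tv n) A i j"
  by (simp add: rel_def vrel_def)

lemma Qn_rels_closed: "{rel n A i j |A i j. A \<subseteq> {1..n} \<and> i \<in> A \<and> j \<in> A \<and> i \<noteq> j} \<subseteq> carrier (Tn n)"
  by (auto simp: rel_conv_vrel intro!: falg.vrel_closed[OF falg_Tn] tv_closed)

lemma Qn_ideal: "ideal (Qn_ideal n) (Tn n)"
proof -
  interpret T: falg "Tn n" by (rule falg_Tn)
  show ?thesis unfolding Qn_ideal_def by (rule T.genideal_ideal[OF Qn_rels_closed])
qed

lemma falg_Qn: "falg (Qn n)"
  unfolding Qn_def by (rule falg.falg_quot[OF falg_Tn Qn_ideal])

lemma alghom_Qn: "alghom_loc (Tn n) (Qn n) (\<lambda>x. Qn_ideal n +>\<^bsub>Tn n\<^esub> x)"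
  using falg.alghom_coset[OF falg_Tn Qn_ideal]
  by (intro alghom_loc.intro alghom_loc_axioms.intro falg_Tn falg_Qn) (simp add: Qn_def)

lemma rr_closed: "A \<subseteq> {1..n} \<Longrightarrow> rr n A \<in> carrier (Qn n)"
proof -
  interpret q: alghom_loc "Tn n" "Qn n" "\<lambda>x. Qn_ideal n +>\<^bsub>Tn n\<^esub> x" by (rule alghom_Qn)
  show "A \<subseteq> {1..n} \<Longrightarrow> rr n A \<in> carrier (Qn n)"
    unfolding rr_def by (rule q.h(1)[OF tv_closed])
qed

lemma rr_empty [simp]: "rr n {} = \<zero>\<^bsub>Qn n\<^esub>"
proof -
  interpret q: alghom_loc "Tn n" "Qn n" "\<lambda>x. Qn_ideal n +>\<^bsub>Tn n\<^esub> x" by (rule alghom_Qn)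
  interpret t: linmap_loc "Vn n" "Tn n" "tensor_incl (Vn n)"
    by (intro linmap_loc.intro linmap_loc_axioms.intro Vn_vecsp q.A.vecsp_axioms
        vecsp.linmap_tensor_incl)
  have "tv n {} = \<zero>\<^bsub>Tn n\<^esub>"
    using t.h_zero by (simp add: vv_def Vn_def)
  then show ?thesis unfolding rr_def using q.h_zero by metis
qed

lemma Qn_vrel:
  assumes "A \<subseteq> {1..n}" "i \<in> A" "j \<in> A" "i \<noteq> j"
  shows "vrel (Qn n) (rr n) A i j = (\<zero>\<^bsub>Qn n\<^esub> :: 'f::field qel)"
proof -
  interpret q: alghom_loc "Tn n :: ('f, ('f, nat set \<Rightarrow>\<^sub>0 'f) tensor) module" "Qn n"
    "\<lambda>x. Qn_ideal n +>\<^bsub>Tn n\<^esub> x" by (rule alghom_Qn)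
  let ?I = "Qn_ideal n :: 'f qel"
  have "vrel (Qn n) (rr n) A i j = ?I +>\<^bsub>Tn n\<^esub> vrel (Tn n) (tv n) A i j"
    using assms(1) by (intro q.h_vrel[symmetric]) (auto simp: rr_def intro!: tv_closed)
  also have "vrel (Tn n) (tv n) A i j \<in> ?I"
    unfolding Qn_ideal_def using assms
    by (intro subsetD[OF q.A.genideal_self[OF Qn_rels_closed]]) (auto simp: rel_conv_vrel)
  then have "?I +>\<^bsub>Tn n\<^esub> vrel (Tn n) (tv n) A i j = ?I +>\<^bsub>Tn n\<^esub> \<zero>\<^bsub>Tn n\<^esub>"
    using q.A.coset_eq_iff[OF q.A.ideal_subspace[OF Qn_ideal], of "vrel (Tn n) (tv n) A i j" "\<zero>\<^bsub>Tn n\<^esub>"]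
      q.A.subspaceD[OF q.A.ideal_subspace[OF Qn_ideal]] by (simp add: a_minus_def)
  finally show ?thesis using q.h_zero by simp
qed

text \<open>Values on nonempty sets extend linearly, then to the tensor algebra, then to the
  quotient. The condition on \<open>g {}\<close> reflects that the relation of a two-element set
  mentions the empty set, where v vanishes.\<close>

lemma Qn_hom:
  fixes B :: "('f::field, 'b) module"
  assumes B: "falg B" and g: "\<And>A. A \<subseteq> {1..n} \<Longrightarrow> g A \<in> carrier B" "g {} = \<zero>\<^bsub>B\<^esub>"
    and r: "\<And>A i j. A \<subseteq> {1..n} \<Longrightarrow> i \<in> A \<Longrightarrow> j \<in> A \<Longrightarrow> i \<noteq> j \<Longrightarrow> vrel B g A i j = \<zero>\<^bsub>B\<^esub>"
  obtains h where "alghom (Qn n) B h" "\<And>A. A \<subseteq> {1..n} \<Longrightarrow> h (rr n A) = g A"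
proof -
  interpret B: falg B by fact
  interpret V: vecsp "Vn n :: ('f, nat set \<Rightarrow>\<^sub>0 'f) module" by (rule Vn_vecsp)
  have gn: "g ` nonempty_subsets n \<subseteq> carrier B" using g by (auto simp: nonempty_subsets_def)
  obtain k where k: "alghom (Tn n) B k"
    "\<And>x. x \<in> carrier (Vn n) \<Longrightarrow> k (tensor_incl (Vn n) x) = lincomb B g x"
    using V.tensor_alg_hom[OF B B.linmap_lincomb[OF gn, folded Vn_def]] by blast
  interpret k: alghom_loc "Tn n" B k
    by (intro alghom_loc.intro alghom_loc_axioms.intro falg_Tn B k(1))
  have kt: "k (tv n A) = g A" if "A \<subseteq> {1..n}" for A
  proof (cases "A = {}")
    case False
    then show ?thesis
      using k(2)[OF vv_closed[OF that]] g(1)[OF that] by (simp add: vv_def B.lincomb_single)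
  qed (use k(2)[OF vv_closed[OF that]] g(2) in \<open>simp add: vv_def\<close>)
  have "k x = \<zero>\<^bsub>B\<^esub>" if "x \<in> {rel n A i j |A i j. A \<subseteq> {1..n} \<and> i \<in> A \<and> j \<in> A \<and> i \<noteq> j}" for x
  proof -
    from that obtain A i j where x: "x = rel n A i j" "A \<subseteq> {1..n}" "i \<in> A" "j \<in> A" "i \<noteq> j" by blast
    have "k (vrel (Tn n) (tv n) A i j) = vrel B g A i j"
      using x(2) by (intro k.h_vrel tv_closed kt) auto
    then show ?thesis using r x by (simp add: rel_conv_vrel)
  qed
  from k.alghom_quot_genideal[OF Qn_rels_closed this] obtain h where
    h: "alghom (Qn n) B h" "\<And>x. x \<in> carrier (Tn n) \<Longrightarrow> h (Qn_ideal n +>\<^bsub>Tn n\<^esub> x) = k x"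
    unfolding Qn_def Qn_ideal_def by blast
  have "h (rr n A) = g A" if "A \<subseteq> {1..n}" for A
    using h(2)[OF tv_closed[OF that]] kt[OF that] by (simp add: rr_def)
  with h(1) that show ?thesis by blast
qed

lemma rstr_conv_mprod: "rstr n B = mprod (Qn n) (map (rr n) B)"
  by (induction B) (simp_all add: rstr_def)

lemma rstr_append:
  assumes "set B \<subseteq> Pow {1..n}" "set C \<subseteq> Pow {1..n}"
  shows "rstr n (B @ C) = rstr n B \<otimes>\<^bsub>Qn n\<^esub> rstr n C"
proof -
  have "set (map (rr n) B) \<subseteq> carrier (Qn n)" "set (map (rr n) C) \<subseteq> carrier (Qn n)"
    using assms by (auto simp only: set_map intro!: rr_closed)
  then show ?thesis unfolding rstr_conv_mprod map_append by (rule falg.mprod_append[OF falg_Qn])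
qed

lemma rstr_closed: "set B \<subseteq> Pow {1..n} \<Longrightarrow> rstr n B \<in> carrier (Qn n)"
  unfolding rstr_conv_mprod
  by (intro falg.mprod_closed[OF falg_Qn]) (auto simp only: set_map intro!: rr_closed)

definition NW :: "nat set set \<Rightarrow> word set" where
  "NW F = {w. nword w \<and> fst ` set w \<subseteq> F}"

lemma set_chain_subset: "set (chain A j) \<subseteq> Pow A"
  by (auto simp: chain_def)

lemma set_str: "fst ` set w \<subseteq> Pow U \<Longrightarrow> set (str w) \<subseteq> Pow U"
proof (induction w)
  case (Cons a w)
  then show ?case using set_chain_subset[of "fst a" "snd a"] by auto
qed simp

section \<open>Linear independence\<close>

abbreviation Nmod :: "('f::field, 'f wvec) module" where
  "Nmod \<equiv> free_vs (Collect nword)"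

text \<open>\<open>\<rho> x\<close> is the empty word acted on by x. Being a map of right modules,
  it is determined by how a further factor r(A) on the right acts, and that is all the later
  argument uses of the module.\<close>

lemma Qn_action:
  obtains \<rho> :: "'f::field qel \<Rightarrow> ('f wvec)" where
    "linmap (Qn n) Nmod \<rho>" "\<rho> \<one>\<^bsub>Qn n\<^esub> = single [] 1"
    "\<And>x A. x \<in> carrier (Qn n) \<Longrightarrow> A \<subseteq> {1..n} \<Longrightarrow> \<rho> (x \<otimes>\<^bsub>Qn n\<^esub> rr n A) = R A 1 (\<rho> x)"
proof -
  interpret V: vecsp "Nmod :: ('f, 'f wvec) module" by (rule vecsp_free_vs)
  interpret E: falg "endalg (Nmod :: ('f, 'f wvec) module)" by (rule V.falg_endalg)
  interpret Q: falg "Qn n :: ('f, 'f qel) module" by (rule falg_Qn)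
  let ?E = "endalg (Nmod :: ('f, 'f wvec) module)"
  define g :: "nat set \<Rightarrow> ('f wvec) \<Rightarrow> 'f wvec" where "g A = restrict (R A 1) (carrier Nmod)" for A
  have gc: "g A \<in> carrier ?E" if "finite A" for A
    using keys_R_norm[OF that, of _ 1] keys_add keys_scl
    by (fastforce simp: g_def endalg_def linmap_def lext_add lext_scl)
  have ev: "f v \<in> carrier Nmod" "(f \<oplus>\<^bsub>?E\<^esub> f') v = f v + f' v" "(f \<otimes>\<^bsub>?E\<^esub> f') v = f' (f v)"
    "(f \<ominus>\<^bsub>?E\<^esub> f') v = f v - f' v"
    if "f \<in> carrier ?E" "f' \<in> carrier ?E" "v \<in> carrier Nmod" for f f' v
  proof -
    show 1: "f v \<in> carrier Nmod" "(f \<oplus>\<^bsub>?E\<^esub> f') v = f v + f' v" "(f \<otimes>\<^bsub>?E\<^esub> f') v = f' (f v)" for f'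
      using that by (auto simp: endalg_def linmap_def)
    have "(f \<ominus>\<^bsub>?E\<^esub> f') \<oplus>\<^bsub>?E\<^esub> f' = f"
      using that by (simp add: a_minus_def E.a_assoc E.l_neg)
    moreover have "((f \<ominus>\<^bsub>?E\<^esub> f') \<oplus>\<^bsub>?E\<^esub> f') v = (f \<ominus>\<^bsub>?E\<^esub> f') v + f' v"
      using that by (simp add: endalg_def)
    ultimately show "(f \<ominus>\<^bsub>?E\<^esub> f') v = f v - f' v" by (simp add: algebra_simps)
  qed
  have gv: "g A v = R A 1 v" "g A v \<in> carrier Nmod" if "v \<in> carrier Nmod" "finite A" for A v
    using that keys_R_norm[OF that(2), of v 1] by (auto simp: g_def)
  have rel0: "vrel ?E g A i j = \<zero>\<^bsub>?E\<^esub>" if A: "finite A" "i \<in> A" "j \<in> A" "i \<noteq> j" for A i j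
  proof (rule extensionalityI)
    have fin: "finite (A - {i})" "finite (A - {j})" "finite (A - {i, j})" using A by auto
    note c = gc[OF A(1)] gc[OF fin(1)] gc[OF fin(2)] gc[OF fin(3)]
    have "vrel ?E g A i j \<in> carrier ?E"
      using gc A(1) finite_subset by (intro E.vrel_closed) blast
    then show "vrel ?E g A i j \<in> extensional (carrier Nmod)" by (simp add: endalg_def)
    show "\<zero>\<^bsub>?E\<^esub> \<in> extensional (carrier Nmod)" by (simp add: endalg_def)
    fix v :: "'f wvec" assume v: "v \<in> carrier Nmod"
    have cl: "g A v \<in> carrier Nmod" "g (A - {i}) v \<in> carrier Nmod" "g (A - {j}) v \<in> carrier Nmod"
      using gv(2)[OF v] A(1) fin by blast+
    have "vrel ?E g A i j v = (g (A - {i}) (g A v) - g (A - {j}) (g A v) + g (A - {i, j}) (g (A - {i}) v - g (A - {j}) v)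
        - g (A - {i}) (g (A - {i}) v)) + g (A - {j}) (g (A - {j}) v)"
      unfolding vrel_def
      by (simp only: ev E.pow2 c v cl E.a_closed E.m_closed E.minus_closed)
    also have "\<dots> = R (A - {i}) 1 (R A 1 v) - R (A - {j}) 1 (R A 1 v)
      + (R (A - {i, j}) 1 (R (A - {i}) 1 v) - R (A - {i, j}) 1 (R (A - {j}) 1 v))
      - R (A - {i}) 1 (R (A - {i}) 1 v) + R (A - {j}) 1 (R (A - {j}) 1 v)"
    proof -
      have "g (A - {i}) v - g (A - {j}) v \<in> carrier Nmod"
        using cl by (simp add: keys_diff_subset)
      then show ?thesis
        using cl A(1) fin v by (simp only: gv lext_diff)
    qed
    also have "\<dots> = 0" using v by (intro R_relation A) auto
    finally show "vrel ?E g A i j v = \<zero>\<^bsub>?E\<^esub> v" using v by (simp add: endalg_def)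
  qed
  have g0: "g {} = \<zero>\<^bsub>?E\<^esub>"
    by (rule extensionalityI[where A = "carrier Nmod"]) (auto simp: g_def endalg_def R_empty[unfolded One_nat_def])
  obtain h where h: "alghom (Qn n) ?E h" "\<And>A. A \<subseteq> {1..n} \<Longrightarrow> h (rr n A) = g A"
  proof (rule Qn_hom[OF E.falg_axioms, where g = g and n = n])
    show "g A \<in> carrier ?E" if "A \<subseteq> {1..n}" for A
      using that finite_subset by (intro gc) blast
    show "vrel ?E g A i j = \<zero>\<^bsub>?E\<^esub>" if "A \<subseteq> {1..n}" "i \<in> A" "j \<in> A" "i \<noteq> j" for A i j
      using that finite_subset by (intro rel0) blast+
  qed (use g0 that in auto)
  interpret h: alghom_loc "Qn n" ?E h
    by (intro alghom_loc.intro alghom_loc_axioms.intro Q.falg_axioms E.falg_axioms h(1))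
  define \<rho> where "\<rho> x = h x (single [] 1)" for x
  have o: "(single [] 1 :: 'f wvec) \<in> carrier Nmod" by simp
  have rc: "\<rho> x \<in> carrier Nmod" if "x \<in> carrier (Qn n)" for x
    unfolding \<rho>_def by (rule ev(1)[OF h.h(1)[OF that] h.h(1)[OF that] o])
  show ?thesis
  proof
    show "\<rho> \<one>\<^bsub>Qn n\<^esub> = single [] 1"
      using o by (simp add: \<rho>_def h.h_one) (simp add: endalg_def)
    show "linmap (Qn n) Nmod \<rho>"
      using rc o by (auto simp: linmap_def \<rho>_def h.h ev) (simp add: endalg_def)
    fix x :: "'f qel" and A assume x: "x \<in> carrier (Qn n)" and A: "A \<subseteq> {1..n}"
    have "\<rho> (x \<otimes>\<^bsub>Qn n\<^esub> rr n A) = g A (\<rho> x)"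
      using h.h_mult[OF x rr_closed[OF A]] ev(3)[OF h.h(1)[OF x] h.h(1)[OF rr_closed[OF A]] o]
      by (simp add: \<rho>_def h(2)[OF A])
    then show "\<rho> (x \<otimes>\<^bsub>Qn n\<^esub> rr n A) = R A 1 (\<rho> x)"
      using gv(1)[OF rc[OF x], of A] A finite_subset by fastforce
  qed
qed

text \<open>The entries of the string are multiplied in one at a time, each turning the leading word
  w into \<open>extend w B\<close>. The first entry of a chain opens a new letter because normality
  excludes a conflict; every further entry conflicts with the letter just built and lengthens
  it.\<close>

lemma rstr_leading:
  fixes \<rho> :: "'f::field qel \<Rightarrow> ('f wvec)"
  assumes \<rho>: "linmap (Qn n) Nmod \<rho>" "\<rho> \<one>\<^bsub>Qn n\<^esub> = single [] 1"
    "\<And>x A. x \<in> carrier (Qn n) \<Longrightarrow> A \<subseteq> {1..n} \<Longrightarrow> \<rho> (x \<otimes>\<^bsub>Qn n\<^esub> rr n A) = R A 1 (\<rho> x)"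
    and w: "w \<in> NW (Pow {1..n})"
  shows "keys (\<rho> (rstr n (str w)) - single w 1) \<subseteq> low (wt w)"
proof -
  interpret Q: falg "Qn n :: ('f, 'f qel) module" by (rule falg_Qn)
  have snoc: "keys (\<rho> (rstr n (D @ [B])) - single (extend w B) 1) \<subseteq> low (wt (extend w B))"
    if D: "set D \<subseteq> Pow {1..n}" "B \<subseteq> {1..n}" "B \<noteq> {}" "nword w"
      and k: "keys (\<rho> (rstr n D) - single w 1) \<subseteq> low (wt w)" for D w B
  proof -
    have fB: "finite B" using D(2) finite_subset by blast
    have "mprod (Qn n) (map (rr n) [B]) = (rr n B :: 'f qel)"
      by (simp add: Q.r_one[OF rr_closed[OF D(2)]])
    moreover have "rstr n (D @ [B]) = (rstr n D \<otimes>\<^bsub>Qn n\<^esub> rstr n [B] :: 'f qel)"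
      using D(1,2) by (intro rstr_append) auto
    ultimately have "rstr n (D @ [B]) = rstr n D \<otimes>\<^bsub>Qn n\<^esub> (rr n B :: 'f qel)"
      by (simp only: rstr_conv_mprod[of n "[B]"])
    then have "\<rho> (rstr n (D @ [B])) = R B 1 (\<rho> (rstr n D))"
      using \<rho>(3)[OF rstr_closed[OF D(1)] D(2)] by simp
    also have "\<dots> = R B 1 (\<rho> (rstr n D) - single w 1) + R B 1 (single w 1)"
      by (simp flip: lext_add)
    finally have e: "\<rho> (rstr n (D @ [B])) - single (extend w B) 1 =
        R B 1 (\<rho> (rstr n D) - single w 1) + (R B 1 (single w 1) - single (extend w B) 1)" by simp
    show ?thesis
      unfolding e extend(2)[OF D(4) fB D(3)]
      by (rule order_trans[OF keys_add Un_least[OF R_low[OF fB k] extend(3)[OF D(4) fB D(3)]]])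
  qed
  show ?thesis
    using w
  proof (induction w)
    case Nil
    then show ?case by (simp add: rstr_conv_mprod \<rho>(2))
  next
    case (Cons a w)
    obtain A j where a: "a = (A, j)" by fastforce
    have n: "finite A" "1 \<le> j" "j \<le> card A" "\<not> conf w A" "nword w" "A \<subseteq> {1..n}"
      and wN: "w \<in> NW (Pow {1..n})"
      using Cons.prems by (auto simp: a NW_def)
    have sw: "set (str w) \<subseteq> Pow {1..n}" using wN by (intro set_str) (auto simp: NW_def)
    \<comment> \<open>The word after i entries of the current chain; i = 0 is separate because no
      letter has length 0.\<close>
    define v where "v i = (if i = 0 then w else (A, i) # w)" for i
    have "i \<le> j \<Longrightarrow> keys (\<rho> (rstr n (str w @ chain A i)) - single (v i) 1) \<subseteq> low (wt (v i))" for i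
    proof (induction i)
      case 0
      then show ?case using Cons.IH wN by (simp add: v_def)
    next
      case (Suc i)
      define B where "B = A - set (take i (rev (sorted_list_of_set A)))"
      have cB: "card B = card A - i" unfolding B_def using n Suc.prems by (intro card_chain_entry) auto
      have "card B \<noteq> 0" using cB Suc.prems n by linarith
      then have BA: "B \<noteq> {}" "B \<subseteq> A" by (metis card.empty, simp add: B_def)
      have Bn: "B \<subseteq> {1..n}" using BA n(6) by blast
      have vi: "nword (v i)" using n Suc.prems by (auto simp: v_def)
      have "extend (v i) B = v (Suc i)"
      proof (cases "i = 0")
        case True
        then have "B = A" by (simp add: B_def)
        then show ?thesis using True n by (simp add: v_def extend_def)
      next
        case False
        then show ?thesis using BA cB by (simp add: v_def extend_def)
      qed
      moreover have "set (str w @ chain A i) \<subseteq> Pow {1..n}"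
        using sw set_chain_subset[of A i] n(6) by auto
      ultimately show ?case
        using snoc[OF _ Bn BA(1) vi, of "str w @ chain A i"] Suc by (simp add: chain_Suc B_def[symmetric])
    qed
    from this[of j] n show ?case by (simp add: a v_def)
  qed
qed

text \<open>Triangularity: take a word w of maximal weight in the support. Any other u in the
  support contributes u and words lighter than u, hence never w, so the coefficient of w survives
  unchanged and must be 0.\<close>

theorem indep_rstr: "indep (Qn n :: ('f::field, 'f qel) module) (NW (Pow {1..n})) (\<lambda>w. rstr n (str w))"
  unfolding indep_def
proof (intro allI impI, rule ccontr)
  interpret Q: falg "Qn n :: ('f, 'f qel) module" by (rule falg_Qn)
  fix p :: "'f wvec"
  assume p: "keys p \<subseteq> NW (Pow {1..n})" "lincomb (Qn n) (\<lambda>w. rstr n (str w)) p = \<zero>\<^bsub>Qn n\<^esub>" "p \<noteq> 0"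
  obtain \<rho> :: "'f qel \<Rightarrow> ('f wvec)" where \<rho>: "linmap (Qn n) Nmod \<rho>" "\<rho> \<one>\<^bsub>Qn n\<^esub> = single [] 1"
    "\<And>x A. x \<in> carrier (Qn n) \<Longrightarrow> A \<subseteq> {1..n} \<Longrightarrow> \<rho> (x \<otimes>\<^bsub>Qn n\<^esub> rr n A) = R A 1 (\<rho> x)"
    by (rule Qn_action[of n]) (rule that; assumption)
  have lead: "keys (\<rho> (rstr n (str w)) - single w 1) \<subseteq> low (wt w)" if "w \<in> NW (Pow {1..n})" for w
    by (rule rstr_leading[OF \<rho>(1,2) _ that]) (rule \<rho>(3))
  have \<rho>': "linmap (Qn n) (free_vs UNIV) \<rho>" using \<rho>(1) by (simp add: linmap_def)
  interpret r: linmap_loc "Qn n" "free_vs UNIV" \<rho>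
    by (intro linmap_loc.intro linmap_loc_axioms.intro Q.vecsp_axioms vecsp_free_vs \<rho>')
  define F where "F w = \<rho> (rstr n (str w))" for w
  have "(\<lambda>w. rstr n (str w)) ` keys p \<subseteq> carrier (Qn n)"
    using p(1) by (intro image_subsetI rstr_closed set_str) (auto simp: NW_def)
  from r.h_lincomb[OF this] have "lext F p = 0"
    using p(2) r.h_zero by (simp add: lext_def F_def[abs_def])
  moreover obtain w where w: "w \<in> keys p" "\<And>u. u \<in> keys p \<Longrightarrow> wt u \<le> wt w"
  proof -
    have "keys p \<noteq> {}" using p(3) by simp
    then have "Max (wt ` keys p) \<in> wt ` keys p" by (intro Max_in) auto
    then obtain w where "w \<in> keys p" "wt w = Max (wt ` keys p)" by auto
    then show ?thesis using that[of w] by simp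
  qed
  define q where "q = p - single w (lookup p w)"
  have qk: "keys q \<subseteq> keys p - {w}"
    by (auto simp: q_def in_keys_iff lookup_minus lookup_single when_def split: if_splits)
  have "keys (lext F q) \<subseteq> - {w}"
  proof (rule keys_lext)
    fix u assume "u \<in> keys q"
    then have u: "u \<noteq> w" "wt u \<le> wt w" "u \<in> NW (Pow {1..n})" using qk w(2) p(1) by auto
    have "keys (F u - single u 1 + single u 1) \<subseteq> low (wt u) \<union> {u}"
      using lead[OF u(3)] unfolding F_def[symmetric] by (intro order_trans[OF keys_add]) auto
    then show "keys (F u) \<subseteq> - {w}" using u by (auto simp: low_def)
  qed
  then have "lookup (lext F q) w = 0" by (auto simp: in_keys_iff)
  moreover have "lookup (F w) w = 1"
  proof -
    have "w \<notin> keys (F w - single w 1)"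
      using lead[of w] w(1) p(1) by (auto simp: F_def low_def)
    then show ?thesis by (simp add: in_keys_iff lookup_minus)
  qed
  moreover have "lext F p = scl (lookup p w) (F w) + lext F q"
    by (simp add: q_def lext_diff lext_single)
  ultimately have "lookup p w = 0" by (metis add.right_neutral lookup_add lookup_scl lookup_zero mult.right_neutral)
  with w(1) show False by (simp add: in_keys_iff)
qed

section \<open>Spanning by normal words\<close>

text \<open>Recursion at the front of a chain, complementing \<open>chain_Suc\<close> at its
  end.\<close>

lemma chain_rec:
  assumes "finite A" "A \<noteq> {}"
  shows "chain A (Suc k) = A # chain (A - {Max A}) k"
proof -
  let ?B = "A - {Max A}"
  have "sorted_list_of_set A = sorted_list_of_set ?B @ [Max A]"
  proof (rule sorted_distinct_set_unique)
    have "x < Max A" if "x \<in> ?B" for x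
      using assms that by (metis Diff_iff Max_ge insertI1 le_neq_implies_less)
    then show "sorted (sorted_list_of_set ?B @ [Max A])" "distinct (sorted_list_of_set ?B @ [Max A])"
      using assms by (auto simp: sorted_append intro: less_imp_le)
    have "insert (Max A) A = A" using Max_in[OF assms] by blast
    then show "set (sorted_list_of_set A) = set (sorted_list_of_set ?B @ [Max A])"
      using assms(1) by simp
  qed auto
  then have r: "rev (sorted_list_of_set A) = Max A # rev (sorted_list_of_set ?B)" by simp
  have "A - set (take (Suc i) (rev (sorted_list_of_set A))) = ?B - set (take i (rev (sorted_list_of_set ?B)))" for i
    unfolding r by auto
  then show ?thesis
    unfolding chain_def by (simp add: map_upt_Suc del: upt_Suc)
qed

text \<open>Unlike in a chain, any element may be removed at each step. Modulo smaller weight the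
  choice turns out not to matter.\<close>

fun is_path :: "nat set list \<Rightarrow> bool" where
  "is_path (A # B # D) = ((\<exists>i\<in>A. B = A - {i}) \<and> is_path (B # D))"
| "is_path _ = True"

lemma is_path_prefix: "is_path (D @ E) \<Longrightarrow> is_path D"
  by (induction D rule: is_path.induct) auto

lemma is_path_length:
  "is_path (A # D) \<Longrightarrow> finite A \<Longrightarrow> {} \<notin> set (A # D) \<Longrightarrow> length (A # D) \<le> card A"
proof (induction D arbitrary: A)
  case Nil
  then show ?case by (simp add: Suc_leI card_gt_0_iff)
next
  case (Cons B D)
  then obtain i where i: "i \<in> A" "B = A - {i}" by auto
  have "is_path (B # D)" "finite B" "{} \<notin> set (B # D)" using Cons.prems i(2) by auto
  from Cons.IH[OF this] have "Suc (length (B # D)) \<le> Suc (card B)" by simp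
  also have "Suc (card B) = card A" using card_Suc_Diff1[OF Cons.prems(2) i(1)] i(2) by simp
  finally show ?case by simp
qed

lemma is_path_chain: "finite A \<Longrightarrow> j \<le> card A \<Longrightarrow> is_path (chain A j)"
proof (induction j arbitrary: A)
  case (Suc j)
  have A: "A \<noteq> {}" using Suc.prems by auto
  have c: "card (A - {Max A}) = card A - 1" using A Suc.prems by simp
  have jA: "Suc j \<le> card A" by (rule Suc.prems)
  have p: "is_path (chain (A - {Max A}) j)"
    using Suc.prems c by (intro Suc.IH) auto
  show ?case
  proof (cases j)
    case 0
    then show ?thesis using A Suc.prems by (simp add: chain_rec)
  next
    case (Suc j')
    have "card (A - {Max A}) \<noteq> 0" using c jA unfolding Suc by linarith
    then have "A - {Max A} \<noteq> {}" by (metis card.empty)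
    then obtain D where D: "chain (A - {Max A}) j = (A - {Max A}) # D"
      using chain_rec[of "A - {Max A}" j'] \<open>finite A\<close> Suc by blast
    have "Max A \<in> A" using \<open>finite A\<close> A by (rule Max_in)
    then show ?thesis
      unfolding chain_rec[OF \<open>finite A\<close> A] D using p[unfolded D] by auto
  qed
qed simp

section \<open>Reduction modulo smaller weight within a family of sets\<close>

definition wts :: "nat set list \<Rightarrow> nat" where
  "wts D = sum_list (map card D)"

lemma wts_simps [simp]: "wts [] = 0" "wts (A # D) = card A + wts D" "wts (D @ E) = wts D + wts E"
  by (simp_all add: wts_def)

text \<open>\<open>F_max\<close> keeps chains inside the family and \<open>F_convex\<close> the
  paths between two of its members, so one reduction serves Q_n and both subalgebras. The bound
  \<open>card A \<ge> 2\<close> is there because the family excludes the empty set.\<close>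

locale family =
  fixes n :: nat and F :: "nat set set" and Q :: "('f::field, 'f qel) module" (structure)
  assumes Q_def: "Q = Qn n"
    and F_sub: "A \<in> F \<Longrightarrow> A \<noteq> {} \<and> A \<subseteq> {1..n}"
    and F_max: "A \<in> F \<Longrightarrow> card A \<ge> 2 \<Longrightarrow> A - {Max A} \<in> F"
    and F_convex: "A \<in> F \<Longrightarrow> B \<in> F \<Longrightarrow> B \<subseteq> C \<Longrightarrow> C \<subseteq> A \<Longrightarrow> C \<in> F"
begin

lemma F_finite: "A \<in> F \<Longrightarrow> finite A"
  using F_sub finite_subset by blast

lemma F_lists: "D \<in> lists F \<Longrightarrow> set D \<subseteq> Pow {1..n}"
  using F_sub by fastforce

lemma F_chain: "A \<in> F \<Longrightarrow> j \<le> card A \<Longrightarrow> chain A j \<in> lists F"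
proof (induction j arbitrary: A)
  case (Suc j)
  have A: "finite A" "A \<noteq> {}" using F_finite F_sub Suc.prems by auto
  show ?case
  proof (cases "j = 0")
    case True
    then show ?thesis using A Suc.prems by (simp add: chain_rec)
  next
    case False
    then have "A - {Max A} \<in> F" using Suc.prems by (intro F_max) auto
    then show ?thesis using A Suc by (simp add: chain_rec)
  qed
qed simp

lemma str_lists: "w \<in> NW F \<Longrightarrow> str w \<in> lists F"
proof (induction w)
  case (Cons a w)
  then have "w \<in> NW F" "fst a \<in> F" "snd a \<le> card (fst a)"
    by (cases a; simp add: NW_def)+
  then show ?case using Cons.IH F_chain[of "fst a" "snd a"] by simp
qed (simp add: NW_def)

sublocale Q: falg Q
  unfolding Q_def by (rule falg_Qn)

text \<open>Length is held fixed along with the weight bound: the reductions are homogeneous, and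
  recording this makes the resulting bases compatible with the grading.\<close>

definition Low :: "nat \<Rightarrow> nat \<Rightarrow> 'f qel set" where
  "Low l c = vspan Q (rstr n ` {D \<in> lists F. length D = l \<and> wts D < c})"

lemma rstr_cl: "D \<in> lists F \<Longrightarrow> rstr n D \<in> carrier Q"
  unfolding Q_def by (intro rstr_closed F_lists)

lemma rr_cl: "A \<in> F \<Longrightarrow> rr n A \<in> carrier Q"
  unfolding Q_def using F_sub by (intro rr_closed) auto

lemma rstr_app: "D \<in> lists F \<Longrightarrow> E \<in> lists F \<Longrightarrow> rstr n (D @ E) = rstr n D \<otimes> rstr n E"
  unfolding Q_def by (intro rstr_append F_lists)

lemma rstr_single: "A \<in> F \<Longrightarrow> rstr n [A] = (rr n A :: 'f qel)"
  using rr_cl[of A] by (simp add: rstr_conv_mprod Q_def[symmetric])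

lemma Low_gen_closed: "rstr n ` {D \<in> lists F. length D = l \<and> wts D < c} \<subseteq> carrier Q"
  using rstr_cl by auto

lemma subspace_Low: "subspace Q (Low l c)"
  unfolding Low_def by (rule Q.subspace_vspan[OF Low_gen_closed])

lemmas Low = Q.subspaceD[OF subspace_Low]

lemma Low_incl: "D \<in> lists F \<Longrightarrow> length D = l \<Longrightarrow> wts D < c \<Longrightarrow> rstr n D \<in> Low l c"
  unfolding Low_def by (intro vspan.incl) auto

lemma Low_context:
  assumes "D \<in> lists F" "E \<in> lists F" "x \<in> Low l c"
  shows "rstr n D \<otimes> x \<otimes> rstr n E \<in> Low (length D + l + length E) (wts D + c + wts E)"
proof -
  note d = rstr_cl[OF assms(1)] and e = rstr_cl[OF assms(2)]
  interpret L: linmap_loc Q Q "\<lambda>x. rstr n D \<otimes> x \<otimes> rstr n E"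
    by unfold_locales (use d e in \<open>auto simp: linmap_def Q.r_distr Q.l_distr Q.smult_mult_left Q.smult_mult_right\<close>)
  have "rstr n D \<otimes> x \<otimes> rstr n E \<in> vspan Q ((\<lambda>x. rstr n D \<otimes> x \<otimes> rstr n E) `
      rstr n ` {D \<in> lists F. length D = l \<and> wts D < c})"
    using assms(3) L.h_vspan[OF Low_gen_closed] unfolding Low_def by blast
  also have "\<dots> \<subseteq> Low (length D + l + length E) (wts D + c + wts E)"
  proof (intro Q.vspan_least subspace_Low subsetI)
    fix y assume "y \<in> (\<lambda>x. rstr n D \<otimes> x \<otimes> rstr n E) ` rstr n ` {D \<in> lists F. length D = l \<and> wts D < c}"
    then obtain G where G: "G \<in> lists F" "length G = l" "wts G < c"
      "y = rstr n D \<otimes> rstr n G \<otimes> rstr n E" by blast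
    then have "y = rstr n (D @ G @ E)"
      using assms d e rstr_cl[OF G(1)] by (simp add: rstr_app Q.m_assoc)
    then show "y \<in> Low (length D + l + length E) (wts D + c + wts E)"
      using G assms by (auto intro!: Low_incl)
  qed
  finally show ?thesis .
qed

definition eqv :: "nat set list \<Rightarrow> nat set list \<Rightarrow> bool" where
  "eqv D E \<longleftrightarrow> D \<in> lists F \<and> E \<in> lists F \<and> length D = length E \<and> wts D = wts E \<and>
    rstr n D \<ominus> rstr n E \<in> Low (length D) (wts D)"

lemma eqv_refl: "D \<in> lists F \<Longrightarrow> eqv D D"
  using rstr_cl[of D] Low(2) by (simp add: eqv_def a_minus_def Q.r_neg)

lemma eqv_sym: "eqv D E \<Longrightarrow> eqv E D"
proof -
  assume a: "eqv D E"
  then have c: "rstr n D \<in> carrier Q" "rstr n E \<in> carrier Q" by (auto simp: eqv_def rstr_cl)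
  have "\<ominus> (rstr n D \<ominus> rstr n E) \<in> Low (length D) (wts D)"
    using a unfolding eqv_def by (intro Low(5)) blast
  also have "\<ominus> (rstr n D \<ominus> rstr n E) = rstr n E \<ominus> rstr n D"
    using c by (simp add: a_minus_def Q.minus_add Q.a_comm)
  finally show ?thesis using a by (simp add: eqv_def)
qed

lemma eqv_trans: "eqv D E \<Longrightarrow> eqv E G \<Longrightarrow> eqv D G"
proof -
  assume a: "eqv D E" "eqv E G"
  then have c: "rstr n D \<in> carrier Q" "rstr n E \<in> carrier Q" "rstr n G \<in> carrier Q"
    by (auto simp: eqv_def rstr_cl)
  have "(rstr n D \<ominus> rstr n E) \<oplus> (rstr n E \<ominus> rstr n G) \<in> Low (length D) (wts D)"
    using a by (intro Low(3)) (auto simp: eqv_def)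
  also have "(rstr n D \<ominus> rstr n E) \<oplus> (rstr n E \<ominus> rstr n G) = rstr n D \<ominus> rstr n G"
    using c by (simp add: a_minus_def Q.a_assoc Q.r_neg1)
  finally show ?thesis using a by (simp add: eqv_def)
qed

lemma eqv_context:
  assumes "eqv D E" "G \<in> lists F" "H \<in> lists F"
  shows "eqv (G @ D @ H) (G @ E @ H)"
proof -
  have DE: "D \<in> lists F" "E \<in> lists F" using assms(1) by (auto simp: eqv_def)
  note c = rstr_cl[OF DE(1)] rstr_cl[OF DE(2)] rstr_cl[OF assms(2)] rstr_cl[OF assms(3)]
  have "rstr n G \<otimes> (rstr n D \<ominus> rstr n E) \<otimes> rstr n H
      \<in> Low (length G + length D + length H) (wts G + wts D + wts H)"
    using assms by (intro Low_context) (auto simp: eqv_def)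
  also have "rstr n G \<otimes> (rstr n D \<ominus> rstr n E) \<otimes> rstr n H = rstr n (G @ D @ H) \<ominus> rstr n (G @ E @ H)"
    using c DE assms(2,3)
    by (simp add: rstr_app a_minus_def Q.r_distr Q.l_distr Q.r_minus Q.l_minus Q.m_assoc)
  finally show ?thesis
    using assms DE by (simp add: eqv_def add.assoc)
qed

text \<open>In the defining relation the two products starting with r(A) have weight 2|A| - 1, all
  others at most 2|A| - 2. If A - {i, j} is empty its r is 0, which is why this set may lie outside
  \<open>F\<close>.\<close>

lemma eqv_swap:
  assumes F: "A \<in> F" "A - {i} \<in> F" "A - {j} \<in> F" "A - {i, j} \<in> F \<or> A - {i, j} = {}"
    and ij: "i \<in> A" "j \<in> A" "i \<noteq> j"
  shows "eqv [A, A - {i}] [A, A - {j}]"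
proof -
  let ?B = "A - {i}" and ?B' = "A - {j}" and ?C = "A - {i, j}"
  have fA: "finite A" by (rule F_finite[OF F(1)])
  have cd: "card ?B = card A - 1" "card ?B' = card A - 1" "card ?C = card A - 2" "card A \<ge> 2"
  proof -
    have "card {i, j} \<le> card A" using fA ij by (intro card_mono) auto
    then show "card A \<ge> 2" using ij by simp
  qed (use fA ij in \<open>auto simp: card_Diff_subset\<close>)
  have "?C \<subseteq> {1..n}" using F_sub[OF F(1)] by auto
  then have c: "rr n A \<in> carrier Q" "rr n ?B \<in> carrier Q" "rr n ?B' \<in> carrier Q" "rr n ?C \<in> carrier Q"
    using F by (simp_all add: rr_cl) (simp add: Q_def rr_closed)
  have two: "rstr n [G, H] = rr n G \<otimes> (rr n H :: 'f qel)" if "G \<in> F" "H \<in> F" for G H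
    using rstr_app[of "[G]" "[H]"] that by (simp add: rstr_single)
  have low: "rr n G \<otimes> rr n H \<in> Low 2 (wts [A, ?B])"
    if "G = ?B \<or> G = ?B'" "H = ?B \<or> H = ?B' \<or> H = ?C" for G H
  proof (cases "H \<in> F")
    case True
    have "rstr n [G, H] \<in> Low 2 (wts [A, ?B])"
      using that F cd True by (intro Low_incl) auto
    then show ?thesis using two[of G H] that True F by auto
  next
    case False
    then have "H = {}" using that F by auto
    then have "rr n H = \<zero>" by (simp add: Q_def)
    then show ?thesis using that(1) F rr_cl Low(2) by auto
  qed
  have v: "rr n A \<otimes> (rr n ?B \<ominus> rr n ?B') \<oplus> (rr n ?B \<ominus> rr n ?B') \<otimes> rr n ?C
     \<ominus> rr n ?B \<otimes> rr n ?B \<oplus> rr n ?B' \<otimes> rr n ?B' = (\<zero> :: 'f qel)"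
    using Qn_vrel[of A n i j, where 'f = 'f] F_sub[OF F(1)] ij c
    by (simp add: vrel_def Q_def[symmetric] Q.pow2)
  define x where "x = rr n A \<otimes> (rr n ?B \<ominus> rr n ?B')"
  define y where "y = (rr n ?B \<ominus> rr n ?B') \<otimes> rr n ?C"
  define z where "z = rr n ?B \<otimes> (rr n ?B :: 'f qel)"
  define w where "w = rr n ?B' \<otimes> (rr n ?B' :: 'f qel)"
  have cl: "x \<in> carrier Q" "y \<in> carrier Q" "z \<in> carrier Q" "w \<in> carrier Q"
    using c by (auto simp: x_def y_def z_def w_def)
  have yl: "y = rr n ?B \<otimes> rr n ?C \<ominus> rr n ?B' \<otimes> rr n ?C"
    using c by (simp add: y_def a_minus_def Q.l_distr Q.l_minus)
  have "x \<oplus> (y \<ominus> z \<oplus> w) = \<zero>"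
    using v[folded x_def y_def z_def w_def] cl by (simp add: a_minus_def Q.a_assoc)
  then have "x = \<ominus> (y \<ominus> z \<oplus> w)"
    using cl by (intro Q.minus_equality[symmetric]) auto
  moreover have "y \<ominus> z \<oplus> w \<in> Low 2 (wts [A, ?B])"
    unfolding yl z_def w_def using low by (intro Low(3,6)) auto
  ultimately have "x \<in> Low 2 (wts [A, ?B])" using Low(5) by simp
  moreover have "x = rstr n [A, ?B] \<ominus> rstr n [A, ?B']"
    using c F by (simp add: x_def two a_minus_def Q.r_distr Q.r_minus)
  ultimately show ?thesis
    using F cd by (simp add: eqv_def numeral_2_eq_2)
qed

text \<open>The induction hypothesis is used twice. The tail starting at A - {i} is first turned
  into a chain; if i is not Max A, the next removal in it is Max A. Exchanging the first two
  removals by \<open>eqv_swap\<close> makes Max A go first, and the tail from A - {Max A}, again a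
  shorter path, is straightened by induction.\<close>

lemma path_eqv_chain:
  "is_path (A # D) \<Longrightarrow> A # D \<in> lists F \<Longrightarrow> eqv (A # D) (chain A (Suc (length D)))"
proof (induction "length D" arbitrary: A D rule: less_induct)
  case less
  have A: "A \<in> F" "finite A" "A \<noteq> {}" using less.prems F_finite F_sub by auto
  show ?case
  proof (cases D)
    case Nil
    then show ?thesis using less.prems A by (simp add: chain_rec eqv_refl)
  next
    case (Cons B D')
    then obtain i where i: "i \<in> A" "B = A - {i}" using less.prems by auto
    have BD: "is_path (B # D')" "B # D' \<in> lists F" using less.prems Cons by auto
    have B: "B \<in> F" "finite B" "B \<noteq> {}" using BD F_finite F_sub by auto
    have e1: "eqv (A # B # D') (A # chain B (Suc (length D')))"
      using eqv_context[OF less.hyps[of D' B], of "[A]" "[]"] BD A Cons by simp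
    let ?a = "Max A"
    show ?thesis
    proof (cases "i = ?a")
      case True
      then show ?thesis using e1 i A Cons by (simp add: chain_rec)
    next
      case False
      have a: "?a \<in> A" "?a \<in> B" using A False i by auto
      have MB: "Max B = ?a"
        using a(2) A B i by (intro Max_eqI) auto
      let ?C = "A - {?a}" and ?G = "A - {i, ?a}"
      have G: "B - {?a} = ?G" "?C - {i} = ?G" using i by auto
      have cB: "card B = card A - 1" "card ?C = card A - 1" "card ?G = card B - 1"
        using i a A(2) B(2) G(1) by (simp_all flip: G(1))
      have lB: "Suc (length D') \<le> card B"
        using is_path_length[OF BD(1) B(2)] BD(2) F_sub by fastforce
      have "card B \<ge> 1" using lB by simp
      then have C: "?C \<in> F" using A cB by (intro F_max) auto
      \<comment> \<open>\<open>?G\<close> is empty only when B is a singleton, and then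
        \<open>D'\<close> is empty too, since a path avoiding the empty set is no longer than the
        cardinality of its first entry.\<close>
      have GF: "?G \<in> F \<or> ?G = {}"
      proof (cases "card B \<ge> 2")
        case True
        then show ?thesis using F_max[OF B(1)] MB G by simp
      next
        case False
        then have "card ?G = 0" using cB by linarith
        then show ?thesis using A(2) by simp
      qed
      define E where "E = chain ?G (length D')"
      have lE: "length E = length D'" by (simp add: E_def)
      have EF: "E \<in> lists F"
        using GF
      proof
        assume "?G \<in> F"
        then show ?thesis unfolding E_def using lB cB by (intro F_chain) auto
      next
        assume G0: "?G = {}"
        have "card ?G = 0" by (simp only: G0 card.empty)
        then have "length D' = 0" using lB cB(3) by linarith
        then show ?thesis by (simp add: E_def)
      qed
      have e2: "A # chain B (Suc (length D')) = A # B # E"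
        using B by (simp add: chain_rec MB G E_def)
      have e3: "eqv (A # B # E) (A # ?C # E)"
        using eqv_context[OF eqv_swap[of A i ?a], of "[]" E] A B C GF EF i a False by simp
      have pE: "is_path (?C # E)"
      proof (cases "length D'")
        case 0
        then show ?thesis by (simp add: E_def)
      next
        case (Suc k)
        then have "card ?G \<noteq> 0" using lB cB(3) by linarith
        then have "?G \<noteq> {}" by (metis card.empty)
        moreover have "is_path E" unfolding E_def using A lB cB by (intro is_path_chain) auto
        moreover obtain E' where E': "E = ?G # E'"
          using chain_rec[of ?G k] A(2) \<open>?G \<noteq> {}\<close> Suc by (auto simp: E_def)
        moreover have "i \<in> ?C" using i(1) False by blast
        ultimately show ?thesis
          unfolding E' using G(2) by (metis is_path.simps(1))
      qed
      have e4: "eqv (A # ?C # E) (A # chain ?C (Suc (length E)))"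
        using eqv_context[OF less.hyps[of E ?C], of "[A]" "[]"] pE C EF A Cons lE by simp
      have "A # chain ?C (Suc (length E)) = chain A (Suc (length D))"
        using A Cons lE by (simp add: chain_rec)
      with eqv_trans[OF e1[unfolded e2] eqv_trans[OF e3 e4]] show ?thesis
        by (simp add: Cons)
    qed
  qed
qed

text \<open>Elements of A - B are removed in any order; all intermediate sets lie between B and A,
  so convexity keeps them in \<open>F\<close>.\<close>

lemma ex_path:
  "A \<in> F \<Longrightarrow> B \<in> F \<Longrightarrow> B \<subseteq> A \<Longrightarrow> card A = card B + Suc j \<Longrightarrow>
    \<exists>D. is_path (A # D @ [B]) \<and> D \<in> lists F \<and> length D = j"
proof (induction j arbitrary: A)
  case 0
  have "card (A - B) = 1"
    using 0 by (subst card_Diff_subset) (auto intro: F_finite)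
  then obtain i where "A - B = {i}" by (auto simp: card_1_singleton_iff)
  then have "i \<in> A" "B = A - {i}" using 0 by auto
  then show ?case by (intro exI[of _ "[]"]) auto
next
  case (Suc j)
  have fA: "finite A" by (rule F_finite) fact
  have "B \<noteq> A" using Suc.prems by auto
  then obtain i where i: "i \<in> A" "i \<notin> B" using Suc.prems by auto
  let ?C = "A - {i}"
  have C: "B \<subseteq> ?C" "?C \<in> F" using F_convex[of A B ?C] Suc.prems i by auto
  have "card ?C = card B + Suc j" using Suc.prems i fA by simp
  from Suc.IH[OF C(2) Suc.prems(2) C(1) this] obtain D where
    "is_path (?C # D @ [B])" "D \<in> lists F" "length D = j" by blast
  then show ?case using C i by (intro exI[of _ "?C # D"]) auto
qed

text \<open>B need not arise from A by removing largest elements. The chain is replaced by a path of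
  the same length ending one element above B; appending B continues that path, which is then
  straightened to the longer chain.\<close>

lemma chain_snoc_eqv:
  assumes "A \<in> F" "B \<in> F" "B \<subseteq> A" "1 \<le> j" "j \<le> card A" "card B = card A - j"
  shows "eqv (chain A j @ [B]) (chain A (Suc j))"
proof -
  obtain k where k: "j = Suc k" using assms(4) by (cases j) auto
  have "card A = card B + Suc k" using assms k by simp
  from ex_path[OF assms(1,2,3) this] obtain D where
    D: "is_path (A # D @ [B])" "D \<in> lists F" "length D = k" by blast
  have "eqv (A # D) (chain A j)"
    using path_eqv_chain[of A D] is_path_prefix[of "A # D" "[B]"] D assms k by simp
  from eqv_context[OF this, of "[]" "[B]"] have "eqv (A # D @ [B]) (chain A j @ [B])"
    using assms by simp
  moreover have "eqv (A # D @ [B]) (chain A (Suc j))"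
    using path_eqv_chain[of A "D @ [B]"] D assms k by simp
  ultimately show ?thesis using eqv_sym eqv_trans by blast
qed

text \<open>Outer induction on the length treats all entries but the last, inner induction on the
  weight absorbs the errors. A last entry B either opens a new letter or, in a conflict, is merged
  into the last chain by \<open>chain_snoc_eqv\<close> with an error in \<open>Low\<close>. The
  weight bound in the conclusion keeps that error below the weight of D.\<close>

lemma span_normal:
  "D \<in> lists F \<Longrightarrow> rstr n D \<in> vspan Q ((\<lambda>w. rstr n (str w)) `
    {w \<in> NW F. length (str w) = length D \<and> wts (str w) \<le> wts D})"
proof (induction "length D" arbitrary: D)
  case 0
  have D: "D = []" using 0 by simp
  have "[] \<in> {w \<in> NW F. length (str w) = length D \<and> wts (str w) \<le> wts D}"
    using 0 by (simp add: NW_def)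
  then have "rstr n (str []) \<in> (\<lambda>w. rstr n (str w)) ` {w \<in> NW F. length (str w) = length D \<and> wts (str w) \<le> wts D}"
    by (rule imageI)
  from vspan.incl[OF this, of Q] show ?case by (simp add: D)
next
  case (Suc l)
  note outer = Suc.hyps(1)
  define W where "W l c = {w \<in> NW F. length (str w) = l \<and> wts (str w) \<le> c}" for l c
  have Wc: "(\<lambda>w. rstr n (str w)) ` W l c \<subseteq> carrier Q" for l c
    using rstr_cl str_lists by (auto simp: W_def)
  have mono: "vspan Q ((\<lambda>w. rstr n (str w)) ` W l c) \<subseteq> vspan Q ((\<lambda>w. rstr n (str w)) ` W l d)"
    if "c \<le> d" for l c d
    using that by (intro Q.vspan_mono) (auto simp: W_def)
  have "D \<in> lists F \<Longrightarrow> length D = Suc l \<Longrightarrow> rstr n D \<in> vspan Q ((\<lambda>w. rstr n (str w)) ` W (Suc l) (wts D))" for D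
  proof (induction "wts D" arbitrary: D rule: less_induct)
    case less
    let ?T = "vspan Q ((\<lambda>w. rstr n (str w)) ` W (Suc l) (wts D))"
    have sT: "subspace Q ?T" by (rule Q.subspace_vspan[OF Wc])
    have LowT: "Low (Suc l) (wts D) \<subseteq> ?T"
      unfolding Low_def
    proof (intro Q.vspan_least sT subsetI)
      fix x :: "'f qel" assume "x \<in> rstr n ` {E \<in> lists F. length E = Suc l \<and> wts E < wts D}"
      then obtain E where E: "E \<in> lists F" "length E = Suc l" "wts E < wts D" "x = rstr n E" by blast
      then show "x \<in> ?T" using less.hyps[of E] mono[of "wts E" "wts D" "Suc l"] by auto
    qed
    obtain E B where DE: "D = E @ [B]" using less.prems by (metis length_Suc_conv_rev)
    have E: "E \<in> lists F" "B \<in> F" "length E = l" using less.prems DE by auto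
    have b: "rr n B \<in> carrier Q" by (rule rr_cl) fact
    interpret L: linmap_loc Q Q "\<lambda>x. x \<otimes> rr n B"
      by unfold_locales (use b in \<open>auto simp: linmap_def Q.l_distr Q.smult_mult_left\<close>)
    have "rstr n E \<in> vspan Q ((\<lambda>w. rstr n (str w)) ` W l (wts E))"
      using outer[of E] E by (simp add: W_def)
    then have "rstr n D \<in> vspan Q ((\<lambda>x. x \<otimes> rr n B) ` (\<lambda>w. rstr n (str w)) ` W l (wts E))"
      using L.h_vspan[OF Wc] rstr_app[of E "[B]"] E by (auto simp: DE rstr_single)
    also have "\<dots> \<subseteq> ?T"
    proof (intro Q.vspan_least sT subsetI)
      fix x assume "x \<in> (\<lambda>x. x \<otimes> rr n B) ` (\<lambda>w. rstr n (str w)) ` W l (wts E)"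
      then obtain w where w: "w \<in> NW F" "length (str w) = l" "wts (str w) \<le> wts E"
        and x: "x = rstr n (str w) \<otimes> rr n B" by (auto simp: W_def)
      have sw: "str w \<in> lists F" using w by (intro str_lists)
      have x': "x = rstr n (str w @ [B])"
        using rstr_app[of "str w" "[B]"] sw E by (simp add: x rstr_single)
      have fB: "finite B" "B \<noteq> {}" using E F_finite F_sub by auto
      then have cB: "card B \<ge> 1" by (simp add: Suc_leI card_gt_0_iff)
      show "x \<in> ?T"
      proof (cases "conf w B")
        case False
        then have "(B, 1) # w \<in> W (Suc l) (wts D)"
          using w E fB cB by (auto simp: W_def NW_def DE chain_rec)
        then have "rstr n (str ((B, 1) # w)) \<in> ?T" by (intro vspan.incl) blast
        then show ?thesis using fB by (simp add: x' chain_rec)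
      next
        case True
        then obtain A j w' where wA: "w = (A, j) # w'" by (cases w) auto
        have A: "A \<in> F" "1 \<le> j" "j \<le> card A" "B \<subseteq> A" "card B = card A - j"
          using w True by (auto simp: wA NW_def)
        have w': "w' \<in> NW F" "nword w'" "\<not> conf w' A" "finite A" using w by (auto simp: wA NW_def)
        have e: "eqv (str w @ [B]) (str ((A, Suc j) # w'))"
          using eqv_context[OF chain_snoc_eqv[OF A(1) E(2) A(4,2,3,5)], of "str w'" "[]"] str_lists[OF w'(1)]
          by (simp add: wA)
        have "Suc j \<le> card A" using A cB by linarith
        then have "(A, Suc j) # w' \<in> W (Suc l) (wts D)"
          using w w' A e DE by (auto simp: W_def NW_def eqv_def wA)
        then have "rstr n (str ((A, Suc j) # w')) \<in> ?T" by (intro vspan.incl) blast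
        moreover have "rstr n (str w @ [B]) \<ominus> rstr n (str ((A, Suc j) # w')) \<in> ?T"
        proof -
          have "Low (Suc l) (wts (str w @ [B])) \<subseteq> Low (Suc l) (wts D)"
            unfolding Low_def using w DE by (intro Q.vspan_mono) auto
          then show ?thesis using e LowT w by (auto simp: eqv_def)
        qed
        ultimately have "(rstr n (str w @ [B]) \<ominus> rstr n (str ((A, Suc j) # w')))
            \<oplus> rstr n (str ((A, Suc j) # w')) \<in> ?T" by (intro vspan.add)
        moreover have "rstr n (str w @ [B]) \<in> carrier Q" "rstr n (str ((A, Suc j) # w')) \<in> carrier Q"
          using e by (auto simp: eqv_def simp del: str.simps intro!: rstr_cl)
        ultimately show ?thesis by (simp add: x' a_minus_def Q.a_assoc Q.l_neg del: str.simps)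
      qed
    qed
    finally show ?case .
  qed
  then show ?case using Suc by (simp add: W_def)
qed

lemma span_normal_deg:
  "vspan Q (rstr n ` {D \<in> lists F. length D = d}) =
    vspan Q ((\<lambda>w. rstr n (str w)) ` {w \<in> NW F. length (str w) = d})"
proof (intro equalityI Q.vspan_least Q.subspace_vspan subsetI)
  fix x :: "'f qel" assume "x \<in> rstr n ` {D \<in> lists F. length D = d}"
  then obtain D where D: "D \<in> lists F" "length D = d" "x = rstr n D" by blast
  have "vspan Q ((\<lambda>w. rstr n (str w)) ` {w \<in> NW F. length (str w) = length D \<and> wts (str w) \<le> wts D})
      \<subseteq> vspan Q ((\<lambda>w. rstr n (str w)) ` {w \<in> NW F. length (str w) = d})"
    using D by (intro Q.vspan_mono) auto
  then show "x \<in> vspan Q ((\<lambda>w. rstr n (str w)) ` {w \<in> NW F. length (str w) = d})"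
    using span_normal[OF D(1)] D(3) by blast
next
  fix x :: "'f qel" assume "x \<in> (\<lambda>w. rstr n (str w)) ` {w \<in> NW F. length (str w) = d}"
  then show "x \<in> vspan Q (rstr n ` {D \<in> lists F. length D = d})"
    using str_lists by (auto intro!: vspan.incl)
qed (use rstr_cl str_lists in auto)

lemma subalg_gen_normal: "subalg_gen Q (rr n ` F) = vspan Q ((\<lambda>w. rstr n (str w)) ` NW F)"
proof -
  have "subalg_gen Q (rr n ` F) = vspan Q (rstr n ` lists F)"
    using Q.subalg_gen_image[of "rr n" F] rr_cl by (auto simp: rstr_conv_mprod Q_def)
  also have "\<dots> = vspan Q ((\<lambda>w. rstr n (str w)) ` NW F)"
  proof (intro equalityI Q.vspan_least Q.subspace_vspan subsetI)
    fix x :: "'f qel" assume "x \<in> rstr n ` lists F"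
    then obtain D where D: "D \<in> lists F" "x = rstr n D" by blast
    have "vspan Q ((\<lambda>w. rstr n (str w)) ` {w \<in> NW F. length (str w) = length D \<and> wts (str w) \<le> wts D})
      \<subseteq> vspan Q ((\<lambda>w. rstr n (str w)) ` NW F)"
      by (intro Q.vspan_mono) auto
    then show "x \<in> vspan Q ((\<lambda>w. rstr n (str w)) ` NW F)"
      using span_normal[OF D(1)] D(2) by blast
  next
    fix x :: "'f qel" assume "x \<in> (\<lambda>w. rstr n (str w)) ` NW F"
    then show "x \<in> vspan Q (rstr n ` lists F)"
      using str_lists by (auto intro!: vspan.incl)
  qed (use rstr_cl str_lists in auto)
  finally show ?thesis .
qed

end

section \<open>Factorization of normal words\<close>

lemma nword_iff: "nword w \<longleftrightarrow> (\<forall>(A, j)\<in>set w. finite A \<and> 1 \<le> j \<and> j \<le> card A) \<and>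
    successively (\<lambda>b a. \<not> (fst b \<subseteq> fst a \<and> card (fst b) = card (fst a) - snd a)) w"
proof (induction w rule: nword.induct)
  case (2 A j w)
  then show ?case by (cases w) (auto simp: conf_def)
qed simp

lemma nword_append1: "nword (u @ v) \<Longrightarrow> nword u" and nword_append2: "nword (u @ v) \<Longrightarrow> nword v"
  by (auto simp: nword_iff successively_append_iff)

text \<open>
  All entries of a chain \<open>(A : j)\<close> contain 1 if and only if \<open>A\<close> does, because 1 is the last element
  to be removed. Hence each letter is of one of two types.
\<close>

abbreviation has1 :: "nat set \<times> nat \<Rightarrow> bool" where
  "has1 a \<equiv> 1 \<in> fst a"

text \<open>In the string, \<open>hd v\<close> stands just before \<open>last u\<close>. The later
  set contains 1 and the earlier one does not, so there is no inclusion and no conflict at the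
  junction.\<close>

lemma nword_appendI:
  assumes "nword u" "nword v" "u \<noteq> [] \<Longrightarrow> has1 (last u)" "v \<noteq> [] \<Longrightarrow> \<not> has1 (hd v)"
  shows "nword (u @ v)"
  using assms by (auto simp: nword_iff successively_append_iff)

lemma str_append: "str (u @ v) = str v @ str u"
  by (induction u) auto

lemma str_conv_concat: "str w = concat (map (\<lambda>(A, j). chain A j) (rev w))"
  by (induction w) (auto simp: case_prod_beta)

section \<open>The families of all sets, of the sets without 1 and of the sets with 1\<close>

definition Fall :: "nat \<Rightarrow> nat set set" where
  "Fall n = {A. A \<noteq> {} \<and> A \<subseteq> {1..n}}"

definition Fhat :: "nat \<Rightarrow> nat set set" where
  "Fhat n = {A. A \<noteq> {} \<and> A \<subseteq> {2..n}}"

definition Fone :: "nat \<Rightarrow> nat set set" where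
  "Fone n = {A. 1 \<in> A \<and> A \<subseteq> {1..n}}"

lemma Diff_ne: "card A \<ge> 2 \<Longrightarrow> A - {x} \<noteq> {}"
  using card_mono[of "{x}" A] by auto

lemma family_Fall: "family n (Fall n) (Qn n :: ('f::field, 'f qel) module)"
proof
  fix A assume "A \<in> Fall n" "2 \<le> card A"
  then show "A - {Max A} \<in> Fall n" using Diff_ne[of A "Max A"] by (auto simp: Fall_def)
qed (auto simp: Fall_def)

lemma family_Fhat: "family n (Fhat n) (Qn n :: ('f::field, 'f qel) module)"
proof
  fix A assume "A \<in> Fhat n" "2 \<le> card A"
  then show "A - {Max A} \<in> Fhat n" using Diff_ne[of A "Max A"] by (auto simp: Fhat_def)
qed (auto simp: Fhat_def)

lemma family_Fone: "family n (Fone n) (Qn n :: ('f::field, 'f qel) module)"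
proof
  fix A assume A: "A \<in> Fone n" "2 \<le> card A"
  \<comment> \<open>A second element, larger than 1, keeps the maximum of A from being 1.\<close>
  then obtain x where x: "x \<in> A" "x \<noteq> 1" using Diff_ne[of A 1] by blast
  have "finite A" using A(1) finite_subset by (auto simp: Fone_def)
  then have "x \<le> Max A" using x by simp
  moreover have "1 \<le> x" using x A(1) by (auto simp: Fone_def)
  ultimately show "A - {Max A} \<in> Fone n" using x A(1) by (auto simp: Fone_def)
qed (auto simp: Fone_def)

lemma NW_Fall: "NW (Pow {1..n}) = NW (Fall n)"
  by (fastforce simp: NW_def Fall_def nword_iff)

lemma NW_Fhat: "w \<in> NW (Fhat n) \<longleftrightarrow> w \<in> NW (Fall n) \<and> (\<forall>a\<in>set w. \<not> has1 a)"
proof -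
  have "A \<in> Fhat n \<longleftrightarrow> A \<in> Fall n \<and> 1 \<notin> A" for A
  proof -
    have "A \<subseteq> {2..n} \<longleftrightarrow> A \<subseteq> {1..n} \<and> 1 \<notin> A"
      by (auto simp: subset_iff Suc_le_eq numeral_2_eq_2) (metis One_nat_def Suc_lessI)
    then show ?thesis by (auto simp: Fhat_def Fall_def)
  qed
  then show ?thesis by (auto simp: NW_def)
qed

lemma NW_Fone: "w \<in> NW (Fone n) \<longleftrightarrow> w \<in> NW (Fall n) \<and> (\<forall>a\<in>set w. has1 a)"
proof -
  have "A \<in> Fone n \<longleftrightarrow> A \<in> Fall n \<and> 1 \<in> A" for A
    by (auto simp: Fone_def Fall_def)
  then show ?thesis by (auto simp: NW_def)
qed

lemma NW_append: "u @ v \<in> NW F \<Longrightarrow> u \<in> NW F \<and> v \<in> NW F"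
  using nword_append1[of u v] nword_append2[of u v] by (auto simp: NW_def)

lemma hd_chain: "1 \<le> j \<Longrightarrow> A \<in> set (chain A j)"
  by (auto simp: chain_def intro!: image_eqI[where x = 0])

lemma chain_has1:
  assumes "w \<in> NW (Fall n)" "a \<in> set w" "A \<in> set (chain (fst a) (snd a))"
  shows "A \<subseteq> {1..n}" "1 \<in> A \<longleftrightarrow> has1 a"
proof -
  have a: "fst a \<in> Fall n" "snd a \<le> card (fst a)" "A \<subseteq> fst a"
    using assms set_chain_subset[of "fst a" "snd a"] by (auto simp: NW_def nword_iff)
  then show "A \<subseteq> {1..n}" by (auto simp: Fall_def)
  show "1 \<in> A \<longleftrightarrow> has1 a"
  proof
    assume "has1 a"
    then have "fst a \<in> Fone n" using a by (auto simp: Fall_def Fone_def)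
    from family.F_chain[OF family_Fone this a(2)] assms(3) show "1 \<in> A" by (auto simp: Fone_def)
  qed (use a in auto)
qed

lemma set_str_conv: "set (str w) = (\<Union>a\<in>set w. set (chain (fst a) (snd a)))"
  by (induction w) auto

lemma str_has1:
  assumes "w \<in> NW (Fall n)"
  shows "(\<forall>A\<in>set (str w). 1 \<in> A) \<longleftrightarrow> (\<forall>a\<in>set w. has1 a)"
    and "(\<forall>A\<in>set (str w). 1 \<notin> A) \<longleftrightarrow> (\<forall>a\<in>set w. \<not> has1 a)"
proof -
  have "fst a \<in> set (str w)" if "a \<in> set w" for a
  proof -
    have "1 \<le> snd a" using assms that by (auto simp: NW_def nword_iff)
    then show ?thesis using hd_chain that by (auto simp: set_str_conv)
  qed
  moreover have "\<exists>a\<in>set w. 1 \<in> A \<longleftrightarrow> has1 a" if "A \<in> set (str w)" for A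
    using chain_has1(2)[OF assms] that unfolding set_str_conv by blast
  moreover have "\<exists>a\<in>set w. A \<in> set (chain (fst a) (snd a))" if "A \<in> set (str w)" for A
    using that unfolding set_str_conv by blast
  ultimately show "(\<forall>A\<in>set (str w). 1 \<in> A) \<longleftrightarrow> (\<forall>a\<in>set w. has1 a)"
    "(\<forall>A\<in>set (str w). 1 \<notin> A) \<longleftrightarrow> (\<forall>a\<in>set w. \<not> has1 a)"
    using chain_has1(2)[OF assms] by blast+
qed

section \<open>The sets of strings as images of normal words\<close>

lemma Y_conv: "Y n = str ` NW (Fall n)"
proof -
  have "(\<forall>(A, j)\<in>set ps. A \<in> nonempty_subsets n \<and> 1 \<le> j \<and> j \<le> card A) \<and>
    (\<forall>i. Suc i < length ps \<longrightarrow> fst (ps ! Suc i) \<subseteq> fst (ps ! i) \<longrightarrow>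
       card (fst (ps ! Suc i)) \<noteq> card (fst (ps ! i)) - snd (ps ! i)) \<longleftrightarrow> rev ps \<in> NW (Fall n)" for ps
  proof -
    have fin: "finite A" if "A \<in> nonempty_subsets n" for A
      using that finite_subset by (auto simp: nonempty_subsets_def)
    have F: "Fall n = nonempty_subsets n" by (simp add: Fall_def nonempty_subsets_def)
    have "(\<forall>(A, j)\<in>set ps. A \<in> nonempty_subsets n \<and> 1 \<le> j \<and> j \<le> card A) \<longleftrightarrow>
        (\<forall>(A, j)\<in>set ps. finite A \<and> 1 \<le> j \<and> j \<le> card A) \<and> fst ` set ps \<subseteq> Fall n"
      unfolding F using fin by fastforce
    moreover have "(\<forall>i. Suc i < length ps \<longrightarrow> fst (ps ! Suc i) \<subseteq> fst (ps ! i) \<longrightarrow>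
       card (fst (ps ! Suc i)) \<noteq> card (fst (ps ! i)) - snd (ps ! i)) \<longleftrightarrow>
      successively (\<lambda>b a. \<not> (fst b \<subseteq> fst a \<and> card (fst b) = card (fst a) - snd a)) (rev ps)"
      by (subst successively_rev, subst successively_conv_nth) blast
    ultimately show ?thesis
      unfolding NW_def nword_iff mem_Collect_eq set_rev by blast
  qed
  note eq = this
  have "Y n = {concat (map (\<lambda>(A, j). chain A j) ps) |ps. rev ps \<in> NW (Fall n)}"
    unfolding Y_def eq ..
  also have "\<dots> = str ` NW (Fall n)"
  proof (intro equalityI subsetI)
    fix x assume "x \<in> {concat (map (\<lambda>(A, j). chain A j) ps) |ps. rev ps \<in> NW (Fall n)}"
    then obtain ps where "rev ps \<in> NW (Fall n)" "x = str (rev ps)"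
      by (auto simp: str_conv_concat)
    then show "x \<in> str ` NW (Fall n)" by blast
  next
    fix x assume "x \<in> str ` NW (Fall n)"
    then obtain w where "w \<in> NW (Fall n)" "x = str w" by blast
    then show "x \<in> {concat (map (\<lambda>(A, j). chain A j) ps) |ps. rev ps \<in> NW (Fall n)}"
      by (intro CollectI exI[of _ "rev w"]) (simp add: str_conv_concat)
  qed
  finally show ?thesis .
qed

lemma Y_1_conv: "Y_1 n = str ` NW (Fone n)"
proof -
  have "{w \<in> NW (Fall n). \<forall>A\<in>set (str w). 1 \<in> A} = NW (Fone n)"
  proof (rule Set.set_eqI)
    fix w show "w \<in> {w \<in> NW (Fall n). \<forall>A\<in>set (str w). 1 \<in> A} \<longleftrightarrow> w \<in> NW (Fone n)"
      using str_has1(1)[of w n] NW_Fone[of w n] by blast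
  qed
  then show ?thesis unfolding Y_1_def Y_conv by blast
qed

lemma Y_hat1_conv: "Y_hat1 n = str ` NW (Fhat n)"
proof -
  have s: "A \<subseteq> {2..n} \<longleftrightarrow> A \<subseteq> {1..n} \<and> 1 \<notin> A" for A :: "nat set"
    by (auto simp: subset_iff Suc_le_eq numeral_2_eq_2) (metis One_nat_def Suc_lessI)
  have "(\<forall>A\<in>set (str w). A \<subseteq> {2..n}) \<longleftrightarrow> (\<forall>a\<in>set w. \<not> has1 a)" if "w \<in> NW (Fall n)" for w
    unfolding s str_has1(2)[OF that, symmetric]
    using chain_has1(1)[OF that] unfolding set_str_conv by blast
  note eq = this
  have "{w \<in> NW (Fall n). \<forall>A\<in>set (str w). A \<subseteq> {2..n}} = NW (Fhat n)"
  proof (rule Set.set_eqI)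
    fix w show "w \<in> {w \<in> NW (Fall n). \<forall>A\<in>set (str w). A \<subseteq> {2..n}} \<longleftrightarrow> w \<in> NW (Fhat n)"
      using eq[of w] NW_Fhat[of w n] by blast
  qed
  then show ?thesis unfolding Y_hat1_def Y_conv by blast
qed

lemma str_eq_Nil: "w \<in> NW F \<Longrightarrow> str w = [] \<longleftrightarrow> w = []"
proof (cases w)
  case (Cons a w')
  assume "w \<in> NW F"
  then have "length (chain (fst a) (snd a)) \<noteq> 0" by (cases a) (simp add: Cons NW_def)
  then have "chain (fst a) (snd a) \<noteq> []" by (simp only: length_0_conv not_False_eq_True)
  then show ?thesis by (simp add: Cons)
qed simp

text \<open>The cut between C and D cannot fall inside a chain, since all entries of a chain agree
  about containing 1; hence it is a cut of the word.\<close>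

lemma split_str:
  "w \<in> NW (Fall n) \<Longrightarrow> str w = C @ D \<Longrightarrow> \<forall>A\<in>set C. 1 \<in> A \<Longrightarrow> \<forall>A\<in>set D. 1 \<notin> A \<Longrightarrow>
    \<exists>c d. w = d @ c \<and> str c = C \<and> str d = D"
proof (induction w arbitrary: D)
  case (Cons a w)
  have w: "w \<in> NW (Fall n)" using NW_append[of "[a]" w] Cons.prems(1) by simp
  have ch: "1 \<in> A \<longleftrightarrow> has1 a" if "A \<in> set (chain (fst a) (snd a))" for A
    using chain_has1(2)[OF Cons.prems(1) _ that] by simp
  have ne: "chain (fst a) (snd a) \<noteq> []"
    using str_eq_Nil[of "[a]" "Fall n"] NW_append[of "[a]" w] Cons.prems(1) by simp
  show ?case
  proof (cases "has1 a")
    case True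
    have "D = []"
    proof (rule ccontr)
      assume "D \<noteq> []"
      then have "last (str (a # w)) \<in> set D" by (simp only: Cons.prems(2) last_append) simp
      moreover have "last (str (a # w)) \<in> set (chain (fst a) (snd a))" using ne by simp
      ultimately show False using ch True Cons.prems(4) by blast
    qed
    then show ?thesis using Cons.prems(2) by (intro exI[of _ "a # w"] exI[of _ "[]"]) simp
  next
    case False
    have "\<exists>D'. str w = C @ D' \<and> D = D' @ chain (fst a) (snd a)"
    proof -
      from Cons.prems(2) consider us where "str w = C @ us" "us @ chain (fst a) (snd a) = D"
        | us where "str w @ us = C" "chain (fst a) (snd a) = us @ D"
        by (auto simp: append_eq_append_conv2)
      then show ?thesis
      proof cases
        case 2
        have "us = []"
        proof (rule ccontr)
          assume "us \<noteq> []"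
          then have "hd us \<in> set us" by simp
          then have "1 \<in> hd us" "hd us \<in> set (chain (fst a) (snd a))" using 2 Cons.prems(3) by auto
          then show False using ch False by blast
        qed
        then show ?thesis using 2 by auto
      qed blast
    qed
    then obtain D' where D': "str w = C @ D'" "D = D' @ chain (fst a) (snd a)" by blast
    then obtain c d where "w = d @ c" "str c = C" "str d = D'"
      using Cons.IH[OF w, of D'] Cons.prems(3,4) by auto
    then show ?thesis using D' by (intro exI[of _ c] exI[of _ "a # d"]) simp
  qed
qed simp

text \<open>The part \<open>c\<close> comes first in the string and \<open>d\<close> second. At this
  junction normality is a genuine condition: a set without 1 may be contained in a set with 1, so a
  conflict has to be excluded.\<close>

definition NM :: "nat \<Rightarrow> word set" where
  "NM n = {d @ c |c d. d @ c \<in> NW (Fall n) \<and> c \<noteq> [] \<and> d \<noteq> [] \<and>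
    (\<forall>a\<in>set c. has1 a) \<and> (\<forall>a\<in>set d. \<not> has1 a)}"

lemma NM_conv: "{C @ D |C D. C \<in> Y_1 n - {[]} \<and> D \<in> Y_hat1 n - {[]}} \<inter> Y n = str ` NM n"
proof (intro equalityI subsetI)
  fix x assume "x \<in> {C @ D |C D. C \<in> Y_1 n - {[]} \<and> D \<in> Y_hat1 n - {[]}} \<inter> Y n"
  then obtain C D w where x: "x = C @ D" "C \<in> Y_1 n" "C \<noteq> []" "D \<in> Y_hat1 n" "D \<noteq> []"
    "w \<in> NW (Fall n)" "x = str w" by (auto simp: Y_conv)
  have "(1::nat) \<notin> {2..n}" by simp
  then have "\<forall>A\<in>set C. 1 \<in> A" "\<forall>A\<in>set D. 1 \<notin> A"
    using x(2,4) unfolding Y_1_def Y_hat1_def by blast+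
  then obtain c d where cd: "w = d @ c" "str c = C" "str d = D"
    using split_str[OF x(6), of C D] x by auto
  then have "c \<in> NW (Fall n)" "d \<in> NW (Fall n)"
    using NW_append[of d c "Fall n"] x(6) cd(1) by simp_all
  then have "(\<forall>a\<in>set c. has1 a) \<and> (\<forall>a\<in>set d. \<not> has1 a)"
    using str_has1(1)[of c n] str_has1(2)[of d n] cd \<open>\<forall>A\<in>set C. 1 \<in> A\<close> \<open>\<forall>A\<in>set D. 1 \<notin> A\<close> by simp
  moreover have "c \<noteq> []" "d \<noteq> []" using cd x(3,5) by auto
  ultimately have "w \<in> NM n" unfolding NM_def using cd(1) x(6) by blast
  then show "x \<in> str ` NM n" using x by blast
next
  fix x assume "x \<in> str ` NM n"
  then obtain c d where x: "x = str (d @ c)" "d @ c \<in> NW (Fall n)" "c \<noteq> []" "d \<noteq> []"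
    "\<forall>a\<in>set c. has1 a" "\<forall>a\<in>set d. \<not> has1 a" by (auto simp: NM_def)
  then have cd: "c \<in> NW (Fone n)" "d \<in> NW (Fhat n)" 
    using NW_append[OF x(2)] x(5,6) by (simp_all add: NW_Fone NW_Fhat)
  then have "str c \<noteq> []" "str d \<noteq> []" 
    using x(3,4) by (simp_all add: str_eq_Nil[OF cd(1)] str_eq_Nil[OF cd(2)])
  then have "str c \<in> Y_1 n - {[]}" "str d \<in> Y_hat1 n - {[]}" using cd by (auto simp: Y_1_conv Y_hat1_conv)
  moreover have "x \<in> Y n" unfolding Y_conv using x(1,2) by blast
  moreover have "x = str c @ str d" using x(1) by (simp add: str_append)
  ultimately show "x \<in> {C @ D |C D. C \<in> Y_1 n - {[]} \<and> D \<in> Y_hat1 n - {[]}} \<inter> Y n" by blast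
qed

section \<open>Unique factorization of normal words\<close>

lemma NM_NW: "NM n \<subseteq> NW (Fall n)"
  by (auto simp: NM_def)

text \<open>
  The triple \<open>(h, [u\<^sub>1, \<dots>, u\<^sub>k], e)\<close> stands for the concatenation \<open>h u\<^sub>1 \<dots> u\<^sub>k e\<close> of the strings;
  the order is reversed as words are stored in reverse.
\<close>

definition glue :: "word \<times> word list \<times> word \<Rightarrow> word" where
  "glue = (\<lambda>(h, us, e). e @ concat (rev us) @ h)"

definition parts :: "nat \<Rightarrow> (word \<times> word list \<times> word) set" where
  "parts n = NW (Fhat n) \<times> lists (NM n) \<times> NW (Fone n)"

text \<open>As strings, each block from \<open>NM n\<close> and each nonempty h end in a letter
  without 1, whereas the factor that follows starts with a letter containing 1. This makes the
  junctions free of conflicts and lets the factorization be read off from the word.\<close>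

lemma hd_glue:
  assumes "h \<in> NW (Fhat n)" "us \<in> lists (NM n)" "concat (rev us) @ h \<noteq> []"
  shows "\<not> has1 (hd (concat (rev us) @ h))"
  using assms
proof (cases us rule: rev_cases)
  case (snoc us' u)
  then have "u \<in> NM n" using assms by auto
  then show ?thesis by (auto simp: snoc NM_def)
qed (auto simp: NW_Fhat)

lemma glue_NW: "p \<in> parts n \<Longrightarrow> glue p \<in> NW (Fall n)"
proof -
  have app: "u @ v \<in> NW (Fall n)" if "u \<in> NW (Fall n)" "v \<in> NW (Fall n)"
    "u \<noteq> [] \<Longrightarrow> has1 (last u)" "v \<noteq> [] \<Longrightarrow> \<not> has1 (hd v)" for u v
    using that nword_appendI[of u v] by (auto simp: NW_def)
  have mid: "concat (rev us) @ h \<in> NW (Fall n)" if "us \<in> lists (NM n)" "h \<in> NW (Fhat n)" for us h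
    using that(1)
  proof (induction us rule: rev_induct)
    case Nil
    then show ?case using that(2) by (simp add: NW_Fhat)
  next
    case (snoc u us)
    then have u: "u \<in> NM n" "us \<in> lists (NM n)" by auto
    have "u @ (concat (rev us) @ h) \<in> NW (Fall n)"
    proof (rule app)
      show "u \<in> NW (Fall n)" using u NM_NW by blast
      show "has1 (last u)" using u by (auto simp: NM_def)
    qed (use snoc u hd_glue[OF that(2) u(2)] in auto)
    then show ?case by simp
  qed
  assume "p \<in> parts n"
  then obtain h us e where p: "p = (h, us, e)" "h \<in> NW (Fhat n)" "us \<in> lists (NM n)" "e \<in> NW (Fone n)"
    by (auto simp: parts_def)
  have "e @ (concat (rev us) @ h) \<in> NW (Fall n)"
    using p by (intro app mid hd_glue) (auto simp: NW_Fone)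
  then show ?thesis by (simp add: p(1) glue_def)
qed

text \<open>The new last letter decides. With 1 it joins e. Without 1 it closes a nonempty e to a
  new block; if e is empty it joins the last block, or h when there is no block.\<close>

lemma glue_surj: "w \<in> NW (Fall n) \<Longrightarrow> \<exists>p\<in>parts n. glue p = w"
proof (induction w)
  case Nil
  have "([], [], []) \<in> parts n" by (simp add: parts_def NW_def)
  then show ?case by (intro bexI[of _ "([], [], [])"]) (simp add: glue_def)
next
  case (Cons a w)
  have "w \<in> NW (Fall n)" using NW_append[of "[a]" w] Cons.prems by simp
  then obtain h us e where p: "h \<in> NW (Fhat n)" "us \<in> lists (NM n)" "e \<in> NW (Fone n)"
    "w = e @ concat (rev us) @ h"
    using Cons.IH by (auto simp: parts_def glue_def)
  have pre: "u \<in> NW (Fall n)" if "a # w = u @ v" for u v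
    using NW_append[of u v "Fall n"] Cons.prems that by simp
  have res: "\<exists>p\<in>parts n. glue p = a # w"
    if "h' \<in> NW (Fhat n)" "us' \<in> lists (NM n)" "e' \<in> NW (Fone n)" "a # w = e' @ concat (rev us') @ h'"
    for h' us' e'
    using that by (intro bexI[of _ "(h', us', e')"]) (auto simp: parts_def glue_def)
  show ?case
  proof (cases "has1 a")
    case True
    have "a # e \<in> NW (Fall n)" using pre[of "a # e"] p by simp
    then show ?thesis using p True by (intro res[of h us "a # e"]) (auto simp: NW_Fone)
  next
    case False
    have nil: "[] \<in> NW (Fone n)" by (simp add: NW_def)
    show ?thesis
    proof (cases "e = []")
      case e: True
      show ?thesis
      proof (cases us rule: rev_cases)
        case Nil
        have "a # h \<in> NW (Fall n)" using pre[of "a # h"] p e Nil by simp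
        then show ?thesis using p False e Nil nil by (intro res[of "a # h" "[]" "[]"]) (auto simp: NW_Fhat)
      next
        case (snoc us' u)
        then obtain c d where u: "u = d @ c" "c \<noteq> []" "d \<noteq> []" "\<forall>a\<in>set c. has1 a" "\<forall>a\<in>set d. \<not> has1 a"
          using p(2) by (auto simp: NM_def)
        have "a # u \<in> NW (Fall n)" using pre[of "a # u"] p e snoc by simp
        then have "a # u \<in> NM n"
          unfolding NM_def using u False
          by (intro CollectI exI[of _ c] exI[of _ "a # d"]) auto
        then show ?thesis using p e snoc nil by (intro res[of h "us' @ [a # u]" "[]"]) auto
      qed
    next
      case e: False
      have "a # e \<in> NW (Fall n)" using pre[of "a # e"] p by simp
      then have "a # e \<in> NM n"
        unfolding NM_def using e False p(3)
        by (intro CollectI exI[of _ e] exI[of _ "[a]"]) (auto simp: NW_Fone)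
      then show ?thesis using p nil by (intro res[of h "us @ [a # e]" "[]"]) auto
    qed
  qed
qed

lemma takeWhile_split:
  assumes "\<forall>x\<in>set u. P x" "v \<noteq> [] \<Longrightarrow> \<not> P (hd v)"
  shows "takeWhile P (u @ v) = u"
  using assms by (cases v) (auto simp: takeWhile_append)

lemma append_unique:
  assumes "u @ v = u' @ v'" "\<forall>x\<in>set u. P x" "v \<noteq> [] \<Longrightarrow> \<not> P (hd v)"
    "\<forall>x\<in>set u'. P x" "v' \<noteq> [] \<Longrightarrow> \<not> P (hd v')"
  shows "u = u' \<and> v = v'"
  using takeWhile_split[OF assms(2,3)] takeWhile_split[OF assms(4,5)] assms(1) by auto

text \<open>Reading from the last letter, a block is a maximal run of letters without 1 followed by
  a maximal run of letters with 1, so the word determines it and it can be peeled off. As h has no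
  letter with 1, both sides run out of blocks together.\<close>

lemma concat_unique:
  assumes "us \<in> lists (NM n)" "us' \<in> lists (NM n)" "h \<in> NW (Fhat n)" "h' \<in> NW (Fhat n)"
    "concat (rev us) @ h = concat (rev us') @ h'"
  shows "us = us' \<and> h = h'"
  using assms
proof (induction us arbitrary: us' rule: rev_induct)
  have one: "\<exists>a\<in>set u. has1 a" if "u \<in> NM n" for u
    using that by (fastforce simp: NM_def neq_Nil_conv)
  {
    case Nil
    have "us' = []"
    proof (cases us' rule: rev_cases)
      case (snoc us0 u)
      then have "u \<in> NM n" using Nil.prems(2) by simp
      from one[OF this] obtain a where "a \<in> set u" "has1 a" ..
      then have "a \<in> set h" using Nil.prems(5) snoc by auto
      then show ?thesis using \<open>has1 a\<close> Nil.prems(3) by (auto simp: NW_Fhat)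
    qed
    then show ?case using Nil.prems by simp
  next
    case (snoc u us)
    have "us' \<noteq> []"
    proof
      assume "us' = []"
      then have "u @ (concat (rev us) @ h) = h'" using snoc.prems(5) by simp
      then have "set u \<subseteq> set h'" by auto
      then show False using one[of u] snoc.prems(1,4) by (auto simp: NW_Fhat)
    qed
    then obtain us0 u' where us': "us' = us0 @ [u']" by (metis rev_exhaust)
    obtain c d where u: "u = d @ c" "c \<noteq> []" "d \<noteq> []" "\<forall>a\<in>set c. has1 a" "\<forall>a\<in>set d. \<not> has1 a"
      using snoc.prems(1) by (auto simp: NM_def)
    obtain c' d' where u': "u' = d' @ c'" "c' \<noteq> []" "d' \<noteq> []" "\<forall>a\<in>set c'. has1 a" "\<forall>a\<in>set d'. \<not> has1 a"
      using snoc.prems(2) us' by (auto simp: NM_def)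
    let ?X = "concat (rev us) @ h" and ?X' = "concat (rev us0) @ h'"
    have l: "us \<in> lists (NM n)" "us0 \<in> lists (NM n)" using snoc.prems us' by auto
    have "d @ (c @ ?X) = d' @ (c' @ ?X')" using snoc.prems(5) us' u(1) u'(1) by simp
    then have 1: "d = d' \<and> c @ ?X = c' @ ?X'"
      by (rule append_unique[where P = "\<lambda>a. \<not> has1 a"]) (use u u' in \<open>auto simp: neq_Nil_conv\<close>)
    then have 2: "c = c' \<and> ?X = ?X'"
      using u u' hd_glue[OF snoc.prems(3) l(1)] hd_glue[OF snoc.prems(4) l(2)]
      by (intro append_unique[where P = has1]) auto
    then have "us = us0 \<and> h = h'" using snoc.IH[OF l snoc.prems(3,4)] by blast
    with 1 2 u u' us' show ?case by simp
  }
qed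

lemma inj_glue: "inj_on glue (parts n)"
proof (rule inj_onI)
  fix p p' assume a: "p \<in> parts n" "p' \<in> parts n" "glue p = glue p'"
  obtain h us e h' us' e' where p: "p = (h, us, e)" "p' = (h', us', e')"
    by (metis prod_cases3)
  have m: "h \<in> NW (Fhat n)" "us \<in> lists (NM n)" "e \<in> NW (Fone n)"
    "h' \<in> NW (Fhat n)" "us' \<in> lists (NM n)" "e' \<in> NW (Fone n)"
    using a p by (auto simp: parts_def)
  have "e @ (concat (rev us) @ h) = e' @ (concat (rev us') @ h')"
    using a(3) by (simp add: p glue_def)
  then have "e = e' \<and> concat (rev us) @ h = concat (rev us') @ h'"
    using m hd_glue[OF m(1,2)] hd_glue[OF m(4,5)]
    by (intro append_unique[where P = has1]) (auto simp: NW_Fone)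
  with concat_unique[OF m(2,5,1,4)] show "p = p'" by (simp add: p)
qed

section \<open>The decomposition of \<open>Q\<^sub>n\<close>\<close>

definition rw :: "nat \<Rightarrow> word \<Rightarrow> 'f::field qel" where
  "rw n w = rstr n (str w)"

lemma Qn_gen: "carrier (Qn n :: ('f::field, 'f qel) module) = subalg_gen (Qn n) (rr n ` Fall n)"
proof -
  interpret q: alghom_loc "Tn n :: ('f, ('f, nat set \<Rightarrow>\<^sub>0 'f) tensor) module" "Qn n :: ('f, 'f qel) module"
    "\<lambda>x. Qn_ideal n +>\<^bsub>Tn n\<^esub> x" by (rule alghom_Qn)
  interpret V: vecsp "Vn n :: ('f, nat set \<Rightarrow>\<^sub>0 'f) module" by (rule Vn_vecsp)
  interpret t: linmap_loc "Vn n :: ('f, nat set \<Rightarrow>\<^sub>0 'f) module" "Tn n" "tensor_incl (Vn n)"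
    by (intro linmap_loc.intro linmap_loc_axioms.intro Vn_vecsp q.A.vecsp_axioms V.linmap_tensor_incl)
  let ?\<pi> = "\<lambda>x. Qn_ideal n +>\<^bsub>Tn n\<^esub> x" and ?v = "(\<lambda>A. single A (1::'f)) ` nonempty_subsets n"
  have v: "?v \<subseteq> carrier (Vn n)" by (auto simp: Vn_def)
  have inc: "tensor_incl (Vn n) ` carrier (Vn n) \<subseteq> carrier (Tn n :: ('f, ('f, nat set \<Rightarrow>\<^sub>0 'f) tensor) module)"
    using t.h(1) by blast
  have tv: "tensor_incl (Vn n) ` ?v \<subseteq> carrier (Tn n)"
    using inc v by blast
  have "carrier (Qn n :: ('f, 'f qel) module) = ?\<pi> ` carrier (Tn n)"
    using q.A.quot_simps(1)[OF q.A.ideal_subspace[OF Qn_ideal] q.A.zero_closed]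
    by (simp add: Qn_def)
  also have "\<dots> = subalg_gen (Qn n) (?\<pi> ` tensor_incl (Vn n) ` carrier (Vn n))"
    unfolding V.tensor_alg_gen using inc by (rule q.h_subalg_gen)
  also have "carrier (Vn n :: ('f, nat set \<Rightarrow>\<^sub>0 'f) module) = vspan (Vn n) ?v"
    unfolding Vn_def by (rule free_vs_span)
  also have "tensor_incl (Vn n) ` vspan (Vn n) ?v = vspan (Tn n) (tensor_incl (Vn n) ` ?v)"
    by (rule t.h_vspan[OF v])
  also have "?\<pi> ` vspan (Tn n) (tensor_incl (Vn n) ` ?v) = vspan (Qn n) (?\<pi> ` tensor_incl (Vn n) ` ?v)"
    by (rule q.h_vspan[OF tv])
  also have "?\<pi> ` tensor_incl (Vn n) ` ?v = rr n ` Fall n"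
    by (auto simp: rr_def vv_def Fall_def nonempty_subsets_def image_image intro!: image_cong)
  also have "subalg_gen (Qn n) (vspan (Qn n) (rr n ` Fall n)) = subalg_gen (Qn n) (rr n ` Fall n :: 'f qel set)"
  proof -
    have "rr n ` Fall n \<subseteq> carrier (Qn n :: ('f, 'f qel) module)"
      by (auto simp: Fall_def intro!: rr_closed)
    then show ?thesis
      by (simp only: q.B.subalg_gen_vspan q.B.subalg_gen_image)
  qed
  finally show ?thesis .
qed

section \<open>Bases of the subalgebras and the two isomorphisms\<close>

context
  fixes n :: nat and Q :: "('f::field, 'f qel) module" (structure)
  assumes Q_def: "Q = Qn n"
begin

interpretation Q: falg Q
  unfolding Q_def by (rule falg_Qn)

interpretation all: family n "Fall n" Q
  unfolding Q_def by (rule family_Fall)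

interpretation hat: family n "Fhat n" Q
  unfolding Q_def by (rule family_Fhat)

interpretation one: family n "Fone n" Q
  unfolding Q_def by (rule family_Fone)

lemma rw_closed: "w \<in> NW (Fall n) \<Longrightarrow> rw n w \<in> carrier Q"
  unfolding rw_def by (intro all.rstr_cl all.str_lists)

lemma rw_image_closed: "S \<subseteq> NW (Fall n) \<Longrightarrow> rw n ` S \<subseteq> carrier Q"
  using rw_closed by auto

lemma rw_indep: "indep Q (NW (Fall n)) (rw n)"
  using indep_rstr[of n, where 'f = 'f] unfolding NW_Fall Q_def rw_def[abs_def] .

lemma carrier_Q: "carrier Q = vspan Q (rw n ` NW (Fall n))"
  using all.subalg_gen_normal Qn_gen[of n, where 'f = 'f] by (simp add: Q_def rw_def[abs_def])

lemma Qhat_conv: "Qn_hat1 n = vspan Q (rw n ` NW (Fhat n))"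
proof -
  have "{rr n A |A. A \<noteq> {} \<and> A \<subseteq> {2..n}} = (rr n ` Fhat n :: 'f qel set)"
    by (auto simp: Fhat_def)
  then show ?thesis
    using hat.subalg_gen_normal by (simp add: Qn_hat1_def Q_def rw_def[abs_def])
qed

lemma Q1_conv: "Qn_1 n = vspan Q (rw n ` NW (Fone n))"
proof -
  have "{rr n A |A. 1 \<in> A \<and> A \<subseteq> {1..n}} = (rr n ` Fone n :: 'f qel set)"
    by (auto simp: Fone_def)
  then show ?thesis
    using one.subalg_gen_normal by (simp add: Qn_1_def Q_def rw_def[abs_def])
qed

lemma M_conv: "Mn n = vspan Q (rw n ` NM n)"
proof -
  have "{rstr n B |B. B \<in> {C @ D |C D. C \<in> Y_1 n - {[]} \<and> D \<in> Y_hat1 n - {[]}} \<inter> Y n} =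
      (rstr n ` str ` NM n :: 'f qel set)"
    unfolding NM_conv by blast
  then show ?thesis by (simp only: Mn_def Q_def rw_def[abs_def] image_image)
qed

lemma rw_append: "u @ v \<in> NW (Fall n) \<Longrightarrow> rw n (u @ v) = rw n v \<otimes> rw n u"
  unfolding rw_def str_append using NW_append by (intro all.rstr_app all.str_lists) blast+

text \<open>Words are stored in reverse but lists of factors are not: \<open>cat us\<close> is the
  word of the product of the \<open>us\<close> in the given order.\<close>

abbreviation (input) "cat us \<equiv> concat (rev us)"

lemma cat_NW: "us \<in> lists (NM n) \<Longrightarrow> cat us \<in> NW (Fall n)"
proof -
  assume "us \<in> lists (NM n)"
  then have "([], us, []) \<in> parts n" by (simp add: parts_def NW_def)
  from glue_NW[OF this] show ?thesis by (simp add: glue_def)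
qed

lemma mprod_rw: "us \<in> lists (NM n) \<Longrightarrow> mprod Q (map (rw n) us) = rw n (cat us)"
proof (induction us)
  case Nil
  then show ?case by (simp add: rw_def rstr_def Q_def)
next
  case (Cons u us)
  then show ?case using rw_append[of "cat us" u] cat_NW[of "u # us"] by simp
qed

lemma N_conv: "Nn n = vspan Q ((\<lambda>us. rw n (cat us)) ` lists (NM n))"
proof -
  have "(\<lambda>u. mprod Q (map (rw n) u)) ` lists (NM n) = (\<lambda>us. rw n (cat us)) ` lists (NM n)"
    by (intro image_cong refl mprod_rw)
  then show ?thesis
    using Q.subalg_gen_vspan[OF rw_image_closed[OF NM_NW]] M_conv by (simp add: Nn_def Q_def)
qed

lemma vecsp_sub_vspan: "S \<subseteq> carrier Q \<Longrightarrow> vecsp (sub Q (vspan Q S))"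
  by (intro Q.vecsp_sub Q.subspace_vspan)

lemma incl_linmap: "S \<subseteq> carrier Q \<Longrightarrow> linmap (sub Q S) Q (\<lambda>x. x)"
  by (auto simp: linmap_def sub_def)

lemma sub_simps: "carrier (sub Q S) = S" "add (sub Q S) = add Q" "smult (sub Q S) = smult Q"
  "mult (sub Q S) = mult Q" "one (sub Q S) = one Q"
  by (simp_all add: sub_def)

text \<open>\<open>\<phi>\<close> extends the inclusion of M. Products of the basis elements of M
  span the tensor algebra and are sent to the words \<open>cat us\<close>; by unique factorization
  these are different normal words for different lists, hence independent.\<close>

lemma tensor_M_iso:
  "\<exists>\<phi>. algebra_iso (tensor_alg (sub Q (Mn n))) (sub Q (Nn n)) \<phi> \<and>
    (\<forall>m\<in>carrier (sub Q (Mn n)). \<phi> (tensor_incl (sub Q (Mn n)) m) = m)"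
proof -
  let ?M = "sub Q (Mn n)"
  have Mc: "rw n ` NM n \<subseteq> carrier Q" by (rule rw_image_closed[OF NM_NW])
  interpret M: vecsp ?M unfolding M_conv by (rule vecsp_sub_vspan[OF Mc])
  have MQ: "Mn n \<subseteq> carrier Q" unfolding M_conv by (rule Q.vspan_closed[OF Mc])
  obtain \<phi> where \<phi>: "alghom (tensor_alg ?M) Q \<phi>" "\<And>x. x \<in> carrier ?M \<Longrightarrow> \<phi> (tensor_incl ?M x) = x"
    using M.tensor_alg_hom[OF Q.falg_axioms incl_linmap[OF MQ]] by blast
  interpret \<phi>: alghom_loc "tensor_alg ?M" Q \<phi>
    by (intro alghom_loc.intro alghom_loc_axioms.intro M.falg_tensor_alg Q.falg_axioms \<phi>(1))
  interpret i: linmap_loc ?M "tensor_alg ?M" "tensor_incl ?M"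
    by (intro linmap_loc.intro linmap_loc_axioms.intro M.vecsp_axioms \<phi>.A.vecsp_axioms M.linmap_tensor_incl)
  define g where "g w = tensor_incl ?M (rw n w)" for w
  define G where "G us = mprod (tensor_alg ?M) (map g us)" for us
  have rM: "rw n w \<in> carrier ?M" if "w \<in> NM n" for w
    using that by (simp add: sub_simps M_conv vspan.incl)
  have gc: "g ` NM n \<subseteq> carrier (tensor_alg ?M)"
    using rM i.h(1) by (auto simp: g_def)
  have Gc: "G ` lists (NM n) \<subseteq> carrier (tensor_alg ?M)"
    unfolding G_def using gc by (intro image_subsetI \<phi>.A.mprod_closed) auto
  have "carrier ?M = vspan ?M (rw n ` NM n)"
    by (simp add: sub_simps vspan_sub M_conv)
  then have "tensor_incl ?M ` carrier ?M = vspan (tensor_alg ?M) (g ` NM n)"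
    using i.h_vspan[of "rw n ` NM n"] rM by (simp add: image_subset_iff g_def[abs_def] image_image)
  then have span: "carrier (tensor_alg ?M) = vspan (tensor_alg ?M) (G ` lists (NM n))"
    using M.tensor_alg_gen \<phi>.A.subalg_gen_vspan[OF gc] by (simp add: G_def[abs_def])
  have \<phi>G: "\<phi> (G us) = rw n (cat us)" if us: "us \<in> lists (NM n)" for us
  proof -
    have "\<phi> (G us) = mprod Q (map \<phi> (map g us))"
      unfolding G_def using gc us by (intro \<phi>.h_mprod) auto
    also have "map \<phi> (map g us) = map (rw n) us"
      using us rM \<phi>(2) by (auto simp: g_def)
    finally show ?thesis by (simp add: mprod_rw us)
  qed
  have inj: "inj_on (\<lambda>us. cat us) (lists (NM n))"
  proof (rule inj_onI)
    fix us us' assume "us \<in> lists (NM n)" "us' \<in> lists (NM n)" "cat us = cat us'"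
    then show "us = us'" using concat_unique[of us n us' "[]" "[]"] by (simp add: NW_def)
  qed
  have "indep Q (lists (NM n)) (\<lambda>us. rw n (cat us))"
    using cat_NW inj by (intro Q.indep_reindex[OF rw_indep] rw_image_closed) auto
  moreover have "lincomb Q (\<lambda>us. \<phi> (G us)) p = lincomb Q (\<lambda>us. rw n (cat us)) p" if "keys p \<subseteq> lists (NM n)" for p
  proof (rule Q.lincomb_cong)
    show "(\<lambda>us. rw n (cat us)) ` keys p \<subseteq> carrier Q"
      using that by (intro image_subsetI rw_closed cat_NW) blast
    show "\<phi> (G us) = rw n (cat us)" if "us \<in> keys p" for us
      using that \<open>keys p \<subseteq> lists (NM n)\<close> by (intro \<phi>G) blast
  qed
  ultimately have "indep Q (lists (NM n)) (\<lambda>us. \<phi> (G us))"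
    by (simp add: indep_def)
  from \<phi>.inj_on_if_indep[OF span Gc this] have "inj_on \<phi> (carrier (tensor_alg ?M))" .
  moreover have "\<phi> ` carrier (tensor_alg ?M) = Nn n"
  proof -
    have "\<phi> ` G ` lists (NM n) = (\<lambda>us. rw n (cat us)) ` lists (NM n)"
      unfolding image_image by (intro image_cong refl \<phi>G)
    then show ?thesis
      unfolding span \<phi>.h_vspan[OF Gc] by (simp add: N_conv)
  qed
  ultimately have "bij_betw \<phi> (carrier (tensor_alg ?M)) (carrier (sub Q (Nn n)))"
    by (simp add: bij_betw_def sub_simps)
  moreover from this have "\<phi> \<in> ring_hom (tensor_alg ?M) (sub Q (Nn n))"
    by (intro ring_hom_memI) (auto simp: sub_simps \<phi>.h \<phi>.h_mult \<phi>.h_one bij_betw_def)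
  ultimately have "algebra_iso (tensor_alg ?M) (sub Q (Nn n)) \<phi>"
    by (auto simp: algebra_iso_def ring_iso_def sub_simps \<phi>.h)
  with \<phi>(2) show ?thesis by blast
qed

lemma Qn_deg_conv: "Qn_deg n d = vspan Q (rw n ` {w \<in> NW (Fall n). length (str w) = d})"
proof -
  have "{rstr n B |B. B \<in> lists (nonempty_subsets n) \<and> length B = d} =
      (rstr n ` {D \<in> lists (Fall n). length D = d} :: 'f qel set)"
    by (auto simp: Fall_def nonempty_subsets_def)
  then show ?thesis
    using all.span_normal_deg[of d] by (simp add: Qn_deg_def Q_def rw_def[abs_def])
qed

lemma Qn_deg_subspace: "subspace Q (Qn_deg n d)"
  unfolding Qn_deg_conv by (intro Q.subspace_vspan rw_image_closed) auto

lemma Qn_deg_mult: "x \<in> Qn_deg n i \<Longrightarrow> y \<in> Qn_deg n j \<Longrightarrow> x \<otimes> y \<in> Qn_deg n (i + j)"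
proof -
  have c: "{rstr n B |B. B \<in> lists (nonempty_subsets n) \<and> length B = d} \<subseteq> carrier Q" for d
    using all.rstr_cl by (auto simp: Fall_def nonempty_subsets_def)
  assume "x \<in> Qn_deg n i" "y \<in> Qn_deg n j"
  then show ?thesis
    unfolding Qn_deg_def Q_def[symmetric]
  proof (rule Q.vspan_mult[OF c c, rotated])
    fix s t :: "'f qel"
    assume "s \<in> {rstr n B |B. B \<in> lists (nonempty_subsets n) \<and> length B = i}"
      "t \<in> {rstr n B |B. B \<in> lists (nonempty_subsets n) \<and> length B = j}"
    then obtain B C where "s = rstr n B" "t = rstr n C" "B \<in> lists (nonempty_subsets n)"
      "C \<in> lists (nonempty_subsets n)" "length B = i" "length C = j" by blast
    moreover from this have "rstr n (B @ C) = s \<otimes> t"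
      using all.rstr_app[of B C] by (simp add: Fall_def nonempty_subsets_def)
    ultimately show "s \<otimes> t \<in> vspan Q {rstr n B |B. B \<in> lists (nonempty_subsets n) \<and> length B = i + j}"
      by (intro vspan.incl CollectI exI[of _ "B @ C"]) auto
  qed
qed


text \<open>Multiplication is lifted through the two tensor products in turn. The pure tensors
  \<open>\<gamma> p\<close> of basis elements span, and their images are the basis words
  \<open>glue p\<close>, each normal word occurring exactly once.\<close>

lemma tensor_decomposition:
  fixes Qhat N Q1 gr
  defines "Qhat \<equiv> sub Q (Qn_hat1 n)" and "N \<equiv> sub Q (Nn n)" and "Q1 \<equiv> sub Q (Qn_1 n)"
    and "gr \<equiv> (\<lambda>A d. carrier A \<inter> Qn_deg n d)"
  shows "\<exists>\<psi>. graded_iso (tensor_prod (tensor_prod Qhat N) Q1)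
      (tensor_grading (tensor_prod Qhat N) (tensor_grading Qhat (gr Qhat) N (gr N)) Q1 (gr Q1))
      Q (Qn_deg n) \<psi> \<and>
    (\<forall>a\<in>carrier Qhat. \<forall>b\<in>carrier N. \<forall>c\<in>carrier Q1.
      \<psi> (pure_tensor (tensor_prod Qhat N) Q1 (pure_tensor Qhat N a b) c) = (a \<otimes> b) \<otimes> c)"
proof -
  have hs: "rw n ` NW (Fhat n) \<subseteq> carrier Q" by (intro rw_image_closed) (auto simp: NW_Fhat)
  have os: "rw n ` NW (Fone n) \<subseteq> carrier Q" by (intro rw_image_closed) (auto simp: NW_Fone)
  have ns: "(\<lambda>us. rw n (cat us)) ` lists (NM n) \<subseteq> carrier Q"
    by (intro image_subsetI rw_closed cat_NW)
  have ch: "carrier Qhat = vspan Q (rw n ` NW (Fhat n))" by (simp add: Qhat_def sub_simps Qhat_conv)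
  have cn: "carrier N = vspan Q ((\<lambda>us. rw n (cat us)) ` lists (NM n))" by (simp add: N_def sub_simps N_conv)
  have co: "carrier Q1 = vspan Q (rw n ` NW (Fone n))" by (simp add: Q1_def sub_simps Q1_conv)
  have hQ: "a \<in> carrier Q" if "a \<in> carrier Qhat" for a using Q.vspan_closed[OF hs] that ch by blast
  have nQ: "a \<in> carrier Q" if "a \<in> carrier N" for a using Q.vspan_closed[OF ns] that cn by blast
  have oQ: "a \<in> carrier Q" if "a \<in> carrier Q1" for a using Q.vspan_closed[OF os] that co by blast
  have add: "add Qhat = add Q" "add N = add Q" "add Q1 = add Q"
    "smult Qhat = smult Q" "smult N = smult Q" "smult Q1 = smult Q"
    by (simp_all add: Qhat_def N_def Q1_def sub_simps)
  interpret H: vecsp Qhat unfolding Qhat_def Qhat_conv by (rule vecsp_sub_vspan[OF hs])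
  interpret N: vecsp N unfolding N_def N_conv by (rule vecsp_sub_vspan[OF ns])
  interpret O: vecsp Q1 unfolding Q1_def Q1_conv by (rule vecsp_sub_vspan[OF os])
  interpret HN: two_vecsp Qhat N by unfold_locales
  let ?U = "tensor_prod Qhat N"
  interpret U: vecsp ?U by (rule HN.vecsp_tensor_prod)
  interpret UO: two_vecsp ?U Q1 by unfold_locales
  let ?T = "tensor_prod ?U Q1"
  interpret T: vecsp ?T by (rule UO.vecsp_tensor_prod)
  obtain m where m: "linmap ?U Q m"
    "\<And>a b. a \<in> carrier Qhat \<Longrightarrow> b \<in> carrier N \<Longrightarrow> m (pure_tensor Qhat N a b) = a \<otimes> b"
  proof (rule HN.tensor_prod_lift[OF Q.vecsp_axioms, where b = "\<lambda>a b. a \<otimes> b"])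
    show "linmap Qhat Q (\<lambda>u. u \<otimes> w)" if "w \<in> carrier N" for w
      using hQ nQ[OF that] by (simp add: linmap_def add Q.l_distr Q.smult_mult_left)
    show "linmap N Q (\<lambda>w. u \<otimes> w)" if "u \<in> carrier Qhat" for u
      using nQ hQ[OF that] by (simp add: linmap_def add Q.r_distr Q.smult_mult_right)
  qed (use that in blast)
  interpret m: linmap_loc ?U Q m by unfold_locales (rule m(1))
  obtain \<psi> where \<psi>: "linmap ?T Q \<psi>"
    "\<And>t c. t \<in> carrier ?U \<Longrightarrow> c \<in> carrier Q1 \<Longrightarrow> \<psi> (pure_tensor ?U Q1 t c) = m t \<otimes> c"
  proof (rule UO.tensor_prod_lift[OF Q.vecsp_axioms, where b = "\<lambda>t c. m t \<otimes> c"])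
    show "linmap ?U Q (\<lambda>t. m t \<otimes> c)" if "c \<in> carrier Q1" for c
      using oQ[OF that] by (simp add: linmap_def m.h Q.l_distr Q.smult_mult_left)
    show "linmap Q1 Q (\<lambda>c. m t \<otimes> c)" if "t \<in> carrier ?U" for t
      using oQ m.h(1)[OF that] by (simp add: linmap_def add Q.r_distr Q.smult_mult_right)
  qed (use that in blast)
  interpret \<psi>: linmap_loc ?T Q \<psi> by unfold_locales (rule \<psi>(1))
  define \<gamma> where "\<gamma> = (\<lambda>(h, us, e). pure_tensor ?U Q1 (pure_tensor Qhat N (rw n h) (rw n (cat us))) (rw n e))"
  have gh: "rw n h \<in> carrier Qhat" if "h \<in> NW (Fhat n)" for h
    using that by (auto simp: ch intro!: vspan.incl)
  have gn: "rw n (cat us) \<in> carrier N" if "us \<in> lists (NM n)" for us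
    unfolding cn using that by (intro vspan.incl imageI)
  have ge: "rw n e \<in> carrier Q1" if "e \<in> NW (Fone n)" for e
    using that by (auto simp: co intro!: vspan.incl)
  have \<gamma>c: "\<gamma> ` parts n \<subseteq> carrier ?T"
  proof (rule image_subsetI)
    fix p assume "p \<in> parts n"
    then obtain h us e where d: "p = (h, us, e)" "h \<in> NW (Fhat n)" "us \<in> lists (NM n)" "e \<in> NW (Fone n)"
      by (auto simp: parts_def)
    show "\<gamma> p \<in> carrier ?T"
      using gh[OF d(2)] gn[OF d(3)] ge[OF d(4)] by (simp add: d(1) \<gamma>_def HN.pure_tensor(1) UO.pure_tensor(1))
  qed
  have \<psi>\<gamma>: "\<psi> (\<gamma> p) = rw n (glue p)" if p: "p \<in> parts n" for p
  proof -
    obtain h us e where d: "p = (h, us, e)" "h \<in> NW (Fhat n)" "us \<in> lists (NM n)" "e \<in> NW (Fone n)"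
      using p by (auto simp: parts_def)
    note g = gh[OF d(2)] gn[OF d(3)] ge[OF d(4)]
    have w: "e @ (cat us @ h) \<in> NW (Fall n)" using glue_NW[OF p] by (simp add: d(1) glue_def)
    have "\<psi> (\<gamma> p) = (rw n h \<otimes> rw n (cat us)) \<otimes> rw n e"
      using g HN.pure_tensor(1) by (simp add: d(1) \<gamma>_def \<psi>(2) m(2))
    also have "\<dots> = rw n (e @ (cat us @ h))"
      using rw_append[OF w] rw_append[of "cat us" h] NW_append[OF w] by simp
    finally show ?thesis by (simp add: d(1) glue_def)
  qed
  have span: "carrier ?T = vspan ?T (\<gamma> ` parts n)"
  proof -
    have "carrier ?U = vspan ?U {pure_tensor Qhat N s t |s t. s \<in> rw n ` NW (Fhat n) \<and> t \<in> (\<lambda>us. rw n (cat us)) ` lists (NM n)}"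
      (is "_ = vspan ?U ?P")
    proof (rule HN.tensor_prod_span)
      show "carrier Qhat \<subseteq> vspan Qhat (rw n ` NW (Fhat n))"
        "carrier N \<subseteq> vspan N ((\<lambda>us. rw n (cat us)) ` lists (NM n))"
        by (simp_all add: ch cn) (simp_all add: Qhat_def N_def vspan_sub)
    qed (auto simp: ch cn intro: vspan.incl)
    moreover have Pc: "?P \<subseteq> carrier ?U"
    proof
      fix t assume "t \<in> ?P"
      then obtain h us where "h \<in> NW (Fhat n)" "us \<in> lists (NM n)"
        "t = pure_tensor Qhat N (rw n h) (rw n (cat us))" by blast
      then show "t \<in> carrier ?U" using HN.pure_tensor(1)[OF gh gn] by simp
    qed
    ultimately have "carrier ?T = vspan ?T {pure_tensor ?U Q1 s t |s t. s \<in> ?P \<and> t \<in> rw n ` NW (Fone n)}"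
    proof (intro UO.tensor_prod_span)
      show "carrier Q1 \<subseteq> vspan Q1 (rw n ` NW (Fone n))"
        by (simp add: co) (simp add: Q1_def vspan_sub)
    qed (auto simp: co intro: vspan.incl)
    also have "{pure_tensor ?U Q1 s t |s t. s \<in> ?P \<and> t \<in> rw n ` NW (Fone n)} = \<gamma> ` parts n"
    proof (intro equalityI subsetI)
      fix t assume "t \<in> {pure_tensor ?U Q1 s t |s t. s \<in> ?P \<and> t \<in> rw n ` NW (Fone n)}"
      then obtain h us e where d: "h \<in> NW (Fhat n)" "us \<in> lists (NM n)" "e \<in> NW (Fone n)"
        "t = pure_tensor ?U Q1 (pure_tensor Qhat N (rw n h) (rw n (cat us))) (rw n e)" by blast
      then have "t = \<gamma> (h, us, e)" "(h, us, e) \<in> parts n" by (simp_all add: \<gamma>_def parts_def)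
      then show "t \<in> \<gamma> ` parts n" by blast
    next
      fix t assume "t \<in> \<gamma> ` parts n"
      then obtain h us e where d: "h \<in> NW (Fhat n)" "us \<in> lists (NM n)" "e \<in> NW (Fone n)"
        "t = pure_tensor ?U Q1 (pure_tensor Qhat N (rw n h) (rw n (cat us))) (rw n e)"
        by (auto simp: \<gamma>_def parts_def)
      then show "t \<in> {pure_tensor ?U Q1 s t |s t. s \<in> ?P \<and> t \<in> rw n ` NW (Fone n)}" by blast
    qed
    finally show ?thesis .
  qed
  have "indep Q (parts n) (\<lambda>p. rw n (glue p))"
    using glue_NW inj_glue by (intro Q.indep_reindex[OF rw_indep] rw_image_closed) auto
  moreover have "lincomb Q (\<lambda>p. \<psi> (\<gamma> p)) q = lincomb Q (\<lambda>p. rw n (glue p)) q" if "keys q \<subseteq> parts n" for q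
  proof (rule Q.lincomb_cong)
    show "(\<lambda>p. rw n (glue p)) ` keys q \<subseteq> carrier Q"
      using that by (intro image_subsetI rw_closed glue_NW) blast
    show "\<psi> (\<gamma> p) = rw n (glue p)" if "p \<in> keys q" for p
      using that \<open>keys q \<subseteq> parts n\<close> by (intro \<psi>\<gamma>) blast
  qed
  ultimately have "indep Q (parts n) (\<lambda>p. \<psi> (\<gamma> p))"
    by (simp add: indep_def)
  from \<psi>.inj_on_if_indep[OF span \<gamma>c this] have inj: "inj_on \<psi> (carrier ?T)" .
  have im: "\<psi> ` \<gamma> ` parts n = rw n ` NW (Fall n)"
  proof -
    have "\<psi> ` \<gamma> ` parts n = rw n ` glue ` parts n"
      unfolding image_image by (intro image_cong refl \<psi>\<gamma>)
    also have "glue ` parts n = NW (Fall n)" using glue_NW glue_surj by blast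
    finally show ?thesis .
  qed
  have "\<psi> ` carrier ?T = carrier Q"
    unfolding span \<psi>.h_vspan[OF \<gamma>c] im carrier_Q ..
  with inj have iso: "linear_iso ?T Q \<psi>"
    by (simp add: linear_iso_def bij_betw_def \<psi>.h)
  let ?gU = "tensor_grading Qhat (gr Qhat) N (gr N)"
  \<comment> \<open>Products of homogeneous elements are homogeneous, which bounds the image of each
    graded piece from above.\<close>
  have mU: "t \<in> carrier ?U" "m t \<in> Qn_deg n i" if "t \<in> ?gU i" for t i
  proof -
    let ?S = "{pure_tensor Qhat N a b |a b k l. a \<in> gr Qhat k \<and> b \<in> gr N l \<and> k + l = i}"
    have S: "?S \<subseteq> carrier ?U" using HN.pure_tensor(1) by (auto simp: gr_def)
    have t: "t \<in> vspan ?U ?S" using that by (simp add: tensor_grading_def)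
    then show "t \<in> carrier ?U" using U.vspan_closed[OF S] by blast
    have "m ` ?S \<subseteq> Qn_deg n i" using Qn_deg_mult by (auto simp: gr_def m(2))
    then have "vspan Q (m ` ?S) \<subseteq> Qn_deg n i" by (rule Q.vspan_least[OF Qn_deg_subspace])
    then show "m t \<in> Qn_deg n i" using t m.h_vspan[OF S] by blast
  qed
  have deg: "\<psi> ` tensor_grading ?U ?gU Q1 (gr Q1) d = Qn_deg n d" for d
  proof -
    let ?S = "{pure_tensor ?U Q1 t c |t c i j. t \<in> ?gU i \<and> c \<in> gr Q1 j \<and> i + j = d}"
    have S: "?S \<subseteq> carrier ?T" using UO.pure_tensor(1) mU(1) by (auto simp: gr_def)
    have "\<psi> ` tensor_grading ?U ?gU Q1 (gr Q1) d = vspan Q (\<psi> ` ?S)"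
      unfolding tensor_grading_def[of ?U] by (rule \<psi>.h_vspan[OF S])
    also have "\<dots> = Qn_deg n d"
    proof
      have "\<psi> ` ?S \<subseteq> Qn_deg n d"
        using Qn_deg_mult mU by (auto simp: gr_def \<psi>(2))
      then show "vspan Q (\<psi> ` ?S) \<subseteq> Qn_deg n d" by (rule Q.vspan_least[OF Qn_deg_subspace])
      \<comment> \<open>Conversely, a basis word of degree d comes from a pure tensor of words whose
        lengths add up to d, because gluing concatenates strings.\<close>
      have "rw n w \<in> \<psi> ` ?S" if w: "w \<in> NW (Fall n)" "length (str w) = d" for w
      proof -
        obtain p where p: "p \<in> parts n" "glue p = w" using glue_surj[OF w(1)] by blast
        then obtain h us e where d: "p = (h, us, e)" "h \<in> NW (Fhat n)" "us \<in> lists (NM n)" "e \<in> NW (Fone n)"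
          by (auto simp: parts_def)
        have dg: "(rw n v :: 'f qel) \<in> Qn_deg n (length (str v))" if "v \<in> NW (Fall n)" for v
          unfolding Qn_deg_conv using that by (intro vspan.incl) auto
        have "h \<in> NW (Fall n)" "e \<in> NW (Fall n)" using d by (auto simp: NW_Fhat NW_Fone)
        then have g: "rw n h \<in> gr Qhat (length (str h))" "rw n (cat us) \<in> gr N (length (str (cat us)))"
          "rw n e \<in> gr Q1 (length (str e))"
          using gh[OF d(2)] gn[OF d(3)] ge[OF d(4)] dg cat_NW[OF d(3)] by (auto simp: gr_def)
        then have "pure_tensor Qhat N (rw n h) (rw n (cat us)) \<in> ?gU (length (str h) + length (str (cat us)))"
          unfolding tensor_grading_def by (intro vspan.incl CollectI exI conjI refl) auto
        moreover have "length (str h) + length (str (cat us)) + length (str e) = d"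
          using w(2) p(2) by (auto simp: d(1) glue_def str_append)
        ultimately have "\<gamma> p \<in> ?S" using g(3) unfolding \<gamma>_def d(1) prod.case
          by (intro CollectI exI conjI) (rule refl, assumption+)
        moreover have "rw n w = \<psi> (\<gamma> p)" using \<psi>\<gamma>[OF p(1)] p(2) by simp
        ultimately show ?thesis by (rule image_eqI[rotated])
      qed
      then show "Qn_deg n d \<subseteq> vspan Q (\<psi> ` ?S)"
        unfolding Qn_deg_conv by (intro Q.vspan_mono) blast
    qed
    finally show ?thesis .
  qed
  have "graded_iso ?T (tensor_grading ?U ?gU Q1 (gr Q1)) Q (Qn_deg n) \<psi>"
    using iso deg by (simp add: graded_iso_def)
  moreover have "\<psi> (pure_tensor ?U Q1 (pure_tensor Qhat N a b) c) = (a \<otimes> b) \<otimes> c"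
    if "a \<in> carrier Qhat" "b \<in> carrier N" "c \<in> carrier Q1" for a b c
    using that HN.pure_tensor(1) by (simp add: \<psi>(2) m(2))
  ultimately show ?thesis by blast
qed

end

theorem lemma4p4:
  fixes n :: nat
  assumes "n \<ge> 1"
  shows
    "let Q = (Qn n :: ('f::field, 'f qel) module);
         Qhat = sub Q (Qn_hat1 n); M = sub Q (Mn n); N = sub Q (Nn n); Q1 = sub Q (Qn_1 n);
         gr = (\<lambda>A d. carrier A \<inter> Qn_deg n d)
     in (\<exists>\<phi>. algebra_iso (tensor_alg M) N \<phi> \<and> (\<forall>m\<in>carrier M. \<phi> (tensor_incl M m) = m)) \<and>
        (\<exists>\<psi>. graded_iso
               (tensor_prod (tensor_prod Qhat N) Q1)
               (tensor_grading (tensor_prod Qhat N) (tensor_grading Qhat (gr Qhat) N (gr N)) Q1 (gr Q1))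
               Q (Qn_deg n) \<psi> \<and>
             (\<forall>a\<in>carrier Qhat. \<forall>b\<in>carrier N. \<forall>c\<in>carrier Q1.
               \<psi> (pure_tensor (tensor_prod Qhat N) Q1 (pure_tensor Qhat N a b) c)
                 = (a \<otimes>\<^bsub>Q\<^esub> b) \<otimes>\<^bsub>Q\<^esub> c))"
  unfolding Let_def using tensor_M_iso[OF refl, of n] tensor_decomposition[OF refl, of n] by (rule conjI)

end
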